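(* Suppose $(G_i,c_i)$, $i\in I$, are circularly-ordered groups, each equipped with a subgroup $H_i\subset G_i$ and an order-preserving isomorphism $\phi_i:(H,d)\to(H_i,c_i)$ from a circularly-ordered group $(H,d)$ (where $H_i$ carries the restriction of $c_i$). If $(H,d)$ is either: (1) a subgroup of the group of rational points of $S^1$ equipped with the standard ordering; or (2) $\mathbb{Q}$ or $\mathbb{Z}$ equipped with the ordering $d$ satisfying $d(q_1,q_2,q_3)=1$ if and only if $q_1<q_2<q_3$ (up to cyclic permutation of $q_1,q_2,q_3$), then the free product with amalgamation $*_{i\in I}G_i\,(H_i\stackrel{\phi_i}{\cong}H)$ admits a circular ordering that extends each of the $c_i$.
   Context: A circular ordering of a group $G$ is a function $c:G^3\to\{0,\pm1\}$ such that: $c(a_1,a_2,a_3)=0$ if and only if $a_i=a_j$ for some $i\ne j$; $c(a_2,a_3,a_4)-c(a_1,a_3,a_4)+c(a_1,a_2,a_4)-c(a_1,a_2,a_3)=0$ for all $a_1,\dots,a_4\in G$; and $c(ga_1,ga_2,ga_3)=c(a_1,a_2,a_3)$ for all $g,a_1,a_2,a_3\in G$. A pair $(G,c)$ is a circularly-ordered group. A homomorphism $\phi:(G,c)\to(H,d)$ is order-preserving if $c(g_1,g_2,g_3)=d(\phi(g_1),\phi(g_2),\phi(g_3))$ for all $g_1,g_2,g_3\in G$. The rational points of $S^1=\{z\in\mathbb{C}:|z|=1\}$ are the elements $e^{2\pi i q}$ with $q\in\mathbb{Q}$. The standard ordering of $S^1$ (restricted to subgroups) assigns to a triple of distinct points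 the value $+1$ if it is in counterclockwise cyclic order and $-1$ otherwise. $*_{i\in I}G_i\,(H_i\stackrel{\phi_i}{\cong}H)$ denotes the free product of the $G_i$ amalgamated by identifying $\phi_i(h)$ with $\phi_j(h)$ for all $h\in H$, $i,j\in I$. Each $G_i$ is regarded as a subgroup of it, and an ordering of the amalgam extends $c_i$ if it restricts to $c_i$ on $G_i$. *)

theory Defs
  imports "HOL-Algebra.Elementary_Groups" Complex_Main
begin

section \<open>Circularly ordered groups\<close>

definition circular_ordering :: "('g, 'm) monoid_scheme \<Rightarrow> ('g \<Rightarrow> 'g \<Rightarrow> 'g \<Rightarrow> int) \<Rightarrow> bool"
  where "circular_ordering G c \<longleftrightarrow>
    (\<forall>x\<in>carrier G. \<forall>y\<in>carrier G. \<forall>z\<in>carrier G. c x y z \<in> {-1, 0, 1}) \<and>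
    (\<forall>x\<in>carrier G. \<forall>y\<in>carrier G. \<forall>z\<in>carrier G.
       c x y z = 0 \<longleftrightarrow> x = y \<or> y = z \<or> x = z) \<and>
    (\<forall>w\<in>carrier G. \<forall>x\<in>carrier G. \<forall>y\<in>carrier G. \<forall>z\<in>carrier G.
       c x y z - c w y z + c w x z - c w x y = 0) \<and>
    (\<forall>g\<in>carrier G. \<forall>x\<in>carrier G. \<forall>y\<in>carrier G. \<forall>z\<in>carrier G.
       c (g \<otimes>\<^bsub>G\<^esub> x) (g \<otimes>\<^bsub>G\<^esub> y) (g \<otimes>\<^bsub>G\<^esub> z) = c x y z)"

definition circularly_ordered_group ::
  "('g, 'm) monoid_scheme \<Rightarrow> ('g \<Rightarrow> 'g \<Rightarrow> 'g \<Rightarrow> int) \<Rightarrow> bool"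
  where "circularly_ordered_group G c \<longleftrightarrow> group G \<and> circular_ordering G c"

definition order_preserving_hom ::
  "('g, 'm) monoid_scheme \<Rightarrow> ('g \<Rightarrow> 'g \<Rightarrow> 'g \<Rightarrow> int) \<Rightarrow>
   ('h, 'n) monoid_scheme \<Rightarrow> ('h \<Rightarrow> 'h \<Rightarrow> 'h \<Rightarrow> int) \<Rightarrow> ('g \<Rightarrow> 'h) \<Rightarrow> bool"
  where "order_preserving_hom G c H d f \<longleftrightarrow> f \<in> hom G H \<and>
    (\<forall>x\<in>carrier G. \<forall>y\<in>carrier G. \<forall>z\<in>carrier G. c x y z = d (f x) (f y) (f z))"

definition order_preserving_iso ::
  "('g, 'm) monoid_scheme \<Rightarrow> ('g \<Rightarrow> 'g \<Rightarrow> 'g \<Rightarrow> int) \<Rightarrow>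
   ('h, 'n) monoid_scheme \<Rightarrow> ('h \<Rightarrow> 'h \<Rightarrow> 'h \<Rightarrow> int) \<Rightarrow> ('g \<Rightarrow> 'h) \<Rightarrow> bool"
  where "order_preserving_iso G c H d f \<longleftrightarrow>
    order_preserving_hom G c H d f \<and> f \<in> iso G H"


section \<open>The rational points of the circle, the rationals and the integers\<close>

definition rational_circle_group :: "complex monoid"
  where "rational_circle_group =
    \<lparr>carrier = range (\<lambda>q. exp (2 * of_real pi * \<i> * of_rat q)), monoid.mult = (*), one = 1\<rparr>"

text \<open>Three points of the unit circle are in counterclockwise cyclic order if they are met in this
  order, at increasing angles, within a single turn.\<close>

definition counterclockwise :: "complex \<Rightarrow> complex \<Rightarrow> complex \<Rightarrow> bool"
  where "counterclockwise x y z \<longleftrightarrow>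
    (\<exists>r s t. r < s \<and> s < t \<and> t < r + 2 * pi \<and> x = cis r \<and> y = cis s \<and> z = cis t)"

definition circle_ordering :: "complex \<Rightarrow> complex \<Rightarrow> complex \<Rightarrow> int"
  where "circle_ordering x y z =
    (if x = y \<or> y = z \<or> x = z then 0 else if counterclockwise x y z then 1 else -1)"

definition rational_group :: "rat monoid"
  where "rational_group = \<lparr>carrier = UNIV, monoid.mult = (+), one = 0\<rparr>"

definition cyclic_ordering :: "'a::linorder \<Rightarrow> 'a \<Rightarrow> 'a \<Rightarrow> int"
  where "cyclic_ordering x y z =
    (if x = y \<or> y = z \<or> x = z then 0
     else if x < y \<and> y < z \<or> y < z \<and> z < x \<or> z < x \<and> x < y then 1 else -1)"

lemma cyclic_ordering_values: "cyclic_ordering x y z \<in> {-1, 0, 1}"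
  and cyclic_ordering_zero: "cyclic_ordering x y z = 0 \<longleftrightarrow> x = y \<or> y = z \<or> x = z"
  by (simp_all add: cyclic_ordering_def)

lemma cyclic_ordering_cocycle:
  fixes w x y z :: "'a::linorder"
  shows "cyclic_ordering x y z - cyclic_ordering w y z + cyclic_ordering w x z
    - cyclic_ordering w x y = 0"
proof -
  define s where "s a b = (if a < b then 1 else if a = b then 0 else -1 :: int)" for a b :: 'a
  have anti: "s a b = - s b a" for a b by (cases a b rule: linorder_cases) (auto simp: s_def)
  have "cyclic_ordering a b e = s a b + s b e + s e a" for a b e
    unfolding cyclic_ordering_def s_def
    by (cases a b rule: linorder_cases; cases b e rule: linorder_cases;
        cases a e rule: linorder_cases) auto
  then show ?thesis using anti [of w y] anti [of w z] anti [of x z] by simp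
qed

lemma group_rational_circle_group: "group rational_circle_group"
proof (rule groupI)
  let ?e = "\<lambda>q::rat. exp (2 * of_real pi * \<i> * of_rat q) :: complex"
  have add: "?e p * ?e q = ?e (p + q)" for p q
    by (simp add: exp_add [symmetric] of_rat_add distrib_left)
  have one: "?e 0 = 1" by simp
  fix x y assume "x \<in> carrier rational_circle_group" "y \<in> carrier rational_circle_group"
  then show "x \<otimes>\<^bsub>rational_circle_group\<^esub> y \<in> carrier rational_circle_group"
    using add by (fastforce simp: rational_circle_group_def)
next
  fix x assume "x \<in> carrier rational_circle_group"
  then obtain q where q: "x = exp (2 * of_real pi * \<i> * of_rat q)"
    by (auto simp: rational_circle_group_def)
  have "exp (2 * of_real pi * \<i> * of_rat (- q)) * x = 1"
    by (simp add: q exp_add [symmetric] of_rat_minus)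
  then show "\<exists>y\<in>carrier rational_circle_group.
      y \<otimes>\<^bsub>rational_circle_group\<^esub> x = \<one>\<^bsub>rational_circle_group\<^esub>"
    unfolding rational_circle_group_def by auto
next
  have "(1::complex) = exp (2 * of_real pi * \<i> * of_rat 0)" by simp
  then show "\<one>\<^bsub>rational_circle_group\<^esub> \<in> carrier rational_circle_group"
    unfolding rational_circle_group_def by (metis partial_object.select_convs(1) monoid.select_convs(2) rangeI)
qed (auto simp: rational_circle_group_def mult.assoc)

lemma counterclockwise_antisym:
  assumes "counterclockwise x y z" shows "\<not> counterclockwise x z y"
proof
  assume "counterclockwise x z y"
  then obtain r' s' t' where 1: "r' < t'" "t' < s'" "s' < r' + 2 * pi"
    "x = cis r'" "y = cis s'" "z = cis t'" unfolding counterclockwise_def by blast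
  obtain r s t where 2: "r < s" "s < t" "t < r + 2 * pi" "x = cis r" "y = cis s" "z = cis t"
    using assms unfolding counterclockwise_def by blast
  have inj: "a = b" if ab: "cis a = cis b" "0 < a" "a < 2 * pi" "0 < b" "b < 2 * pi" for a b
  proof -
    obtain n :: int where n: "a = b + 2 * pi * n"
      using ab(1) sin_cos_eq_iff [of a b] by (auto simp: cis.ctr)
    with ab have "2 * pi * n < 2 * pi * 1" "2 * pi * (-1) < 2 * pi * n" by linarith+
    then have "real_of_int n < 1" "-1 < real_of_int n"
      using mult_less_cancel_left_pos [of "2 * pi"] pi_gt_zero by fastforce+
    then have "n = 0" by linarith
    with n show ?thesis by simp
  qed
  have "cis (s - r) = cis (s' - r')" "cis (t - r) = cis (t' - r')"
    using 1 2 by (simp_all flip: cis_divide)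
  then have "s - r = s' - r'" "t - r = t' - r'"
    using 1 2 by (auto intro!: inj)
  then show False using 1 2 by linarith
qed

lemma circle_ordering_eq_cyclic_ordering:
  assumes "cmod x = 1" "cmod y = 1" "cmod z = 1"
  shows "circle_ordering x y z = cyclic_ordering (Arg x) (Arg y) (Arg z)"
proof -
  have cis: "cis (Arg v) = v" if "cmod v = 1" for v
    using that cis_Arg [of v] by (force simp: sgn_div_norm)
  have bounds: "- pi < Arg v" "Arg v \<le> pi" for v using Arg_bounded by auto
  have eq: "u = v \<longleftrightarrow> Arg u = Arg v" if "cmod u = 1" "cmod v = 1" for u v
    using cis that by metis
  have ccw: "counterclockwise u v w"
    if "cmod u = 1" "cmod v = 1" "cmod w = 1" and
      "Arg u < Arg v \<and> Arg v < Arg w \<or> Arg v < Arg w \<and> Arg w < Arg u \<or> Arg w < Arg u \<and> Arg u < Arg v"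
    for u v w
  proof -
    have 2: "cis (Arg v + 2 * pi) = v" if "cmod v = 1" for v
      using cis [OF that] by (simp add: cis.ctr complex_eq_iff)
    from that(4) consider "Arg u < Arg v" "Arg v < Arg w" | "Arg v < Arg w" "Arg w < Arg u"
      | "Arg w < Arg u" "Arg u < Arg v" by blast
    then show ?thesis
    proof cases
      case 1
      then show ?thesis unfolding counterclockwise_def
        using bounds [of u] bounds [of w] cis that
        by (intro exI [of _ "Arg u"] exI [of _ "Arg v"] exI [of _ "Arg w"]) auto
    next
      case A: 2
      then show ?thesis unfolding counterclockwise_def
        using bounds [of u] bounds [of v] cis 2 that
        by (intro exI [of _ "Arg u"] exI [of _ "Arg v + 2 * pi"] exI [of _ "Arg w + 2 * pi"]) auto
    next
      case 3
      then show ?thesis unfolding counterclockwise_def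
        using bounds [of w] bounds [of v] cis 2 that
        by (intro exI [of _ "Arg u"] exI [of _ "Arg v"] exI [of _ "Arg w + 2 * pi"]) auto
    qed
  qed
  show ?thesis
  proof (cases "x = y \<or> y = z \<or> x = z")
    case True
    then show ?thesis by (auto simp: circle_ordering_def cyclic_ordering_def)
  next
    case False
    then have ne: "Arg x \<noteq> Arg y" "Arg y \<noteq> Arg z" "Arg x \<noteq> Arg z"
      using eq assms by blast+
    define p where "p \<longleftrightarrow> Arg x < Arg y \<and> Arg y < Arg z \<or> Arg y < Arg z \<and> Arg z < Arg x
      \<or> Arg z < Arg x \<and> Arg x < Arg y"
    have "p \<Longrightarrow> counterclockwise x y z"
      using ccw [of x y z] assms unfolding p_def by blast
    moreover have "counterclockwise x z y" if "\<not> p"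
    proof (rule ccw)
      show "Arg x < Arg z \<and> Arg z < Arg y \<or> Arg z < Arg y \<and> Arg y < Arg x
        \<or> Arg y < Arg x \<and> Arg x < Arg z"
        using ne that unfolding p_def by linarith
    qed (use assms in auto)
    ultimately have "counterclockwise x y z \<longleftrightarrow> p"
      using counterclockwise_antisym by blast
    then show ?thesis
      using False ne by (simp add: circle_ordering_def cyclic_ordering_def p_def)
  qed
qed

lemma circularly_ordered_rational_circle_group:
  "circularly_ordered_group rational_circle_group circle_ordering"
proof -
  have exp: "exp (2 * of_real pi * \<i> * of_rat q) = cis (2 * pi * of_rat q)" for q :: rat
  proof -
    have "of_rat q = complex_of_real (of_rat q)" by (cases q) (simp add: of_rat_rat)
    then show ?thesis by (simp add: cis_conv_exp mult_ac)
  qed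
  have unit: "cmod x = 1" if "x \<in> carrier rational_circle_group" for x
    using that by (auto simp: rational_circle_group_def exp)
  have rot: "counterclockwise (g * x) (g * y) (g * z)"
    if "cmod g = 1" "counterclockwise x y z" for g x y z
  proof -
    from that(2) obtain r s t
      where *: "r < s" "s < t" "t < r + 2 * pi" "x = cis r" "y = cis s" "z = cis t"
      unfolding counterclockwise_def by blast
    have g: "cis (Arg g) = g" using that cis_Arg [of g] by (force simp: sgn_div_norm)
    have "g * x = cis (Arg g + r)" "g * y = cis (Arg g + s)" "g * z = cis (Arg g + t)"
      by (simp_all add: * g flip: cis_mult)
    then show ?thesis using * unfolding counterclockwise_def
      by (intro exI [of _ "Arg g + r"] exI [of _ "Arg g + s"] exI [of _ "Arg g + t"]) simp
  qed
  have "circle_ordering (g * x) (g * y) (g * z) = circle_ordering x y z" if "cmod g = 1" for g x y z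
  proof -
    have g: "g \<noteq> 0" "cmod (inverse g) = 1" using that by (auto simp: norm_inverse)
    have "counterclockwise (g * x) (g * y) (g * z) \<longleftrightarrow> counterclockwise x y z"
      using rot [OF that, of x y z] rot [OF g(2), of "g * x" "g * y" "g * z"] g(1)
      by (auto simp: mult.assoc [symmetric])
    then show ?thesis using g by (simp add: circle_ordering_def)
  qed
  moreover have "circle_ordering x y z - circle_ordering w y z + circle_ordering w x z
      - circle_ordering w x y = 0" if "cmod w = 1" "cmod x = 1" "cmod y = 1" "cmod z = 1" for w x y z
    using that cyclic_ordering_cocycle by (simp add: circle_ordering_eq_cyclic_ordering)
  ultimately have "circular_ordering rational_circle_group circle_ordering"
    using unit unfolding circular_ordering_def
    by (simp add: rational_circle_group_def) (auto simp: circle_ordering_def)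
  then show ?thesis by (simp add: circularly_ordered_group_def group_rational_circle_group)
qed

lemma circularly_ordered_rational_group: "circularly_ordered_group rational_group cyclic_ordering"
proof -
  have "group rational_group"
  proof (rule groupI)
    fix x
    have "- x \<otimes>\<^bsub>rational_group\<^esub> x = \<one>\<^bsub>rational_group\<^esub>" by (simp add: rational_group_def)
    then show "\<exists>y\<in>carrier rational_group. y \<otimes>\<^bsub>rational_group\<^esub> x = \<one>\<^bsub>rational_group\<^esub>"
      by (intro bexI [of _ "- x"]) (simp_all add: rational_group_def)
  qed (simp_all add: rational_group_def add.assoc)
  moreover have "circular_ordering rational_group cyclic_ordering"
    unfolding circular_ordering_def
    by (intro conjI ballI cyclic_ordering_values cyclic_ordering_zero cyclic_ordering_cocycle)
      (simp add: rational_group_def cyclic_ordering_def)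
  ultimately show ?thesis by (simp add: circularly_ordered_group_def)
qed

lemma circularly_ordered_integer_group: "circularly_ordered_group integer_group cyclic_ordering"
proof -
  have "circular_ordering integer_group cyclic_ordering"
    unfolding circular_ordering_def
    by (intro conjI ballI cyclic_ordering_values cyclic_ordering_zero cyclic_ordering_cocycle)
      (simp add: cyclic_ordering_def)
  then show ?thesis by (simp add: circularly_ordered_group_def)
qed


section \<open>Free products with amalgamation\<close>

text \<open>The free product of the groups \<open>G i\<close>, amalgamated along maps \<open>\<phi> i\<close> from \<open>H\<close>: words in the
  letters \<open>(i, g)\<close> with \<open>g\<close> in \<open>G i\<close>, modulo the congruence generated by the relations of the
  \<open>G i\<close> and by \<open>\<phi> i h = \<phi> j h\<close>.\<close>

definition amalgam_words :: "'i set \<Rightarrow> ('i \<Rightarrow> ('g, 'm) monoid_scheme) \<Rightarrow> ('i \<times> 'g) list set"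
  where "amalgam_words I G = lists (SIGMA i:I. carrier (G i))"

inductive amalgam_eq ::
  "'i set \<Rightarrow> ('i \<Rightarrow> ('g, 'm) monoid_scheme) \<Rightarrow> ('h, 'n) monoid_scheme \<Rightarrow> ('i \<Rightarrow> 'h \<Rightarrow> 'g) \<Rightarrow>
   ('i \<times> 'g) list \<Rightarrow> ('i \<times> 'g) list \<Rightarrow> bool"
  for I G H \<phi> where
  refl: "u \<in> amalgam_words I G \<Longrightarrow> amalgam_eq I G H \<phi> u u"
| sym: "amalgam_eq I G H \<phi> u v \<Longrightarrow> amalgam_eq I G H \<phi> v u"
| trans: "amalgam_eq I G H \<phi> u v \<Longrightarrow> amalgam_eq I G H \<phi> v w \<Longrightarrow> amalgam_eq I G H \<phi> u w"
| append: "amalgam_eq I G H \<phi> u u' \<Longrightarrow> amalgam_eq I G H \<phi> v v' \<Longrightarrow>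
    amalgam_eq I G H \<phi> (u @ v) (u' @ v')"
| one: "i \<in> I \<Longrightarrow> amalgam_eq I G H \<phi> [(i, \<one>\<^bsub>G i\<^esub>)] []"
| mult: "i \<in> I \<Longrightarrow> a \<in> carrier (G i) \<Longrightarrow> b \<in> carrier (G i) \<Longrightarrow>
    amalgam_eq I G H \<phi> [(i, a), (i, b)] [(i, a \<otimes>\<^bsub>G i\<^esub> b)]"
| amalgamate: "i \<in> I \<Longrightarrow> j \<in> I \<Longrightarrow> h \<in> carrier H \<Longrightarrow>
    amalgam_eq I G H \<phi> [(i, \<phi> i h)] [(j, \<phi> j h)]"

definition amalgam_class ::
  "'i set \<Rightarrow> ('i \<Rightarrow> ('g, 'm) monoid_scheme) \<Rightarrow> ('h, 'n) monoid_scheme \<Rightarrow> ('i \<Rightarrow> 'h \<Rightarrow> 'g) \<Rightarrow>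
   ('i \<times> 'g) list \<Rightarrow> ('i \<times> 'g) list set"
  where "amalgam_class I G H \<phi> u = {v. amalgam_eq I G H \<phi> u v}"

definition amalgamated_product ::
  "'i set \<Rightarrow> ('i \<Rightarrow> ('g, 'm) monoid_scheme) \<Rightarrow> ('h, 'n) monoid_scheme \<Rightarrow> ('i \<Rightarrow> 'h \<Rightarrow> 'g) \<Rightarrow>
   ('i \<times> 'g) list set monoid"
  where "amalgamated_product I G H \<phi> =
    \<lparr>carrier = amalgam_class I G H \<phi> ` amalgam_words I G,
     monoid.mult = (\<lambda>A B. \<Union>u\<in>A. \<Union>v\<in>B. amalgam_class I G H \<phi> (u @ v)),
     one = amalgam_class I G H \<phi> []\<rparr>"

definition amalgam_incl ::
  "'i set \<Rightarrow> ('i \<Rightarrow> ('g, 'm) monoid_scheme) \<Rightarrow> ('h, 'n) monoid_scheme \<Rightarrow> ('i \<Rightarrow> 'h \<Rightarrow> 'g) \<Rightarrow>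
   'i \<Rightarrow> 'g \<Rightarrow> ('i \<times> 'g) list set"
  where "amalgam_incl I G H \<phi> i g = amalgam_class I G H \<phi> [(i, g)]"

lemma amalgam_words_Nil [simp]: "[] \<in> amalgam_words I G"
  and amalgam_words_Cons [simp]:
    "(i, g) # u \<in> amalgam_words I G \<longleftrightarrow> i \<in> I \<and> g \<in> carrier (G i) \<and> u \<in> amalgam_words I G"
  and amalgam_words_append [simp]:
    "u @ v \<in> amalgam_words I G \<longleftrightarrow> u \<in> amalgam_words I G \<and> v \<in> amalgam_words I G"
  by (auto simp: amalgam_words_def)

locale amalgam_diagram =
  fixes I :: "'i set" and G :: "'i \<Rightarrow> ('g, 'm) monoid_scheme"
    and H :: "('h, 'n) monoid_scheme" and \<phi> :: "'i \<Rightarrow> 'h \<Rightarrow> 'g"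
  assumes groups: "\<And>i. i \<in> I \<Longrightarrow> group (G i)"
    and maps: "\<And>i. i \<in> I \<Longrightarrow> \<phi> i \<in> hom H (G i)"
begin

abbreviation "P \<equiv> amalgamated_product I G H \<phi>"
abbreviation "cls \<equiv> amalgam_class I G H \<phi>"
abbreviation "W \<equiv> amalgam_words I G"

lemma amalgam_eq_words: "amalgam_eq I G H \<phi> u v \<Longrightarrow> u \<in> W \<and> v \<in> W"
proof (induction rule: amalgam_eq.induct)
  case (one i)
  then show ?case using groups by (simp add: group.is_monoid monoid.one_closed)
next
  case (mult i a b)
  then show ?case using groups by (simp add: group.is_monoid monoid.m_closed)
next
  case (amalgamate i j h)
  then show ?case using hom_in_carrier [OF maps] by simp
qed auto

lemma cls_eq_iff:
  assumes "u \<in> W" shows "cls u = cls v \<longleftrightarrow> amalgam_eq I G H \<phi> u v"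
proof
  assume "cls u = cls v"
  moreover have "u \<in> cls u" using assms by (simp add: amalgam_class_def amalgam_eq.refl)
  ultimately show "amalgam_eq I G H \<phi> u v" by (simp add: amalgam_class_def amalgam_eq.sym)
next
  assume "amalgam_eq I G H \<phi> u v"
  then show "cls u = cls v"
    unfolding amalgam_class_def by (blast intro: amalgam_eq.sym amalgam_eq.trans)
qed

lemma mult_cls:
  assumes "u \<in> W" "v \<in> W" shows "cls u \<otimes>\<^bsub>P\<^esub> cls v = cls (u @ v)"
proof -
  have "cls (u' @ v') = cls (u @ v)" if "u' \<in> cls u" "v' \<in> cls v" for u' v'
    using that assms cls_eq_iff [of "u @ v" "u' @ v'"]
    by (simp add: amalgam_class_def amalgam_eq.append)
  moreover have "u \<in> cls u" "v \<in> cls v"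
    using assms by (simp_all add: amalgam_class_def amalgam_eq.refl)
  ultimately have "(\<Union>u'\<in>cls u. \<Union>v'\<in>cls v. cls (u' @ v')) = cls (u @ v)"
    by blast
  then show ?thesis by (simp add: amalgamated_product_def)
qed

lemma carrier_P: "carrier P = cls ` W" and one_P: "\<one>\<^bsub>P\<^esub> = cls []"
  by (simp_all add: amalgamated_product_def)

lemma letter_inverse:
  assumes "i \<in> I" "g \<in> carrier (G i)"
  shows "amalgam_eq I G H \<phi> [(i, inv\<^bsub>G i\<^esub> g), (i, g)] []"
proof -
  interpret group "G i" using groups assms by blast
  from amalgam_eq.mult [of i I "inv\<^bsub>G i\<^esub> g" G g H \<phi>] assms
  have "amalgam_eq I G H \<phi> [(i, inv\<^bsub>G i\<^esub> g), (i, g)] [(i, \<one>\<^bsub>G i\<^esub>)]" by simp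
  then show ?thesis using amalgam_eq.one [OF assms(1)] amalgam_eq.trans by blast
qed

lemma word_inverse: "u \<in> W \<Longrightarrow> \<exists>v\<in>W. amalgam_eq I G H \<phi> (v @ u) []"
proof (induction u)
  case Nil
  then show ?case by (intro bexI [of _ "[]"]) (simp_all add: amalgam_eq.refl)
next
  case (Cons x u)
  obtain i g where x: "x = (i, g)" by force
  with Cons obtain v where v: "v \<in> W" "amalgam_eq I G H \<phi> (v @ u) []" by auto
  have ig: "i \<in> I" "g \<in> carrier (G i)" "u \<in> W" using Cons x by auto
  have inv: "inv\<^bsub>G i\<^esub> g \<in> carrier (G i)" using groups ig by (simp add: group.inv_closed)
  have "amalgam_eq I G H \<phi> ([(i, inv\<^bsub>G i\<^esub> g), (i, g)] @ u) ([] @ u)"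
    by (rule amalgam_eq.append [OF letter_inverse amalgam_eq.refl]) (use ig in auto)
  then have "amalgam_eq I G H \<phi> (v @ ([(i, inv\<^bsub>G i\<^esub> g), (i, g)] @ u)) (v @ ([] @ u))"
    using v by (intro amalgam_eq.append [OF amalgam_eq.refl])
  then have "amalgam_eq I G H \<phi> ((v @ [(i, inv\<^bsub>G i\<^esub> g)]) @ (x # u)) []"
    using v(2) x amalgam_eq.trans by fastforce
  then show ?case using v ig inv by (intro bexI [of _ "v @ [(i, inv\<^bsub>G i\<^esub> g)]"]) auto
qed

lemma group_amalgamated_product: "group P"
proof (rule groupI)
  fix x assume "x \<in> carrier P"
  then obtain u where u: "u \<in> W" "x = cls u" by (auto simp: carrier_P)
  then obtain v where v: "v \<in> W" "amalgam_eq I G H \<phi> (v @ u) []" using word_inverse by blast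
  have "cls v \<otimes>\<^bsub>P\<^esub> x = \<one>\<^bsub>P\<^esub>"
    using u v by (simp add: mult_cls one_P cls_eq_iff)
  then show "\<exists>y\<in>carrier P. y \<otimes>\<^bsub>P\<^esub> x = \<one>\<^bsub>P\<^esub>" using v by (auto simp: carrier_P)
qed (auto simp: carrier_P one_P mult_cls)

lemma amalgam_incl_hom: "i \<in> I \<Longrightarrow> amalgam_incl I G H \<phi> i \<in> hom (G i) P"
proof (rule homI)
  fix a b assume "i \<in> I" "a \<in> carrier (G i)" "b \<in> carrier (G i)"
  moreover from this have "a \<otimes>\<^bsub>G i\<^esub> b \<in> carrier (G i)"
    using groups by (simp add: group.is_monoid monoid.m_closed)
  ultimately show "amalgam_incl I G H \<phi> i (a \<otimes>\<^bsub>G i\<^esub> b) =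
      amalgam_incl I G H \<phi> i a \<otimes>\<^bsub>P\<^esub> amalgam_incl I G H \<phi> i b"
    by (simp add: amalgam_incl_def mult_cls cls_eq_iff amalgam_eq.sym amalgam_eq.mult)
qed (simp add: amalgam_incl_def carrier_P)

lemma amalgam_incl_agree:
  "i \<in> I \<Longrightarrow> j \<in> I \<Longrightarrow> h \<in> carrier H \<Longrightarrow>
   amalgam_incl I G H \<phi> i (\<phi> i h) = amalgam_incl I G H \<phi> j (\<phi> j h)"
  using hom_in_carrier [OF maps]
  by (simp add: amalgam_incl_def cls_eq_iff amalgam_eq.amalgamate)

lemma amalgamated_product_universal:
  fixes K :: "('k, 'l) monoid_scheme"
  assumes K: "group K" and f: "\<And>i. i \<in> I \<Longrightarrow> f i \<in> hom (G i) K"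
    and agree: "\<And>i j h. i \<in> I \<Longrightarrow> j \<in> I \<Longrightarrow> h \<in> carrier H \<Longrightarrow> f i (\<phi> i h) = f j (\<phi> j h)"
  shows "\<exists>F\<in>hom P K. (\<forall>i\<in>I. \<forall>g\<in>carrier (G i). F (amalgam_incl I G H \<phi> i g) = f i g) \<and>
    (\<forall>F'\<in>hom P K. (\<forall>i\<in>I. \<forall>g\<in>carrier (G i). F' (amalgam_incl I G H \<phi> i g) = f i g) \<longrightarrow>
      (\<forall>x\<in>carrier P. F' x = F x))"
proof -
  interpret K: group K by (rule K)
  define ev where "ev u = foldr (\<lambda>(i, g) k. f i g \<otimes>\<^bsub>K\<^esub> k) u \<one>\<^bsub>K\<^esub>" for u
  have fc: "f i g \<in> carrier K" if "i \<in> I" "g \<in> carrier (G i)" for i g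
    using f [OF that(1)] that by (simp add: hom_in_carrier)
  have evc: "ev u \<in> carrier K" if "u \<in> W" for u
    using that by (induction u) (auto simp: ev_def fc)
  have eva: "ev (u @ v) = ev u \<otimes>\<^bsub>K\<^esub> ev v" if "u \<in> W" "v \<in> W" for u v
    using that(1)
  proof (induction u)
    case Nil
    then show ?case using evc [OF that(2)] by (simp add: ev_def)
  next
    case (Cons x u)
    obtain i g where "x = (i, g)" by force
    then show ?case using Cons evc [of u] evc [OF that(2)] fc [of i g]
      by (simp add: ev_def K.m_assoc)
  qed
  have ev1: "ev [(i, g)] = f i g" if "i \<in> I" "g \<in> carrier (G i)" for i g
    using fc that by (simp add: ev_def)
  have ev_eq: "amalgam_eq I G H \<phi> u v \<Longrightarrow> ev u = ev v" for u v
  proof (induction rule: amalgam_eq.induct)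
    case (append u u' v v')
    then show ?case by (metis eva amalgam_eq_words)
  next
    case (one i)
    then show ?case using f [OF one] groups [OF one]
      by (simp add: ev_def hom_one [OF f [OF one] groups [OF one] K])
  next
    case (mult i a b)
    then show ?case using f [OF mult(1)] fc by (simp add: ev_def hom_mult K.m_assoc
          group.is_monoid [OF groups] monoid.m_closed)
  next
    case (amalgamate i j h)
    then show ?case using agree [OF amalgamate] by (simp add: ev_def)
  qed auto
  define F where "F A = ev (SOME u. u \<in> A)" for A
  have F: "F (cls u) = ev u" if "u \<in> W" for u
  proof -
    have "u \<in> cls u" using that by (simp add: amalgam_class_def amalgam_eq.refl)
    then have "(SOME u'. u' \<in> cls u) \<in> cls u" by (rule someI)
    then show ?thesis using ev_eq by (simp add: F_def amalgam_class_def)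
  qed
  have "F \<in> hom P K"
    by (rule homI) (auto simp: carrier_P mult_cls F evc eva)
  moreover have "\<forall>i\<in>I. \<forall>g\<in>carrier (G i). F (amalgam_incl I G H \<phi> i g) = f i g"
    by (simp add: amalgam_incl_def F ev1)
  moreover have "F' x = F x" if F': "F' \<in> hom P K"
    "\<forall>i\<in>I. \<forall>g\<in>carrier (G i). F' (amalgam_incl I G H \<phi> i g) = f i g" and x: "x \<in> carrier P" for F' x
  proof -
    have "F' (cls u) = ev u" if "u \<in> W" for u
      using that
    proof (induction u)
      case Nil
      then show ?case using hom_one [OF F'(1) group_amalgamated_product K]
        by (simp add: one_P ev_def)
    next
      case (Cons y u)
      obtain i g where y: "y = (i, g)" by force
      then have c: "[(i, g)] \<in> W" "u \<in> W" using Cons by auto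
      then have "cls (y # u) = cls [(i, g)] \<otimes>\<^bsub>P\<^esub> cls u" using mult_cls [of "[(i, g)]" u] y by simp
      then have "F' (cls (y # u)) = F' (cls [(i, g)]) \<otimes>\<^bsub>K\<^esub> F' (cls u)"
        using hom_mult [OF F'(1)] c by (simp add: carrier_P)
      also have "\<dots> = ev (y # u)"
        using Cons c F'(2) y by (simp add: amalgam_incl_def ev_def)
      finally show ?case .
    qed
    then show ?thesis using x F by (auto simp: carrier_P)
  qed
  ultimately show ?thesis by blast
qed

end

text \<open>\<open>G i\<close> is regarded as a subgroup of the amalgam by way of \<open>amalgam_incl I G H \<phi> i\<close>.
  Injectivity is stated separately because preservation of the orderings does not give it when
  \<open>G i\<close> has two elements (all triples are then degenerate).\<close>

definition extends_ordering ::
  "'i set \<Rightarrow> ('i \<Rightarrow> ('g, 'm) monoid_scheme) \<Rightarrow> ('h, 'n) monoid_scheme \<Rightarrow> ('i \<Rightarrow> 'h \<Rightarrow> 'g) \<Rightarrow>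
   (('i \<times> 'g) list set \<Rightarrow> ('i \<times> 'g) list set \<Rightarrow> ('i \<times> 'g) list set \<Rightarrow> int) \<Rightarrow>
   'i \<Rightarrow> ('g \<Rightarrow> 'g \<Rightarrow> 'g \<Rightarrow> int) \<Rightarrow> bool"
  where "extends_ordering I G H \<phi> C i c \<longleftrightarrow>
    inj_on (amalgam_incl I G H \<phi> i) (carrier (G i)) \<and>
    order_preserving_hom (G i) c (amalgamated_product I G H \<phi>) C (amalgam_incl I G H \<phi> i)"

end

theory Submission
  imports Defs
begin

text \<open>
  A circular order on the amalgam is constructed orbit by orbit, on the set of normal forms of its
  elements, with the groups \<open>G i\<close> acting by left multiplication. By the normal form theorem these
  actions have the shape of a tree: a set of normal forms that is closed under \<open>H\<close> and under
  changing or removing leftmost letters meets each orbit of \<open>G i\<close> either completely or in at most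
  one orbit of \<open>H\<close>. So the set of all normal forms is built up, starting from \<open>H\<close>, by adding an
  orbit of some \<open>G i\<close> along an orbit of \<open>H\<close> again and again, and Zorn's lemma reduces the theorem
  to one such step (\<open>partial_ordering_add_orbit\<close>, \<open>partial_ordering_extend\<close>,
  \<open>exists_invariant_order\<close>). The orbits of the empty normal form come first and receive the orders
  \<open>c i\<close>.

  A step has two halves. In the first (\<open>extend_to_orbit\<close>), let \<open>Y\<close> be the part of the set on which
  \<open>G i\<close> already acts, and \<open>x\<close> the point whose \<open>G i\<close>-orbit is to be added. The point \<open>x\<close> cuts the
  circle \<open>Y\<close> somewhere, and invariance forces \<open>g x\<close> to cut it in the translated position. This
  determines the position of \<open>g x\<close> up to the order among the points of the orbit with the same cut,
  which is a matter of a left order on the stabiliser \<open>K\<close> of that cut. There is one, because \<open>K\<close>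
  acts freely on the line into which the cut turns \<open>Y\<close>; but on \<open>K \<inter> H\<close> the order is prescribed, as
  the order on \<open>H x\<close> is already given. At this point the hypothesis on \<open>H\<close> enters. In a subgroup of
  the rational circle, in the rationals and in the integers, any two nontrivial elements have a
  common nonzero power. Hence \<open>K \<inter> H\<close> has at most two left orders, one the reverse of the other
  (\<open>order_sign_unique_up_to_sign\<close>), and the left order on \<open>K\<close> or its reverse is as prescribed.

  The second half (\<open>amalgamate_circular_orders\<close>) puts the new orbit together with the remaining old
  points. Their positions relative to \<open>Y\<close> and \<open>H x\<close> are known, and between points with the same
  position the old ones are put first. Only \<open>H\<close> acts on both sides, and it respects this rule.

  Both halves use that a circular order on a set is lexicographic over the cuts of any nonempty
  subset (\<open>circ_on_lex_circular\<close>, \<open>lex_circular_decomposition\<close>). A circular order is treated as the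
  coboundary of the sign function of a linear order, and a cut as a linear order with the given
  coboundary.
\<close>

section \<open>Circular orders and their cuts\<close>

text \<open>The sign function \<open>b\<close> of a linear order has the value \<open>1\<close> at \<open>u\<close> and \<open>v\<close> if \<open>u\<close> comes before
  \<open>v\<close>. Closing the line up to a circle amounts to taking the coboundary of \<open>b\<close>, and the cocycle
  identity of circular orders then holds because the coboundary of a coboundary vanishes.\<close>

definition coboundary :: "('a \<Rightarrow> 'a \<Rightarrow> int) \<Rightarrow> 'a \<Rightarrow> 'a \<Rightarrow> 'a \<Rightarrow> int"
  where "coboundary b u v w = b u v + b v w + b w u"

definition lin_on :: "'a set \<Rightarrow> ('a \<Rightarrow> 'a \<Rightarrow> int) \<Rightarrow> bool"
  where "lin_on X b \<longleftrightarrow>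
    (\<forall>u\<in>X. \<forall>v\<in>X. b u v \<in> {-1, 0, 1} \<and> (b u v = 0 \<longleftrightarrow> u = v) \<and> b v u = - b u v) \<and>
    (\<forall>u\<in>X. \<forall>v\<in>X. \<forall>w\<in>X. b u v = 1 \<longrightarrow> b v w = 1 \<longrightarrow> b u w = 1)"

text \<open>The conditions of \<open>circular_ordering\<close> without invariance, on a set instead of a group: the
  orders that are built below live on subsets of a set with a group action.\<close>

definition circ_on :: "'a set \<Rightarrow> ('a \<Rightarrow> 'a \<Rightarrow> 'a \<Rightarrow> int) \<Rightarrow> bool"
  where "circ_on X C \<longleftrightarrow>
    (\<forall>x\<in>X. \<forall>y\<in>X. \<forall>z\<in>X. C x y z \<in> {-1, 0, 1}) \<and>
    (\<forall>x\<in>X. \<forall>y\<in>X. \<forall>z\<in>X. C x y z = 0 \<longleftrightarrow> x = y \<or> y = z \<or> x = z) \<and>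
    (\<forall>w\<in>X. \<forall>x\<in>X. \<forall>y\<in>X. \<forall>z\<in>X. C x y z - C w y z + C w x z - C w x y = 0)"

lemma circular_ordering_iff:
  "circular_ordering G c \<longleftrightarrow> circ_on (carrier G) c \<and>
    (\<forall>g\<in>carrier G. \<forall>x\<in>carrier G. \<forall>y\<in>carrier G. \<forall>z\<in>carrier G.
      c (g \<otimes>\<^bsub>G\<^esub> x) (g \<otimes>\<^bsub>G\<^esub> y) (g \<otimes>\<^bsub>G\<^esub> z) = c x y z)"
  unfolding circular_ordering_def circ_on_def by (simp only: conj_assoc)

lemma lin_onD:
  assumes "lin_on X b" "u \<in> X" "v \<in> X"
  shows lin_on_values: "b u v = -1 \<or> b u v = 0 \<or> b u v = 1"
    and lin_on_zero: "b u v = 0 \<longleftrightarrow> u = v"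
    and lin_on_antisym: "b v u = - b u v"
  using assms unfolding lin_on_def by blast+

lemma lin_on_trans:
  "lin_on X b \<Longrightarrow> u \<in> X \<Longrightarrow> v \<in> X \<Longrightarrow> w \<in> X \<Longrightarrow> b u v = 1 \<Longrightarrow> b v w = 1 \<Longrightarrow> b u w = 1"
  unfolding lin_on_def by blast

lemma lin_on_subset: "lin_on X b \<Longrightarrow> Y \<subseteq> X \<Longrightarrow> lin_on Y b"
  unfolding lin_on_def by (meson subsetD)

lemma circ_onD:
  assumes "circ_on X C" "x \<in> X" "y \<in> X" "z \<in> X"
  shows circ_on_values: "C x y z = -1 \<or> C x y z = 0 \<or> C x y z = 1"
    and circ_on_zero: "C x y z = 0 \<longleftrightarrow> x = y \<or> y = z \<or> x = z"
  using assms unfolding circ_on_def by blast+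

lemma circ_on_cocycle:
  assumes "circ_on X C" "w \<in> X" "x \<in> X" "y \<in> X" "z \<in> X"
  shows "C x y z = C w y z - C w x z + C w x y"
proof -
  have "C x y z - C w y z + C w x z - C w x y = 0" using assms unfolding circ_on_def by blast
  then show ?thesis by simp
qed

lemma circ_on_subset: "circ_on X C \<Longrightarrow> Y \<subseteq> X \<Longrightarrow> circ_on Y C"
  unfolding circ_on_def by (meson subsetD)

lemma circ_on_swap:
  assumes "circ_on X C" "x \<in> X" "y \<in> X" "z \<in> X" shows "C y x z = - C x y z"
  using circ_on_cocycle [OF assms(1), of x y x z] circ_on_zero [OF assms(1)] assms
  by (smt (verit))

lemma circ_on_rotate:
  assumes "circ_on X C" "x \<in> X" "y \<in> X" "z \<in> X" shows "C y z x = C x y z"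
  using circ_on_cocycle [OF assms(1), of x y z x] circ_on_zero [OF assms(1)] assms
  by (smt (verit))

lemma circ_on_flip:
  assumes "circ_on X C" "x \<in> X" "y \<in> X" "z \<in> X" shows "C x z y = - C x y z"
  using circ_on_swap [OF assms(1,3,2,4)] circ_on_rotate [OF assms]
    circ_on_rotate [OF assms(1,2,4,3)] circ_on_rotate [OF assms(1,3,2,4)]
    circ_on_swap [OF assms(1,2,4,3)]
  by (smt (verit, best))

lemma circ_on_trans:
  assumes "circ_on X C" "p \<in> X" "u \<in> X" "v \<in> X" "w \<in> X" "C p u v = 1" "C p v w = 1"
  shows "C p u w = 1"
  using circ_on_cocycle [OF assms(1-5)] circ_on_values [OF assms(1,3-5)]
    circ_on_values [OF assms(1,2,3,5)] assms(6,7) by linarith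

lemma circ_on_pullback:
  assumes C: "circ_on B C" and f: "inj_on f A" "f ` A \<subseteq> B"
  shows "circ_on A (\<lambda>u v w. C (f u) (f v) (f w))"
  unfolding circ_on_def
proof (intro conjI ballI)
  fix x y z assume a: "x \<in> A" "y \<in> A" "z \<in> A"
  then have m: "f x \<in> B" "f y \<in> B" "f z \<in> B" using f by auto
  show "C (f x) (f y) (f z) \<in> {-1, 0, 1}" using circ_on_values [OF C m] by auto
  show "C (f x) (f y) (f z) = 0 \<longleftrightarrow> x = y \<or> y = z \<or> x = z"
    using circ_on_zero [OF C m] a inj_on_eq_iff [OF f(1)] by simp
next
  fix w x y z assume a: "w \<in> A" "x \<in> A" "y \<in> A" "z \<in> A"
  then have "f w \<in> B" "f x \<in> B" "f y \<in> B" "f z \<in> B" using f by auto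
  then show "C (f x) (f y) (f z) - C (f w) (f y) (f z) + C (f w) (f x) (f z) - C (f w) (f x) (f y) = 0"
    using circ_on_cocycle [OF C, of "f w" "f x" "f y" "f z"] by simp
qed

lemma circ_on_coboundary:
  assumes "lin_on X b" shows "circ_on X (coboundary b)"
  unfolding circ_on_def
proof (intro conjI ballI)
  fix w x y z assume "w \<in> X" "x \<in> X" "y \<in> X" "z \<in> X"
  then show "coboundary b x y z - coboundary b w y z + coboundary b w x z - coboundary b w x y = 0"
    using lin_on_antisym [OF assms, of w y] lin_on_antisym [OF assms, of w z]
      lin_on_antisym [OF assms, of x z] by (simp add: coboundary_def)
next
  fix x y z assume *: "x \<in> X" "y \<in> X" "z \<in> X"
  note T = lin_on_trans [OF assms] and A = lin_on_antisym [OF assms] and Z = lin_on_zero [OF assms]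
  have v: "b x y = -1 \<or> b x y = 0 \<or> b x y = 1" "b y z = -1 \<or> b y z = 0 \<or> b y z = 1"
    "b z x = -1 \<or> b z x = 0 \<or> b z x = 1"
    using lin_on_values [OF assms] * by auto
  have s: "b y x = - b x y" "b z y = - b y z" "b x z = - b z x" by (rule A; fact)+
  have t: "\<not> (b x y = 1 \<and> b y z = 1 \<and> b z x = 1)" "\<not> (b x y = -1 \<and> b y z = -1 \<and> b z x = -1)"
    using T [of x y z] T [of z y x] s * by fastforce+
  have z: "b x y = 0 \<longleftrightarrow> x = y" "b y z = 0 \<longleftrightarrow> y = z" "b z x = 0 \<longleftrightarrow> x = z"
    using Z *(1,2) Z *(2,3) Z [of z x] * by blast+
  have e: "x = y \<Longrightarrow> b y z = - b z x" "y = z \<Longrightarrow> b z x = - b x y" "x = z \<Longrightarrow> b y z = - b x y"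
    using s by simp_all
  show "coboundary b x y z \<in> {-1, 0, 1}" "coboundary b x y z = 0 \<longleftrightarrow> x = y \<or> y = z \<or> x = z"
    using v t z e unfolding coboundary_def by (smt (verit) insertCI)+
qed

text \<open>Cutting the circle just before \<open>u\<close> makes it a line with first point \<open>u\<close>. This makes sense on
  any subset, whether it contains \<open>u\<close> or not, so that every point of the circle, old or new, gives
  a cut of the subset.\<close>

definition cut_at :: "('a \<Rightarrow> 'a \<Rightarrow> 'a \<Rightarrow> int) \<Rightarrow> 'a \<Rightarrow> 'a \<Rightarrow> 'a \<Rightarrow> int"
  where "cut_at C u a b = (if a = b then 0 else if a = u then 1 else if b = u then -1 else C u a b)"

text \<open>A cut of \<open>D\<close> is a linear order on \<open>D\<close> that closes up to the given circular order.\<close>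

definition is_cut :: "'a set \<Rightarrow> ('a \<Rightarrow> 'a \<Rightarrow> 'a \<Rightarrow> int) \<Rightarrow> ('a \<Rightarrow> 'a \<Rightarrow> int) \<Rightarrow> bool"
  where "is_cut D C f \<longleftrightarrow> lin_on D f \<and> (\<forall>a\<in>D. \<forall>b\<in>D. \<forall>c\<in>D. C a b c = coboundary f a b c)"

lemma is_cut_coboundary: "is_cut D C f \<Longrightarrow> a \<in> D \<Longrightarrow> b \<in> D \<Longrightarrow> c \<in> D \<Longrightarrow> C a b c = coboundary f a b c"
  and is_cut_lin: "is_cut D C f \<Longrightarrow> lin_on D f"
  unfolding is_cut_def by blast+

lemma is_cut_subset: "is_cut A C f \<Longrightarrow> D \<subseteq> A \<Longrightarrow> is_cut D C f"
  unfolding is_cut_def using lin_on_subset by blast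

lemma is_cut_cut_at:
  assumes C: "circ_on A C" and u: "u \<in> A" shows "is_cut A C (cut_at C u)"
proof -
  have neg: "C u b a = - C u a b" if "a \<in> A" "b \<in> A" for a b
    using circ_on_flip [OF C u that] .
  have zero: "C u u a = 0" "C u a u = 0" "C u a a = 0" if "a \<in> A" for a
    using circ_on_zero [OF C] u that by auto
  show ?thesis
    unfolding is_cut_def lin_on_def
  proof (intro conjI ballI impI)
    fix a b assume a: "a \<in> A" "b \<in> A"
    show "cut_at C u a b \<in> {-1, 0, 1}"
      using circ_on_values [OF C u a] by (auto simp: cut_at_def)
    show "cut_at C u a b = 0 \<longleftrightarrow> a = b"
      using circ_on_zero [OF C u a] by (auto simp: cut_at_def)
    show "cut_at C u b a = - cut_at C u a b"
      using neg [OF a] by (simp add: cut_at_def)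
  next
    fix a b c assume a: "a \<in> A" "b \<in> A" "c \<in> A" "cut_at C u a b = 1" "cut_at C u b c = 1"
    then show "cut_at C u a c = 1"
      using circ_on_trans [OF C u a(1-3)] neg [OF a(1,2)] zero
      by (auto simp: cut_at_def split: if_splits)
  next
    fix a b c assume a: "a \<in> A" "b \<in> A" "c \<in> A"
    have c: "C a b c = C u b c - C u a c + C u a b" by (rule circ_on_cocycle [OF C u a])
    have n: "C u c a = - C u a c" by (rule neg [OF a(1,3)])
    show "C a b c = coboundary (cut_at C u) a b c"
      unfolding c coboundary_def cut_at_def using n zero a neg [OF a(1,2)] by simp
  qed
qed

section \<open>Lexicographic circular orders over the cuts of a subset\<close>

text \<open>Cuts are functions on the whole type, of which only the values on \<open>D\<close> matter.\<close>

definition same_cut :: "'a set \<Rightarrow> ('a \<Rightarrow> 'a \<Rightarrow> int) \<Rightarrow> ('a \<Rightarrow> 'a \<Rightarrow> int) \<Rightarrow> bool"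
  where "same_cut D f g \<longleftrightarrow> (\<forall>a\<in>D. \<forall>b\<in>D. f a b = g a b)"

lemma same_cutD: "same_cut D f g \<Longrightarrow> a \<in> D \<Longrightarrow> b \<in> D \<Longrightarrow> f a b = g a b"
  by (simp add: same_cut_def)

lemma same_cut_refl: "same_cut D f f"
  and same_cut_sym: "same_cut D f g \<Longrightarrow> same_cut D g f"
  and same_cut_trans: "same_cut D f g \<Longrightarrow> same_cut D g h \<Longrightarrow> same_cut D f h"
  by (simp_all add: same_cut_def)

lemma same_cut_cong:
  "same_cut D f f' \<Longrightarrow> same_cut D g g' \<Longrightarrow> same_cut D f g \<longleftrightarrow> same_cut D f' g'"
  by (simp add: same_cut_def)

lemma is_cut_cong:
  assumes "is_cut D C f" "\<And>a b. a \<in> D \<Longrightarrow> b \<in> D \<Longrightarrow> g a b = f a b"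
  shows "is_cut D C g"
proof -
  note l = is_cut_lin [OF assms(1)]
  have "lin_on D g" unfolding lin_on_def
  proof (intro conjI ballI impI)
    fix u v assume "u \<in> D" "v \<in> D"
    then show "g u v \<in> {-1, 0, 1}" "g u v = 0 \<longleftrightarrow> u = v" "g v u = - g u v"
      using lin_on_values [OF l, of u v] lin_on_zero [OF l, of u v] lin_on_antisym [OF l, of u v]
      by (simp_all add: assms(2))
  next
    fix u v w assume "u \<in> D" "v \<in> D" "w \<in> D" "g u v = 1" "g v w = 1"
    then show "g u w = 1" using lin_on_trans [OF l, of u v w] by (simp add: assms(2))
  qed
  then show ?thesis
    using is_cut_coboundary [OF assms(1)] unfolding is_cut_def coboundary_def
      by (simp add: assms(2))
qed

text \<open>Two linear orders with the same coboundary differ by the coboundary of a function on points.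
  Hence a cut is determined by its values \<open>f y\<close> at one base point \<open>y\<close>.\<close>

lemma cut_rebase:
  assumes "is_cut D C f" "is_cut D C g" "y \<in> D" "a \<in> D" "b \<in> D"
  shows "g a b - f a b = (g y b - f y b) - (g y a - f y a)"
  using assms is_cut_coboundary [OF assms(1), of y a b] is_cut_coboundary [OF assms(2), of y a b]
    lin_on_antisym [OF is_cut_lin [OF assms(1)], of b y] lin_on_antisym [OF is_cut_lin [OF assms(2)], of b y]
  unfolding coboundary_def by simp

lemma same_cutI:
  assumes "is_cut D C f" "is_cut D C g" "y \<in> D" "\<forall>w\<in>D. f y w = g y w"
  shows "same_cut D f g"
  unfolding same_cut_def using cut_rebase [OF assms(1-3)] assms(4) by fastforce

text \<open>The points that a cut puts after the base point \<open>y\<close> form an initial segment of the line that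
  starts at \<open>y\<close>, and initial segments of a line are nested.\<close>

lemma cuts_nested:
  assumes f: "is_cut D C f" and g: "is_cut D C g" and y: "y \<in> D"
  shows "(\<forall>w\<in>D. f y w \<le> g y w) \<or> (\<forall>w\<in>D. g y w \<le> f y w)"
proof (rule ccontr)
  assume "\<not> ?thesis"
  then obtain a b where ab: "a \<in> D" "b \<in> D" "f y a < g y a" "g y b < f y b" by fastforce
  note lf = is_cut_lin [OF f] and lg = is_cut_lin [OF g]
  have "f y a = 0 \<longleftrightarrow> g y a = 0" "f y b = 0 \<longleftrightarrow> g y b = 0"
    using lin_on_zero [OF lf] lin_on_zero [OF lg] ab y by auto
  then have "f y a = -1" "g y a = 1" "f y b = 1" "g y b = -1"
    using lin_on_values [OF lf, of y] lin_on_values [OF lg, of y] ab y by fastforce+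
  then have "g a b - f a b = -4" using cut_rebase [OF f g y ab(1,2)] by simp
  then show False
    using lin_on_values [OF lf ab(1,2)] lin_on_values [OF lg ab(1,2)] by linarith
qed

text \<open>The sign of the order in which \<open>f\<close> and \<open>g\<close> are met when the circle is run through from \<open>y\<close>.\<close>

definition cut_compare :: "'a set \<Rightarrow> 'a \<Rightarrow> ('a \<Rightarrow> 'a \<Rightarrow> int) \<Rightarrow> ('a \<Rightarrow> 'a \<Rightarrow> int) \<Rightarrow> int"
  where "cut_compare D y f g =
    (if same_cut D f g then 0 else if \<forall>w\<in>D. f y w \<le> g y w then 1 else -1)"

lemma cut_compare_eqI:
  assumes f: "is_cut D C f" and g: "is_cut D C g" and y: "y \<in> D" and w: "w \<in> D"
  shows "f y w < g y w \<Longrightarrow> cut_compare D y f g = 1" "g y w < f y w \<Longrightarrow> cut_compare D y f g = -1"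
proof -
  assume *: "f y w < g y w"
  then have "\<not> same_cut D f g" using same_cutD [of D f g y w] w y by auto
  moreover have "\<forall>w\<in>D. f y w \<le> g y w" using cuts_nested [OF f g y] * w by fastforce
  ultimately show "cut_compare D y f g = 1" by (simp add: cut_compare_def)
next
  assume *: "g y w < f y w"
  then have "\<not> same_cut D f g" using same_cutD [of D f g y w] w y by auto
  moreover have "\<not> (\<forall>w\<in>D. f y w \<le> g y w)" using * w by fastforce
  ultimately show "cut_compare D y f g = -1" by (simp add: cut_compare_def)
qed

lemma cut_compare_cases:
  assumes f: "is_cut D C f" and g: "is_cut D C g" and y: "y \<in> D"
  obtains "same_cut D f g" "cut_compare D y f g = 0"
  | w where "w \<in> D" "f y w = -1" "g y w = 1" "cut_compare D y f g = 1" "\<not> same_cut D f g"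
  | w where "w \<in> D" "f y w = 1" "g y w = -1" "cut_compare D y f g = -1" "\<not> same_cut D f g"
proof (cases "same_cut D f g")
  case True
  then show ?thesis using that(1) by (simp add: cut_compare_def)
next
  case False
  then obtain w where w: "w \<in> D" "f y w \<noteq> g y w" using same_cutI [OF f g y] by blast
  have "f y w = 0 \<longleftrightarrow> g y w = 0"
    using lin_on_zero [OF is_cut_lin [OF f] y] lin_on_zero [OF is_cut_lin [OF g] y] w by auto
  then consider "f y w = -1" "g y w = 1" | "f y w = 1" "g y w = -1"
    using lin_on_values [OF is_cut_lin [OF f] y w(1)] lin_on_values [OF is_cut_lin [OF g] y w(1)] w
    by linarith
  then show ?thesis
    using that(2,3) [OF w(1)] cut_compare_eqI [OF f g y w(1)] False by cases auto
qed

lemma cut_compare_cong: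
  assumes "same_cut D f f'" "same_cut D g g'" "y \<in> D"
  shows "cut_compare D y f g = cut_compare D y f' g'"
  using assms same_cut_cong [OF assms(1,2)]
  by (simp add: cut_compare_def same_cutD [OF assms(1)] same_cutD [OF assms(2)])

lemma cut_compare_swap:
  assumes f: "is_cut D C f" and g: "is_cut D C g" and y: "y \<in> D"
  shows "cut_compare D y g f = - cut_compare D y f g"
  using cut_compare_cases [OF f g y]
proof cases
  case 1
  then show ?thesis using same_cut_sym [OF 1(1)] by (simp add: cut_compare_def)
qed (use cut_compare_eqI [OF g f y] in auto)

lemma cut_compare_trans:
  assumes "is_cut D C f" "is_cut D C g" "is_cut D C h" "y \<in> D"
    "cut_compare D y f g = 1" "cut_compare D y g h = 1"
  shows "cut_compare D y f h = 1"
  using cut_compare_cases [OF assms(1,2,4)]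
proof cases
  case (2 w)
  have "g y w \<le> h y w" using assms(6) 2 by (auto simp: cut_compare_def split: if_splits)
  then show ?thesis using cut_compare_eqI(1) [OF assms(1,3,4) 2(1)] 2 by simp
qed (use assms in auto)

text \<open>Moving the base point changes the comparison of cuts by a coboundary. This is what makes the
  circular order on cuts, and with it \<open>lex_circular\<close>, independent of any choice, and hence
  invariant under all symmetries.\<close>

lemma cut_compare_rebase:
  assumes f: "is_cut D C f" and g: "is_cut D C g" and y: "y \<in> D" and y': "y' \<in> D"
  shows "cut_compare D y f g - cut_compare D y' f g = g y y' - f y y'"
proof -
  have less: "cut_compare D y f g - cut_compare D y' f g = g y y' - f y y'"
    if f: "is_cut D C f" and g: "is_cut D C g"
      and w: "w \<in> D" "f y w = -1" "g y w = 1" and 1: "cut_compare D y f g = 1" for f g w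
  proof -
    have r: "g y' b - f y' b = (g y b - f y b) - (g y y' - f y y')" if "b \<in> D" for b
      using cut_rebase [OF f g y y' that] .
    have le: "f y y' \<le> g y y'" using 1 y' by (auto simp: cut_compare_def split: if_splits)
    have z: "f y y' = 0 \<longleftrightarrow> g y y' = 0" "f y y = 0" "g y y = 0"
      using lin_on_zero [OF is_cut_lin [OF f] y] lin_on_zero [OF is_cut_lin [OF g] y] y y' by auto
    consider "g y y' = f y y'" | "f y y' = -1" "g y y' = 1"
      using lin_on_values [OF is_cut_lin [OF f] y y'] lin_on_values [OF is_cut_lin [OF g] y y'] le z
      by linarith
    then show ?thesis
    proof cases
      \<comment> \<open>Seen from \<open>y\<close>, the point \<open>y'\<close> is not between the two cuts, so \<open>w\<close> separates them in the
        same order when seen from \<open>y'\<close>. In the other case \<open>y'\<close> is between them, and \<open>y\<close> takes the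
        part of \<open>w\<close>.\<close>
      case 1
      then show ?thesis
        using r [OF w(1)] cut_compare_eqI(1) [OF f g y' w(1)] w \<open>cut_compare D y f g = 1\<close> by simp
    next
      case 2
      then show ?thesis
        using r [OF y] cut_compare_eqI(2) [OF f g y' y] z \<open>cut_compare D y f g = 1\<close> by simp
    qed
  qed
  show ?thesis
    using cut_compare_cases [OF f g y]
  proof cases
    case 1
    then show ?thesis using same_cutD [OF 1(1) y y'] by (simp add: cut_compare_def)
  next
    case (2 w)
    then show ?thesis using less [OF f g] by blast
  next
    case (3 w)
    have "cut_compare D y g f = 1" using cut_compare_swap [OF f g y] 3 by simp
    then show ?thesis
      using less [OF g f 3(1,3,2)] cut_compare_swap [OF f g y] cut_compare_swap [OF f g y'] by simp
  qed
qed

text \<open>Points of \<open>Z\<close> are compared by the cuts \<open>f u\<close> that they make in \<open>D\<close>, and by \<open>s\<close> if these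
  coincide.\<close>

definition lex_over_cuts :: "'a set \<Rightarrow> ('z \<Rightarrow> 'a \<Rightarrow> 'a \<Rightarrow> int) \<Rightarrow> ('z \<Rightarrow> 'z \<Rightarrow> int) \<Rightarrow> 'a \<Rightarrow> 'z \<Rightarrow> 'z \<Rightarrow> int"
  where "lex_over_cuts D f s y u v = (if same_cut D (f u) (f v) then s u v else cut_compare D y (f u) (f v))"

definition fibre_order :: "'a set \<Rightarrow> ('z \<Rightarrow> 'a \<Rightarrow> 'a \<Rightarrow> int) \<Rightarrow> ('z \<Rightarrow> 'z \<Rightarrow> int) \<Rightarrow> 'z set \<Rightarrow> bool"
  where "fibre_order D f s Z \<longleftrightarrow> (\<forall>z\<in>Z. lin_on {u \<in> Z. same_cut D (f u) (f z)} s)"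

definition lex_circular :: "'a set \<Rightarrow> ('z \<Rightarrow> 'a \<Rightarrow> 'a \<Rightarrow> int) \<Rightarrow> ('z \<Rightarrow> 'z \<Rightarrow> int) \<Rightarrow> 'z \<Rightarrow> 'z \<Rightarrow> 'z \<Rightarrow> int"
  where "lex_circular D f s = coboundary (lex_over_cuts D f s (SOME y. y \<in> D))"

lemma lin_on_lex_over_cuts:
  assumes f: "\<And>u. u \<in> Z \<Longrightarrow> is_cut D C (f u)" and s: "fibre_order D f s Z" and y: "y \<in> D"
  shows "lin_on Z (lex_over_cuts D f s y)"
  unfolding lin_on_def
proof (intro conjI ballI impI)
  fix u v assume uv: "u \<in> Z" "v \<in> Z"
  have l: "lin_on {x \<in> Z. same_cut D (f x) (f v)} s" using s uv by (simp add: fibre_order_def)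
  have same: "s u v = -1 \<or> s u v = 0 \<or> s u v = 1" "s u v = 0 \<longleftrightarrow> u = v" "s v u = - s u v"
    if "same_cut D (f u) (f v)"
    using lin_on_values [OF l, of u v] lin_on_zero [OF l, of u v] lin_on_antisym [OF l, of u v]
      uv that same_cut_refl [of D "f v"] by blast+
  have eq: "u = v \<Longrightarrow> same_cut D (f u) (f v)" by (simp add: same_cut_refl)
  show "lex_over_cuts D f s y u v \<in> {-1, 0, 1}"
    using same(1) by (auto simp: lex_over_cuts_def cut_compare_def)
  show "lex_over_cuts D f s y u v = 0 \<longleftrightarrow> u = v"
    using same(2) eq by (auto simp: lex_over_cuts_def cut_compare_def)
  show "lex_over_cuts D f s y v u = - lex_over_cuts D f s y u v"
    using cut_compare_swap [OF f f y, OF uv] same(3) same_cut_sym [of D "f u" "f v"]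
      same_cut_sym [of D "f v" "f u"]
    by (auto simp: lex_over_cuts_def)
next
  fix u v w assume uv: "u \<in> Z" "v \<in> Z" "w \<in> Z" "lex_over_cuts D f s y u v = 1" "lex_over_cuts D f s y v w = 1"
  have l: "lin_on {x \<in> Z. same_cut D (f x) (f v)} s" using s uv by (simp add: fibre_order_def)
  show "lex_over_cuts D f s y u w = 1"
  proof (cases "same_cut D (f u) (f v)")
    case T: True
    show ?thesis
    proof (cases "same_cut D (f v) (f w)")
      case True
      then show ?thesis
        using T lin_on_trans [OF l, of u v w] uv same_cut_refl [of D] same_cut_sym [OF True]
          same_cut_trans [OF T True]
        by (simp add: lex_over_cuts_def)
    next
      case False
      then have "\<not> same_cut D (f u) (f w)" using T same_cut_sym same_cut_trans by metis
      moreover have "cut_compare D y (f u) (f w) = cut_compare D y (f v) (f w)"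
        using cut_compare_cong [OF T same_cut_refl y] .
      ultimately show ?thesis using uv False by (simp add: lex_over_cuts_def)
    qed
  next
    case F: False
    show ?thesis
    proof (cases "same_cut D (f v) (f w)")
      case True
      then have "\<not> same_cut D (f u) (f w)" using F same_cut_sym same_cut_trans by metis
      moreover have "cut_compare D y (f u) (f w) = cut_compare D y (f u) (f v)"
        using cut_compare_cong [OF same_cut_refl same_cut_sym [OF True] y] .
      ultimately show ?thesis using uv F by (simp add: lex_over_cuts_def)
    next
      case False
      then have "cut_compare D y (f u) (f w) = 1"
        using cut_compare_trans [OF f f f y, of u v w] uv F by (simp add: lex_over_cuts_def)
      moreover from this have "\<not> same_cut D (f u) (f w)" by (auto simp: cut_compare_def)
      ultimately show ?thesis by (simp add: lex_over_cuts_def)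
    qed
  qed
qed

lemma lex_circular_base:
  assumes f: "\<And>u. u \<in> Z \<Longrightarrow> is_cut D C (f u)" and y: "y \<in> D" and uvw: "u \<in> Z" "v \<in> Z" "w \<in> Z"
  shows "lex_circular D f s u v w = coboundary (lex_over_cuts D f s y) u v w"
proof -
  define y' where "y' = (SOME y. y \<in> D)"
  have y': "y' \<in> D" using y unfolding y'_def by (rule someI)
  have r: "lex_over_cuts D f s y a b - lex_over_cuts D f s y' a b = f b y y' - f a y y'"
    if "a \<in> Z" "b \<in> Z" for a b
  proof (cases "same_cut D (f a) (f b)")
    case True
    then show ?thesis using same_cutD [OF True y y'] by (simp add: lex_over_cuts_def)
  next
    case False
    then show ?thesis
      using cut_compare_rebase [OF f f y y', OF that] by (simp add: lex_over_cuts_def)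
  qed
  show ?thesis
    using r [of u v] r [of v w] r [of w u] uvw
      unfolding lex_circular_def y'_def [symmetric] coboundary_def
    by simp
qed

theorem circ_on_lex_circular:
  assumes f: "\<And>u. u \<in> Z \<Longrightarrow> is_cut D C (f u)" and s: "fibre_order D f s Z" and D: "D \<noteq> {}"
  shows "circ_on Z (lex_circular D f s)"
proof -
  have "(SOME y. y \<in> D) \<in> D" using D by (simp add: some_in_eq)
  then show ?thesis
    unfolding lex_circular_def by (intro circ_on_coboundary lin_on_lex_over_cuts [OF f s])
qed

text \<open>A map \<open>g\<close> that respects the position over \<open>D\<close> and the order on fibres carries the linear
  order based at \<open>y\<close> to the one based at \<open>g y\<close>, which closes up to the same circular order.\<close>

lemma lex_circular_invariant:
  assumes f: "\<And>u. u \<in> Z \<Longrightarrow> is_cut D C (f u)" and D: "D \<noteq> {}"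
    and uvw: "u \<in> Z" "v \<in> Z" "w \<in> Z" "g u \<in> Z" "g v \<in> Z" "g w \<in> Z"
    and g: "g ` D = D"
    and fg: "\<And>x a b. x \<in> {u, v, w} \<Longrightarrow> a \<in> D \<Longrightarrow> b \<in> D \<Longrightarrow> f (g x) (g a) (g b) = f x a b"
    and sg: "\<And>x y. x \<in> {u, v, w} \<Longrightarrow> y \<in> {u, v, w} \<Longrightarrow> same_cut D (f x) (f y) \<Longrightarrow>
      s (g x) (g y) = s x y"
  shows "lex_circular D f s (g u) (g v) (g w) = lex_circular D f s u v w"
proof -
  obtain y where y: "y \<in> D" using D by blast
  have gy: "g y \<in> D" using g y by blast
  have all: "(\<forall>a\<in>D. P a) \<longleftrightarrow> (\<forall>a\<in>D. P (g a))" for P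
    using g by (metis (no_types, lifting) image_iff)
  have same: "same_cut D (f (g x)) (f (g z)) \<longleftrightarrow> same_cut D (f x) (f z)"
    if "x \<in> {u, v, w}" "z \<in> {u, v, w}" for x z
  proof -
    have "same_cut D (f (g x)) (f (g z)) \<longleftrightarrow>
        (\<forall>a\<in>D. \<forall>b\<in>D. f (g x) (g a) (g b) = f (g z) (g a) (g b))"
      unfolding same_cut_def
      using all [of "\<lambda>a. \<forall>b\<in>D. f (g x) a b = f (g z) a b"]
        all [of "\<lambda>b. f (g x) (g a) b = f (g z) (g a) b" for a] by simp
    then show ?thesis using fg that by (simp add: same_cut_def)
  qed
  have "cut_compare D (g y) (f (g x)) (f (g z)) = cut_compare D y (f x) (f z)"
    if "x \<in> {u, v, w}" "z \<in> {u, v, w}" for x z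
  proof -
    have "(\<forall>a\<in>D. f (g x) (g y) a \<le> f (g z) (g y) a) \<longleftrightarrow>
        (\<forall>a\<in>D. f (g x) (g y) (g a) \<le> f (g z) (g y) (g a))"
      by (rule all)
    then show ?thesis using fg that same y by (simp add: cut_compare_def)
  qed
  then have "lex_over_cuts D f s (g y) (g x) (g z) = lex_over_cuts D f s y x z"
    if "x \<in> {u, v, w}" "z \<in> {u, v, w}" for x z
    using same sg that unfolding lex_over_cuts_def by presburger
  then show ?thesis
    using lex_circular_base [OF f y uvw(1-3), where s = s] lex_circular_base [OF f gy uvw(4-6), where s = s]
    by (simp add: coboundary_def)
qed

text \<open>Points of \<open>A\<close> with different cuts of \<open>D\<close> are separated by a point of \<open>D\<close>, so their cuts
  determine how they compare; what remains is the order among points with the same cut. A point \<open>v\<close>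
  of \<open>D\<close> is represented by the cut just before it, so it comes last among the points with that cut;
  this is hypothesis \<open>s1\<close>. Read backwards, the theorem lets an order on a larger set be prescribed
  by cuts and fibre orders, with certainty that it restricts to the given order on \<open>A\<close>.\<close>

theorem lex_circular_decomposition:
  assumes C: "circ_on A C" and D: "D \<subseteq> A" "D \<noteq> {}"
    and f: "\<And>u. u \<in> A \<Longrightarrow> same_cut D (f u) (cut_at C u)"
    and s0: "\<And>u v y. u \<in> A - D \<Longrightarrow> v \<in> A - D \<Longrightarrow> y \<in> D \<Longrightarrow>
      same_cut D (cut_at C u) (cut_at C v) \<Longrightarrow> s u v = C y u v"
    and s1: "\<And>u v. u \<in> A - D \<Longrightarrow> v \<in> D \<Longrightarrow> same_cut D (cut_at C u) (cut_at C v) \<Longrightarrow> s u v = 1 \<and> s v u = -1"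
    and s2: "\<And>u. u \<in> D \<Longrightarrow> s u u = 0"
    and uvw: "u \<in> A" "v \<in> A" "w \<in> A"
  shows "lex_circular D f s u v w = C u v w"
proof -
  obtain y where y: "y \<in> D" using D by blast
  have yA: "y \<in> A" using y D by blast
  have cut': "is_cut D C (cut_at C u)" if "u \<in> A" for u
    using is_cut_subset [OF is_cut_cut_at [OF C that] D(1)] .
  have cut: "is_cut D C (f u)" if "u \<in> A" for u
  proof -
    have "f u a b = cut_at C u a b" if "a \<in> D" "b \<in> D" for a b
      using same_cutD [OF f [OF \<open>u \<in> A\<close>] that] .
    then show ?thesis by (rule is_cut_cong [OF cut' [OF that]])
  qed
  have less: "a \<noteq> y \<and> (b \<noteq> y \<longrightarrow> C y a b = 1)"
    if ab: "a \<in> A" "b \<in> A" and w: "w \<in> D" "cut_at C a y w = -1" "cut_at C b y w = 1" for a b w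
  proof -
    have wA: "w \<in> A" using w D by blast
    have ay: "a \<noteq> y" using w(2) by (auto simp: cut_at_def split: if_splits)
    have "w = a \<or> C y a w = 1"
      using w(2) ay circ_on_swap [OF C ab(1) yA wA] by (auto simp: cut_at_def split: if_splits)
    moreover have "C y w b = 1" if "b \<noteq> y"
      using w(3) that circ_on_rotate [OF C ab(2) yA wA] by (auto simp: cut_at_def split: if_splits)
    ultimately show ?thesis using circ_on_trans [OF C yA ab(1) wA ab(2)] ay by blast
  qed
  \<comment> \<open>The sign functions \<open>lex_over_cuts D f s y\<close> and \<open>C y\<close> differ only at \<open>y\<close>, which the former puts
    last and the latter leaves out. The correction term is the coboundary of a function on points,
    so it disappears on closing up.\<close>
  have key: "lex_over_cuts D f s y a b = C y a b + (if b = y \<and> a \<noteq> y then 1 else if a = y \<and> b \<noteq> y then -1 else 0)"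
    if ab: "a \<in> A" "b \<in> A" for a b
  proof -
    have fv: "f a p q = cut_at C a p q" "f b p q = cut_at C b p q" if "p \<in> D" "q \<in> D" for p q
      using same_cutD [OF f [OF ab(1)] that] same_cutD [OF f [OF ab(2)] that] by simp_all
    have sc: "same_cut D (f a) (f b) \<longleftrightarrow> same_cut D (cut_at C a) (cut_at C b)"
      using same_cut_cong f ab by blast
    have zero: "C y a b = 0 \<longleftrightarrow> y = a \<or> a = b \<or> y = b" by (rule circ_on_zero [OF C yA ab])
    show ?thesis
      using cut_compare_cases [OF cut cut y, OF ab]
    proof cases
      case 1
      then have sm: "same_cut D (cut_at C a) (cut_at C b)" using sc by simp
      have L: "lex_over_cuts D f s y a b = s a b" using 1 by (simp add: lex_over_cuts_def)
      consider "a \<notin> D" "b \<notin> D" | "a \<notin> D" "b \<in> D" | "a \<in> D" "b \<notin> D" | "a \<in> D" "b \<in> D" by blast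
      then show ?thesis
      proof cases
        case 1
        then show ?thesis using L s0 [OF _ _ y sm] ab y by auto
      next
        case 2
        have "cut_at C a b y = cut_at C b b y" using same_cutD [OF sm] 2 y by blast
        then have "b \<noteq> y \<Longrightarrow> C y a b = 1" using 2 y circ_on_rotate [OF C yA ab]
          by (auto simp: cut_at_def split: if_splits)
        moreover have "C y a b = 0" if "b = y" using zero that by simp
        ultimately show ?thesis using L s1 [of a b] sm 2 ab y by auto
      next
        case 3
        have "cut_at C b a y = cut_at C a a y" using same_cutD [OF sm] 3 y by (metis)
        then have "a \<noteq> y \<Longrightarrow> C b a y = 1" using 3 by (auto simp: cut_at_def split: if_splits)
        then have "a \<noteq> y \<Longrightarrow> C y a b = -1"
          using circ_on_rotate [OF C yA ab(2,1)] circ_on_flip [OF C yA ab] by simp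
        moreover have "C y a b = 0" if "a = y" using zero that by simp
        ultimately show ?thesis using L s1 [of b a] same_cut_sym [OF sm] 3 ab y by auto
      next
        case 4
        have "cut_at C a a b = cut_at C b a b" using same_cutD [OF sm] 4 by blast
        then have "a = b" by (auto simp: cut_at_def split: if_splits)
        then show ?thesis using L s2 4 zero by auto
      qed
    next
      case (2 w)
      then have L: "lex_over_cuts D f s y a b = 1" by (simp add: lex_over_cuts_def)
      have "a \<noteq> y" "b \<noteq> y \<longrightarrow> C y a b = 1"
        using less [OF ab 2(1)] 2(2,3) fv y 2(1) by simp_all
      then show ?thesis using L zero by auto
    next
      case (3 w)
      then have L: "lex_over_cuts D f s y a b = -1" by (simp add: lex_over_cuts_def)
      have "b \<noteq> y" "a \<noteq> y \<longrightarrow> C y b a = 1"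
        using less [OF ab(2,1) 3(1)] 3(2,3) fv y 3(1) by simp_all
      then show ?thesis using L zero circ_on_flip [OF C yA ab] by auto
    qed
  qed
  have "C u v w = C y v w - C y u w + C y u v" using circ_on_cocycle [OF C yA uvw] .
  moreover have "C y w u = - C y u w"
    by (rule circ_on_flip [OF C yA uvw(1,3)])
  moreover have "lex_circular D f s u v w = coboundary (lex_over_cuts D f s y) u v w"
    by (rule lex_circular_base [OF cut y uvw])
  ultimately show ?thesis using key uvw unfolding coboundary_def by auto
qed

section \<open>Amalgamation of circular orders\<close>

text \<open>If no point of \<open>D\<close> separates \<open>u\<close> from \<open>v\<close>, then all of \<open>D\<close> lies in the same one of the two
  arcs between them.\<close>

lemma same_cut_base:
  assumes C: "circ_on A C" and "D \<subseteq> A" and uv: "u \<in> A - D" "v \<in> A - D"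
    and same: "same_cut D (cut_at C u) (cut_at C v)" and y: "y \<in> D" "y' \<in> D"
  shows "C y u v = C y' u v"
proof -
  have A: "y \<in> A" "y' \<in> A" "u \<in> A" "v \<in> A" using assms by auto
  have "C u y y = 0" "C v y y = 0"
    using circ_on_zero [OF C A(3,1,1)] circ_on_zero [OF C A(4,1,1)] by simp_all
  then have "C u y' y = C v y' y"
    using same_cutD [OF same y(2,1)] uv y by (auto simp: cut_at_def split: if_splits)
  then show ?thesis
    using circ_on_cocycle [OF C A(2,1,3,4)] circ_on_rotate [OF C A(3,2,1)]
      circ_on_rotate [OF C A(4,2,1)] by simp
qed

lemma same_cut_point:
  assumes "u \<in> D" "v \<in> D" "same_cut D (cut_at C u) (cut_at C v)" shows "u = v"
  using same_cutD [OF assms(3,1,2)] by (auto simp: cut_at_def split: if_splits)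

definition circ_automorphism :: "'a set \<Rightarrow> ('a \<Rightarrow> 'a \<Rightarrow> 'a \<Rightarrow> int) \<Rightarrow> ('a \<Rightarrow> 'a) \<Rightarrow> bool"
  where "circ_automorphism X C g \<longleftrightarrow> bij_betw g X X \<and>
    (\<forall>u\<in>X. \<forall>v\<in>X. \<forall>w\<in>X. C (g u) (g v) (g w) = C u v w)"

lemma circ_automorphismD:
  assumes "circ_automorphism X C g"
  shows "g ` X = X" "u \<in> X \<Longrightarrow> v \<in> X \<Longrightarrow> w \<in> X \<Longrightarrow> C (g u) (g v) (g w) = C u v w"
  using assms unfolding circ_automorphism_def bij_betw_def by blast+

lemma circ_automorphismI:
  assumes "inj_on g X" "g ` X = X"
    and "\<And>u v w. u \<in> X \<Longrightarrow> v \<in> X \<Longrightarrow> w \<in> X \<Longrightarrow> C (g u) (g v) (g w) = C u v w"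
  shows "circ_automorphism X C g"
  using assms unfolding circ_automorphism_def bij_betw_def by blast

text \<open>The positions of the points of \<open>A\<close> and of \<open>B\<close> over the common part \<open>D\<close> are known; only points
  of the two sides with the same cut of \<open>D\<close> have to be compared, and there \<open>A\<close> is put before \<open>B\<close>.
  The points of \<open>D\<close> themselves have to come last in their fibre, for \<open>lex_circular_decomposition\<close>
  to give back both orders. This rule refers to nothing but the two sides and their orders, so it
  is respected by every permutation that is an automorphism of both.\<close>

theorem amalgamate_circular_orders:
  assumes CA: "circ_on A CA" and CB: "circ_on B CB" and ne: "A \<inter> B \<noteq> {}"
    and CAB: "\<forall>u\<in>A \<inter> B. \<forall>v\<in>A \<inter> B. \<forall>w\<in>A \<inter> B. CA u v w = CB u v w"
  shows "\<exists>E. circ_on (A \<union> B) E \<and>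
    (\<forall>u\<in>A. \<forall>v\<in>A. \<forall>w\<in>A. E u v w = CA u v w) \<and>
    (\<forall>u\<in>B. \<forall>v\<in>B. \<forall>w\<in>B. E u v w = CB u v w) \<and>
    (\<forall>g. inj_on g (A \<union> B) \<longrightarrow> circ_automorphism A CA g \<longrightarrow> circ_automorphism B CB g \<longrightarrow>
      circ_automorphism (A \<union> B) E g)"
proof -
  note agree = CAB [rule_format]
  define D where "D = A \<inter> B"
  define y0 where "y0 = (SOME y. y \<in> D)"
  have y0: "y0 \<in> D" unfolding y0_def some_in_eq using ne by (simp add: D_def)
  have DA: "D \<subseteq> A" and DB: "D \<subseteq> B" by (auto simp: D_def)
  have y0A: "y0 \<in> A" and y0B: "y0 \<in> B" using y0 DA DB by auto
  define f where "f u = (if u \<in> A then cut_at CA u else cut_at CB u)" for u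
  define r :: "_ \<Rightarrow> nat" where "r u = (if u \<in> D then 2 else if u \<in> A then 0 else 1)" for u
  define s where "s u v = (if r u < r v then 1 else if r v < r u then -1
    else if u \<in> D then 0 else if u \<in> A then CA y0 u v else CB y0 u v)" for u v
  have fA: "same_cut D (f u) (cut_at CA u)" if "u \<in> A" for u
    using that by (simp add: f_def same_cut_refl)
  have fB: "same_cut D (f u) (cut_at CB u)" if "u \<in> B" for u
    using that agree unfolding f_def same_cut_def cut_at_def by (simp add: D_def)
  have cut: "is_cut D CA (f u)" if "u \<in> A \<union> B" for u
  proof (cases "u \<in> A")
    case True
    then show ?thesis using is_cut_subset [OF is_cut_cut_at [OF CA] DA] by (simp add: f_def)
  next
    case False
    then have "is_cut D CB (f u)"
      using that is_cut_subset [OF is_cut_cut_at [OF CB] DB] by (simp add: f_def)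
    then show ?thesis using agree unfolding is_cut_def by (simp add: D_def)
  qed
  have pt: "u = v" if "u \<in> D" "v \<in> D" "same_cut D (f u) (f v)" for u v
    using same_cut_point [of u D v CA] that DA by (simp add: f_def subset_iff)
  have side: "CA y0 u v = -1 \<or> CA y0 u v = 0 \<or> CA y0 u v = 1" "CA y0 u v = 0 \<longleftrightarrow> u = v"
    "CA y0 v u = - CA y0 u v" if "u \<in> A - D" "v \<in> A - D" for u v
    using circ_on_values [OF CA y0A, of u v] circ_on_zero [OF CA y0A, of u v]
      circ_on_flip [OF CA y0A, of u v] that y0 by auto
  have sideB: "CB y0 u v = -1 \<or> CB y0 u v = 0 \<or> CB y0 u v = 1" "CB y0 u v = 0 \<longleftrightarrow> u = v"
    "CB y0 v u = - CB y0 u v" if "u \<in> B - D" "v \<in> B - D" for u v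
    using circ_on_values [OF CB y0B, of u v] circ_on_zero [OF CB y0B, of u v]
      circ_on_flip [OF CB y0B, of u v] that y0 by auto
  have r_cases: "u \<in> D \<and> r u = 2 \<or> u \<in> A - D \<and> r u = 0 \<or> u \<in> B - D \<and> u \<notin> A \<and> r u = 1"
    if "u \<in> A \<union> B" for u using that by (auto simp: r_def)
  have fib: "fibre_order D f s (A \<union> B)"
    unfolding fibre_order_def lin_on_def
  proof (intro conjI ballI impI)
    fix z u v assume z: "z \<in> A \<union> B" and u: "u \<in> {x \<in> A \<union> B. same_cut D (f x) (f z)}"
      and v: "v \<in> {x \<in> A \<union> B. same_cut D (f x) (f z)}"
    then have uv: "u \<in> A \<union> B" "v \<in> A \<union> B" "same_cut D (f u) (f v)"
      by (auto intro: same_cut_trans same_cut_sym)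
    have *: "u = v" if "u \<in> D" "v \<in> D" using pt that uv by blast
    show "s u v \<in> {-1, 0, 1}"
      using r_cases [OF uv(1)] r_cases [OF uv(2)] side(1) sideB(1) unfolding s_def by fastforce
    show "s u v = 0 \<longleftrightarrow> u = v"
      using r_cases [OF uv(1)] r_cases [OF uv(2)] side(2) sideB(2) * unfolding s_def by fastforce
    show "s v u = - s u v"
    proof (cases "u = v")
      case True
      then show ?thesis
        using r_cases [OF uv(1)] side(2) [of u u] sideB(2) [of u u] unfolding s_def by auto
    next
      case False
      then show ?thesis
        using r_cases [OF uv(1)] r_cases [OF uv(2)] side(3) [of u v] sideB(3) [of u v] *
        unfolding s_def by auto
    qed
  next
    fix z u v w assume z: "z \<in> A \<union> B" and u: "u \<in> {x \<in> A \<union> B. same_cut D (f x) (f z)}"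
      and v: "v \<in> {x \<in> A \<union> B. same_cut D (f x) (f z)}"
      and w: "w \<in> {x \<in> A \<union> B. same_cut D (f x) (f z)}" and s: "s u v = 1" "s v w = 1"
    have tA: "CA y0 u w = 1" if "u \<in> A" "v \<in> A" "w \<in> A" "CA y0 u v = 1" "CA y0 v w = 1"
      using circ_on_trans [OF CA y0A] that by blast
    have tB: "CB y0 u w = 1" if "u \<in> B" "v \<in> B" "w \<in> B" "CB y0 u v = 1" "CB y0 v w = 1"
      using circ_on_trans [OF CB y0B] that by blast
    show "s u w = 1"
      using r_cases [of u] r_cases [of v] r_cases [of w] u v w s tA tB unfolding s_def
      by (auto split: if_splits)
  qed
  have D: "D \<noteq> {}" using y0 by blast
  let ?E = "lex_circular D f s"
  have 1: "circ_on (A \<union> B) ?E" by (rule circ_on_lex_circular [OF cut fib D])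
  have 2: "?E u v w = CA u v w" if "u \<in> A" "v \<in> A" "w \<in> A" for u v w
  proof (rule lex_circular_decomposition [OF CA DA D fA])
    fix u v y assume *: "u \<in> A - D" "v \<in> A - D" "y \<in> D" "same_cut D (cut_at CA u) (cut_at CA v)"
    then show "s u v = CA y u v"
      using same_cut_base [OF CA DA *(1,2,4,3) y0] by (simp add: s_def r_def)
  qed (use that in \<open>auto simp: s_def r_def\<close>)
  have 3: "?E u v w = CB u v w" if "u \<in> B" "v \<in> B" "w \<in> B" for u v w
  proof (rule lex_circular_decomposition [OF CB DB D fB])
    fix u v y assume *: "u \<in> B - D" "v \<in> B - D" "y \<in> D" "same_cut D (cut_at CB u) (cut_at CB v)"
    moreover from this have "u \<notin> A" "v \<notin> A" by (auto simp: D_def)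
    ultimately show "s u v = CB y u v"
      using same_cut_base [OF CB DB *(1,2,4,3) y0] by (simp add: s_def r_def)
  qed (use that in \<open>auto simp: s_def r_def D_def\<close>)
  have 4: "circ_automorphism (A \<union> B) ?E g"
    if inj: "inj_on g (A \<union> B)" and gA': "circ_automorphism A CA g" and gB': "circ_automorphism B CB g"
    for g
  proof -
    note gA = circ_automorphismD(1) [OF gA'] and gB = circ_automorphismD(1) [OF gB']
      and iA = circ_automorphismD(2) [OF gA'] and iB = circ_automorphismD(2) [OF gB']
    have gD: "g ` D = D" unfolding D_def using inj_on_image_Int [OF inj, of A B] gA gB by simp
    have mem: "g x \<in> A \<longleftrightarrow> x \<in> A" "g x \<in> B \<longleftrightarrow> x \<in> B" "g x \<in> D \<longleftrightarrow> x \<in> D" if "x \<in> A \<union> B" for x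
      using inj_on_image_mem_iff [OF inj that, of A] inj_on_image_mem_iff [OF inj that, of B]
        inj_on_image_mem_iff [OF inj that, of D] gA gB gD by (auto simp: D_def)
    have eq: "g x = g y \<longleftrightarrow> x = y" if "x \<in> A \<union> B" "y \<in> A \<union> B" for x y
      using inj that by (auto simp: inj_on_def)
    have fg: "f (g x) (g a) (g b) = f x a b" if "x \<in> A \<union> B" "a \<in> D" "b \<in> D" for x a b
    proof -
      have "a \<in> A \<union> B" "b \<in> A \<union> B" "a \<in> A" "b \<in> A" "a \<in> B" "b \<in> B" using that DA DB by auto
      then show ?thesis using that mem(1)[of x] eq iA [of x a b] iB [of x a b]
        by (auto simp: f_def cut_at_def)
    qed
    have sg: "s (g x) (g y) = s x y"
      if x: "x \<in> A \<union> B" and y: "y \<in> A \<union> B" and same: "same_cut D (f x) (f y)" for x y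
    proof -
      have r: "r (g x) = r x" "r (g y) = r y" using mem x y by (auto simp: r_def)
      \<comment> \<open>The fibre orders are based at \<open>y0\<close>, which \<open>g\<close> may move; by \<open>same_cut_base\<close> the preimage of
        \<open>y0\<close> is an equally good base.\<close>
      have "y0 \<in> g ` D" unfolding gD by (rule y0)
      then obtain y1 where y1: "y1 \<in> D" "g y1 = y0" by auto
      have "CA y0 (g x) (g y) = CA y0 x y" if "x \<in> A - D" "y \<in> A - D"
      proof -
        have "same_cut D (cut_at CA x) (cut_at CA y)" using same that by (simp add: f_def)
        then have "CA y1 x y = CA y0 x y" using same_cut_base [OF CA DA that _ y1(1) y0] by blast
        then show ?thesis using iA [of y1 x y] y1 DA that by auto
      qed
      moreover have "CB y0 (g x) (g y) = CB y0 x y" if "x \<in> B - D" "y \<in> B - D"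
      proof -
        have "same_cut D (cut_at CB x) (cut_at CB y)"
          using same same_cut_cong [OF fB fB, of x y] that by blast
        then have "CB y1 x y = CB y0 x y" using same_cut_base [OF CB DB that _ y1(1) y0] by blast
        then show ?thesis using iB [of y1 x y] y1 DB that by auto
      qed
      ultimately show ?thesis
        using r r_cases [OF x] r_cases [OF y] mem [OF x] mem [OF y] unfolding s_def by auto
    qed
    have gm: "g x \<in> A \<union> B" if "x \<in> A \<union> B" for x using mem [OF that] that by blast
    have "?E (g u) (g v) (g w) = ?E u v w" if uvw: "u \<in> A \<union> B" "v \<in> A \<union> B" "w \<in> A \<union> B" for u v w
    proof -
      have in3: "x \<in> A \<union> B" if "x \<in> {u, v, w}" for x using uvw that by auto
      show ?thesis
        by (rule lex_circular_invariant [OF cut D uvw gm [OF uvw(1)] gm [OF uvw(2)] gm [OF uvw(3)] gD])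
          (simp_all only: fg [OF in3] sg [OF in3 in3])
    qed
    moreover have "g ` (A \<union> B) = A \<union> B" unfolding image_Un gA gB ..
    ultimately show ?thesis by (intro circ_automorphismI inj)
  qed
  show ?thesis using 1 2 3 4 by (intro exI [of _ ?E]) simp
qed

section \<open>Signs of elements in left-ordered groups\<close>

text \<open>A left order on the group \<open>K\<close>, given by the signs of its elements: the elements of sign \<open>1\<close>
  are the positive cone, and \<open>h\<close> precedes \<open>k\<close> if \<open>inv h \<otimes> k\<close> is positive.\<close>

definition order_sign :: "('g, 'm) monoid_scheme \<Rightarrow> 'g set \<Rightarrow> ('g \<Rightarrow> int) \<Rightarrow> bool"
  where "order_sign G K \<sigma> \<longleftrightarrow>
    (\<forall>k\<in>K. \<sigma> k \<in> {-1, 0, 1} \<and> (\<sigma> k = 0 \<longleftrightarrow> k = \<one>\<^bsub>G\<^esub>) \<and> \<sigma> (inv\<^bsub>G\<^esub> k) = - \<sigma> k) \<and>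
    (\<forall>k\<in>K. \<forall>l\<in>K. \<sigma> k = 1 \<longrightarrow> \<sigma> l = 1 \<longrightarrow> \<sigma> (k \<otimes>\<^bsub>G\<^esub> l) = 1)"

lemma order_signD:
  assumes "order_sign G K \<sigma>" "k \<in> K"
  shows "\<sigma> k = -1 \<or> \<sigma> k = 0 \<or> \<sigma> k = 1" "\<sigma> k = 0 \<longleftrightarrow> k = \<one>\<^bsub>G\<^esub>" "\<sigma> (inv\<^bsub>G\<^esub> k) = - \<sigma> k"
  using assms unfolding order_sign_def by blast+

lemma order_sign_mult:
  "order_sign G K \<sigma> \<Longrightarrow> k \<in> K \<Longrightarrow> l \<in> K \<Longrightarrow> \<sigma> k = 1 \<Longrightarrow> \<sigma> l = 1 \<Longrightarrow> \<sigma> (k \<otimes>\<^bsub>G\<^esub> l) = 1"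
  unfolding order_sign_def by blast

context group begin

lemma order_sign_mult_neg:
  assumes K: "subgroup K G" and s: "order_sign G K \<sigma>" and kl: "k \<in> K" "l \<in> K" "\<sigma> k = -1" "\<sigma> l = -1"
  shows "\<sigma> (k \<otimes> l) = -1"
proof -
  have c: "k \<in> carrier G" "l \<in> carrier G" using kl subgroup.mem_carrier [OF K] by auto
  have i: "inv k \<in> K" "inv l \<in> K" "k \<otimes> l \<in> K"
    using kl subgroup.m_inv_closed [OF K] subgroup.m_closed [OF K] by auto
  have "\<sigma> (inv l \<otimes> inv k) = 1"
    by (rule order_sign_mult [OF s i(2,1)]) (use order_signD(3) [OF s] kl in simp_all)
  then have "\<sigma> (inv (k \<otimes> l)) = 1" using c by (simp add: inv_mult_group)
  then show ?thesis using order_signD(3) [OF s i(3)] by simp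
qed

lemma order_sign_uminus:
  assumes K: "subgroup K G" and s: "order_sign G K \<sigma>" shows "order_sign G K (\<lambda>k. - \<sigma> k)"
  unfolding order_sign_def
proof (intro conjI ballI impI)
  fix k assume k: "k \<in> K"
  show "- \<sigma> k \<in> {-1, 0, 1}" "- \<sigma> k = 0 \<longleftrightarrow> k = \<one>" "- \<sigma> (inv k) = - (- \<sigma> k)"
    using order_signD [OF s k] by auto
next
  fix k l assume "k \<in> K" "l \<in> K" "- \<sigma> k = 1" "- \<sigma> l = 1"
  then show "- \<sigma> (k \<otimes> l) = 1" using order_sign_mult_neg [OF K s, of k l] by simp
qed

lemma order_sign_nat_pow:
  assumes K: "subgroup K G" and s: "order_sign G K \<sigma>" and k: "k \<in> K"
  shows "k [^] Suc n \<in> K \<and> \<sigma> (k [^] Suc n) = \<sigma> k"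
proof (induction n)
  case 0
  then show ?case using k subgroup.mem_carrier [OF K k] by simp
next
  case (Suc n)
  have e: "k [^] Suc (Suc n) = k [^] Suc n \<otimes> k" by simp
  have "k [^] Suc (Suc n) \<in> K" unfolding e using Suc k subgroup.m_closed [OF K] by blast
  moreover have "\<sigma> (k [^] Suc (Suc n)) = \<sigma> k"
  proof (cases "\<sigma> k = 0")
    case True
    then have "k = \<one>" using order_signD(2) [OF s k] by simp
    then show ?thesis using True by simp
  next
    case False
    then consider "\<sigma> k = 1" | "\<sigma> k = -1" using order_signD(1) [OF s k] by blast
    then show ?thesis
      unfolding e
        using Suc order_sign_mult [OF s _ k] order_sign_mult_neg [OF K s _ k] by cases auto
  qed
  ultimately show ?case by blast
qed

lemma order_sign_int_pow:
  assumes K: "subgroup K G" and s: "order_sign G K \<sigma>" and k: "k \<in> K"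
  shows "\<sigma> (k [^] (n::int)) = sgn n * \<sigma> k"
proof -
  have kc: "k \<in> carrier G" using subgroup.mem_carrier [OF K k] .
  show ?thesis
  proof (cases n rule: int_cases)
    case (nonneg m)
    show ?thesis
    proof (cases m)
      case 0
      then show ?thesis
        using nonneg order_signD(2) [OF s, of \<one>] subgroup.one_closed [OF K] by simp
    next
      case (Suc l)
      have "k [^] n = k [^] Suc l" unfolding nonneg Suc by (rule int_pow_int)
      then show ?thesis using order_sign_nat_pow [OF K s k, of l] nonneg Suc by simp
    qed
  next
    case (neg m)
    have "k [^] n = inv (k [^] Suc m)" unfolding neg by (rule int_pow_neg_int [OF kc])
    then show ?thesis
      using order_sign_nat_pow [OF K s k, of m] order_signD(3) [OF s, of "k [^] Suc m"] neg
      by (simp del: nat_pow_Suc)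
  qed
qed

text \<open>An element has the sign of its positive powers, so elements with a common nonzero power have
  signs that determine each other. A group in which any two nontrivial elements are related in this
  way is left ordered by the sign of a single element.\<close>

lemma order_sign_unique_up_to_sign:
  assumes L: "subgroup L G" and s: "order_sign G L \<sigma>" and t: "order_sign G L \<tau>"
    and pow: "\<And>h k. h \<in> L \<Longrightarrow> k \<in> L \<Longrightarrow> h \<noteq> \<one> \<Longrightarrow> k \<noteq> \<one> \<Longrightarrow>
      \<exists>(m::int) (n::int). m \<noteq> 0 \<and> n \<noteq> 0 \<and> h [^] m = k [^] n"
  shows "(\<forall>h\<in>L. \<tau> h = \<sigma> h) \<or> (\<forall>h\<in>L. \<tau> h = - \<sigma> h)"
proof (cases "\<exists>k\<in>L. k \<noteq> \<one>")
  case False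
  then have "\<tau> h = 0 \<and> \<sigma> h = 0" if "h \<in> L" for h
    using order_signD(2) [OF s that] order_signD(2) [OF t that] that by blast
  then show ?thesis by simp
next
  case True
  then obtain k where k: "k \<in> L" "k \<noteq> \<one>" by blast
  have "\<tau> h * \<sigma> k = \<sigma> h * \<tau> k" if h: "h \<in> L" for h
  proof (cases "h = \<one>")
    case True
    then show ?thesis using order_signD(2) [OF s h] order_signD(2) [OF t h] by simp
  next
    case False
    obtain m n :: int where mn: "m \<noteq> 0" "n \<noteq> 0" "h [^] m = k [^] n"
      using pow [OF h k(1) False k(2)] by blast
    have 1: "sgn m * \<sigma> h = sgn n * \<sigma> k" "sgn m * \<tau> h = sgn n * \<tau> k"
      using order_sign_int_pow [OF L s h, of m] order_sign_int_pow [OF L s k(1), of n]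
        order_sign_int_pow [OF L t h, of m] order_sign_int_pow [OF L t k(1), of n] mn(3) by auto
    have "sgn m = 1 \<or> sgn m = -1" "sgn n = 1 \<or> sgn n = -1" using mn by (auto simp: sgn_if)
    then have "\<sigma> k = \<sigma> h \<and> \<tau> k = \<tau> h \<or> \<sigma> k = - \<sigma> h \<and> \<tau> k = - \<tau> h"
      using 1 by (elim disjE) simp_all
    then show ?thesis by auto
  qed
  note eq = this
  have k0: "\<sigma> k \<noteq> 0" "\<tau> k \<noteq> 0"
    using order_signD(2) [OF s k(1)] order_signD(2) [OF t k(1)] k(2) by blast+
  then consider "\<tau> k = \<sigma> k" | "\<tau> k = - \<sigma> k"
    using order_signD(1) [OF s k(1)] order_signD(1) [OF t k(1)] by linarith
  then show ?thesis
  proof cases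
    case 1
    then have "\<tau> h = \<sigma> h" if "h \<in> L" for h using k0 eq [OF that] by simp
    then show ?thesis by blast
  next
    case 2
    have "\<tau> h = - \<sigma> h" if "h \<in> L" for h
    proof -
      have "\<tau> h * \<sigma> k = (- \<sigma> h) * \<sigma> k" using eq [OF that] 2 by simp
      then show ?thesis using k0(1) unfolding mult_cancel_right by blast
    qed
    then show ?thesis by blast
  qed
qed

end

section \<open>Extending an invariant circular order to a free orbit\<close>

locale free_action = group G for G (structure) +
  fixes N :: "'x set" and act :: "'a \<Rightarrow> 'x \<Rightarrow> 'x"
  assumes act_closed: "g \<in> carrier G \<Longrightarrow> u \<in> N \<Longrightarrow> act g u \<in> N"
    and act_one: "u \<in> N \<Longrightarrow> act \<one> u = u"
    and act_mult: "g \<in> carrier G \<Longrightarrow> h \<in> carrier G \<Longrightarrow> u \<in> N \<Longrightarrow> act (g \<otimes> h) u = act g (act h u)"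
    and act_free: "g \<in> carrier G \<Longrightarrow> u \<in> N \<Longrightarrow> act g u = u \<Longrightarrow> g = \<one>"
begin

lemma act_inv: "g \<in> carrier G \<Longrightarrow> u \<in> N \<Longrightarrow> act (inv g) (act g u) = u"
  "g \<in> carrier G \<Longrightarrow> u \<in> N \<Longrightarrow> act g (act (inv g) u) = u"
  using act_mult [of "inv g" g u] act_mult [of g "inv g" u] by (simp_all add: act_one)

lemma act_inj: "g \<in> carrier G \<Longrightarrow> u \<in> N \<Longrightarrow> v \<in> N \<Longrightarrow> act g u = act g v \<longleftrightarrow> u = v"
  by (metis act_inv(1))

lemma act_cancel:
  assumes "g \<in> carrier G" "h \<in> carrier G" "u \<in> N" "act g u = act h u" shows "g = h"
proof -
  have "act (inv h \<otimes> g) u = u" using assms by (simp add: act_mult act_inv)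
  then have "inv h \<otimes> g = \<one>" using act_free assms by simp
  then show ?thesis using assms by (metis inv_equality inv_inv inv_closed)
qed

lemma act_image:
  assumes g: "g \<in> carrier G" and Y: "Y \<subseteq> N" "\<And>h u. h \<in> carrier G \<Longrightarrow> u \<in> Y \<Longrightarrow> act h u \<in> Y"
  shows "act g ` Y = Y"
proof
  show "Y \<subseteq> act g ` Y"
  proof
    fix u assume u: "u \<in> Y"
    then have "u = act g (act (inv g) u)" using g Y act_inv(2) by auto
    then show "u \<in> act g ` Y" using Y g u by blast
  qed
qed (use g Y in auto)

text \<open>The cut of \<open>Y\<close> at \<open>act g x\<close> has to be the translate by \<open>g\<close> of the cut at \<open>x\<close>. Points of the
  orbit with the same cut differ by the stabiliser \<open>K\<close> of a cut. A stabilised cut turns \<open>Y\<close> into a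
  line on which \<open>K\<close> acts freely, so \<open>K\<close> has a left order, read off from a point \<open>y0\<close> of \<open>Y\<close> as \<open>\<tau>\<close>.
  Ordering the fibres by a left order of \<open>K\<close> makes the result invariant. It extends the given order
  if that left order agrees on \<open>K \<inter> S\<close> with the order \<open>lam\<close> in which the points \<open>act h x\<close> already
  lie. By \<open>order_sign_unique_up_to_sign\<close> the order \<open>lam\<close> is the restriction of \<open>\<tau>\<close> or of its
  reverse, and both of these are left orders of \<open>K\<close>.\<close>

theorem extend_to_orbit:
  assumes S: "subgroup S G"
    and pow: "\<And>h k. h \<in> S \<Longrightarrow> k \<in> S \<Longrightarrow> h \<noteq> \<one> \<Longrightarrow> k \<noteq> \<one> \<Longrightarrow>
      \<exists>(m::int) (n::int). m \<noteq> 0 \<and> n \<noteq> 0 \<and> h [^] m = k [^] n"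
    and Y: "Y \<subseteq> N" "Y \<noteq> {}" "\<And>g u. g \<in> carrier G \<Longrightarrow> u \<in> Y \<Longrightarrow> act g u \<in> Y"
    and x: "x \<in> N" "x \<notin> Y"
    and C: "circ_on (Y \<union> (\<lambda>s. act s x) ` S) C"
    and invY: "\<And>g u v w. g \<in> carrier G \<Longrightarrow> u \<in> Y \<Longrightarrow> v \<in> Y \<Longrightarrow> w \<in> Y \<Longrightarrow>
      C (act g u) (act g v) (act g w) = C u v w"
    and invS: "\<And>s u v w. s \<in> S \<Longrightarrow> u \<in> Y \<union> (\<lambda>s. act s x) ` S \<Longrightarrow> v \<in> Y \<union> (\<lambda>s. act s x) ` S \<Longrightarrow>
      w \<in> Y \<union> (\<lambda>s. act s x) ` S \<Longrightarrow> C (act s u) (act s v) (act s w) = C u v w"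
  shows "\<exists>E. circ_on (Y \<union> (\<lambda>g. act g x) ` carrier G) E \<and>
    (\<forall>u\<in>Y \<union> (\<lambda>s. act s x) ` S. \<forall>v\<in>Y \<union> (\<lambda>s. act s x) ` S. \<forall>w\<in>Y \<union> (\<lambda>s. act s x) ` S.
      E u v w = C u v w) \<and>
    (\<forall>g\<in>carrier G. circ_automorphism (Y \<union> (\<lambda>g. act g x) ` carrier G) E (act g))"
proof -
  define A where "A = Y \<union> (\<lambda>s. act s x) ` S"
  define B where "B = Y \<union> (\<lambda>g. act g x) ` carrier G"
  note C = C [folded A_def] and invS = invS [folded A_def]
  have Sc: "s \<in> carrier G" if "s \<in> S" for s using subgroup.mem_carrier [OF S that] .
  have xA: "x \<in> A"
    using subgroup.one_closed [OF S] act_one [OF x(1)] unfolding A_def by force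
  have YA: "Y \<subseteq> A" by (auto simp: A_def)
  have notY: "act g x \<notin> Y" if g: "g \<in> carrier G" for g
    using Y(3) [of "inv g" "act g x"] g x act_inv(1) [OF g x(1)] by auto
  have BN: "B \<subseteq> N" using Y act_closed x by (auto simp: B_def)
  define \<gamma> where "\<gamma> u = (THE g. g \<in> carrier G \<and> act g x = u)" for u
  have \<gamma>: "\<gamma> (act g x) = g" if "g \<in> carrier G" for g
    unfolding \<gamma>_def using that act_cancel [OF _ that x(1)] by (intro the_equality) auto
  obtain y0 where y0: "y0 \<in> Y" using Y(2) by blast
  have y0N: "y0 \<in> N" using y0 Y by blast
  \<comment> \<open>As \<open>x\<close> is not in \<open>Y\<close>, the cut at \<open>x\<close> is simply \<open>C x\<close>.\<close>
  have fx: "is_cut Y C (C x)"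
    using is_cut_cong [OF is_cut_subset [OF is_cut_cut_at [OF C xA] YA]] circ_on_zero [OF C xA] x YA
    by (smt (verit, best) cut_at_def subsetD)
  note lx = is_cut_lin [OF fx]

  define K where "K = {k \<in> carrier G. \<forall>a\<in>Y. \<forall>b\<in>Y. C x (act k a) (act k b) = C x a b}"
  have KD: "k \<in> carrier G" "C x (act k a) (act k b) = C x a b" if "k \<in> K" "a \<in> Y" "b \<in> Y" for k a b
    using that by (auto simp: K_def)
  have K: "subgroup K G"
  proof (rule subgroupI)
    show "K \<subseteq> carrier G" by (auto simp: K_def)
    have "\<one> \<in> K" using act_one Y by (auto simp: K_def subset_iff)
    then show "K \<noteq> {}" by blast
  next
    fix k assume k: "k \<in> K"
    then have kc: "k \<in> carrier G" by (simp add: K_def)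
    have "C x (act (inv k) a) (act (inv k) b) = C x a b" if "a \<in> Y" "b \<in> Y" for a b
      using KD(2) [OF k, of "act (inv k) a" "act (inv k) b"] Y that kc act_inv(2) [OF kc]
      by (simp add: subset_iff)
    then show "inv k \<in> K" using kc by (simp add: K_def)
  next
    fix k l assume k: "k \<in> K" and l: "l \<in> K"
    then have c: "k \<in> carrier G" "l \<in> carrier G" by (simp_all add: K_def)
    have "C x (act (k \<otimes> l) a) (act (k \<otimes> l) b) = C x a b" if "a \<in> Y" "b \<in> Y" for a b
    proof -
      have "a \<in> N" "b \<in> N" using that Y by auto
      then show ?thesis
        using KD(2) [OF k, of "act l a" "act l b"] KD(2) [OF l that] Y(3) [OF c(2)] that c
        by (simp add: act_mult)
    qed
    then show "k \<otimes> l \<in> K" using c by (simp add: K_def)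
  qed
  define \<tau> where "\<tau> k = C x y0 (act k y0)" for k
  have \<tau>: "order_sign G K \<tau>"
    unfolding order_sign_def
  proof (intro conjI ballI impI)
    fix k assume k: "k \<in> K"
    then have kc: "k \<in> carrier G" by (simp add: K_def)
    have ky: "act k y0 \<in> Y" "act (inv k) y0 \<in> Y" using Y(3) y0 kc by auto
    show "\<tau> k \<in> {-1, 0, 1}" using lin_on_values [OF lx y0 ky(1)] by (auto simp: \<tau>_def)
    have "act k y0 = y0 \<longleftrightarrow> k = \<one>" using act_free [OF kc y0N] act_one [OF y0N] by auto
    then show "\<tau> k = 0 \<longleftrightarrow> k = \<one>" using lin_on_zero [OF lx y0 ky(1)] by (auto simp: \<tau>_def)
    have "\<tau> (inv k) = C x (act k y0) y0"
      using KD(2) [OF k y0 ky(2)] act_inv(2) [OF kc y0N] by (simp add: \<tau>_def)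
    then show "\<tau> (inv k) = - \<tau> k" using lin_on_antisym [OF lx y0 ky(1)] by (simp add: \<tau>_def)
  next
    fix k l assume kl: "k \<in> K" "l \<in> K" "\<tau> k = 1" "\<tau> l = 1"
    then have c: "k \<in> carrier G" "l \<in> carrier G" by (simp_all add: K_def)
    have Yk: "act k y0 \<in> Y" "act l y0 \<in> Y" "act k (act l y0) \<in> Y" using Y(3) y0 c by auto
    have "C x (act k y0) (act k (act l y0)) = 1"
      using KD(2) [OF kl(1) y0 Yk(2)] kl(4) by (simp add: \<tau>_def)
    then have "C x y0 (act k (act l y0)) = 1"
      using lin_on_trans [OF lx y0 Yk(1,3)] kl(3) by (simp add: \<tau>_def)
    then show "\<tau> (k \<otimes> l) = 1" using c y0N by (simp add: \<tau>_def act_mult)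
  qed

  define f where "f u = (if u \<in> Y then cut_at C u
    else (\<lambda>a b. C x (act (inv (\<gamma> u)) a) (act (inv (\<gamma> u)) b)))" for u
  have f_orbit: "f (act g x) a b = C x (act (inv g) a) (act (inv g) b)" if "g \<in> carrier G" for g a b
    using notY [OF that] \<gamma> [OF that] by (simp add: f_def)
  have same_K: "same_cut Y (f (act g x)) (f (act h x)) \<longleftrightarrow> inv g \<otimes> h \<in> K"
    if gh: "g \<in> carrier G" "h \<in> carrier G" for g h
  proof
    assume same: "same_cut Y (f (act g x)) (f (act h x))"
    have "C x (act (inv g \<otimes> h) a) (act (inv g \<otimes> h) b) = C x a b" if ab: "a \<in> Y" "b \<in> Y" for a b
    proof -
      have N: "a \<in> N" "b \<in> N" using ab Y by auto
      show ?thesis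
        using same_cutD [OF same, of "act h a" "act h b"] Y(3) [OF gh(2)] ab N gh
        by (simp add: f_orbit act_mult act_inv)
    qed
    then show "inv g \<otimes> h \<in> K" using gh by (simp add: K_def)
  next
    assume k: "inv g \<otimes> h \<in> K"
    show "same_cut Y (f (act g x)) (f (act h x))"
      unfolding same_cut_def
    proof (intro ballI)
      fix a b assume ab: "a \<in> Y" "b \<in> Y"
      have N: "a \<in> N" "b \<in> N" using ab Y by auto
      show "f (act g x) a b = f (act h x) a b"
        using KD(2) [OF k, of "act (inv h) a" "act (inv h) b"] Y(3) [of "inv h"] ab N gh
        by (simp add: f_orbit act_mult act_inv act_closed)
    qed
  qed
  have fA: "same_cut Y (f u) (cut_at C u)" if u: "u \<in> A" for u
  proof (cases "u \<in> Y")
    case True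
    then show ?thesis by (simp add: f_def same_cut_refl)
  next
    case False
    then obtain g where g: "g \<in> S" "u = act g x" using u by (auto simp: A_def)
    have gc: "g \<in> carrier G" using Sc g by blast
    have "f u a b = cut_at C u a b" if ab: "a \<in> Y" "b \<in> Y" for a b
    proof -
      have i: "act (inv g) a \<in> Y" "act (inv g) b \<in> Y" "a \<in> N" "b \<in> N"
        using Y gc ab by auto
      have "C (act g x) (act g (act (inv g) a)) (act g (act (inv g) b))
        = C x (act (inv g) a) (act (inv g) b)"
        by (rule invS [OF g(1) xA]) (use i YA in auto)
      then have "f u a b = C u a b" using i gc g(2) by (simp add: f_orbit act_inv)
      moreover have "C u b b = 0" using circ_on_zero [OF C u, of b b] ab YA by auto
      ultimately show ?thesis using False ab by (auto simp: cut_at_def)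
    qed
    then show ?thesis by (simp add: same_cut_def)
  qed

  define L where "L = K \<inter> S"
  have L: "subgroup L G" unfolding L_def by (rule subgroups_Inter_pair [OF K S])
  have LK: "L \<subseteq> K" and LS: "L \<subseteq> S" by (auto simp: L_def)
  have same_L: "same_cut Y (cut_at C (act g x)) (cut_at C (act h x)) \<longleftrightarrow> inv g \<otimes> h \<in> L"
    if gh: "g \<in> S" "h \<in> S" for g h
  proof -
    have "act g x \<in> A" "act h x \<in> A" using gh by (auto simp: A_def)
    then have "same_cut Y (cut_at C (act g x)) (cut_at C (act h x)) \<longleftrightarrow>
        same_cut Y (f (act g x)) (f (act h x))"
      using same_cut_cong [OF fA fA] by blast
    moreover have "inv g \<otimes> h \<in> S"
      using gh subgroup.m_closed [OF S] subgroup.m_inv_closed [OF S] by blast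
    ultimately show ?thesis using same_K gh Sc by (simp add: L_def)
  qed
  define lam where "lam h = C y0 x (act h x)" for h
  have hx: "act h x \<in> A" if "h \<in> S" for h using that by (auto simp: A_def)
  have one_S: "\<one> \<in> S" using subgroup.one_closed [OF S] .
  have y0A: "y0 \<in> A" using y0 YA by blast
  have base: "C y (act g x) (act h x) = C y' (act g x) (act h x)"
    if "g \<in> S" "h \<in> S" "inv g \<otimes> h \<in> L" "y \<in> Y" "y' \<in> Y" for g h y y'
    using same_cut_base [OF C YA _ _ _ that(4,5), of "act g x" "act h x"] same_L that hx notY Sc by blast
  have lam_shift: "C y (act g x) (act h x) = lam (inv g \<otimes> h)"
    if "g \<in> S" "h \<in> S" "inv g \<otimes> h \<in> L" "y \<in> Y" for g h y
  proof -
    have c: "g \<in> carrier G" "h \<in> carrier G" using that Sc by auto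
    have i: "inv g \<otimes> h \<in> S" using that LS by blast
    have "C (act g y0) (act g x) (act g (act (inv g \<otimes> h) x)) = C y0 x (act (inv g \<otimes> h) x)"
      by (rule invS [OF that(1) y0A xA hx [OF i]])
    moreover have "act g (act (inv g \<otimes> h) x) = act h x"
      using c x act_inv(2) act_closed by (simp add: act_mult)
    ultimately show ?thesis
      using base [OF that(1-4) Y(3) [OF c(1) y0]] by (simp add: lam_def)
  qed
  have lam: "order_sign G L lam"
    unfolding order_sign_def
  proof (intro conjI ballI impI)
    fix h assume h: "h \<in> L"
    then have hS: "h \<in> S" and hc: "h \<in> carrier G" using LS Sc by auto
    show "lam h \<in> {-1, 0, 1}" using circ_on_values [OF C y0A xA hx [OF hS]] by (auto simp: lam_def)
    have "act h x = x \<longleftrightarrow> h = \<one>" using act_free [OF hc x(1)] act_one [OF x(1)] by auto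
    moreover have "y0 \<noteq> x" "y0 \<noteq> act h x" using y0 x(2) notY [OF hc] by auto
    ultimately show "lam h = 0 \<longleftrightarrow> h = \<one>"
      using circ_on_zero [OF C y0A xA hx [OF hS]] by (auto simp: lam_def)
    have "C y0 (act h x) (act \<one> x) = lam (inv h \<otimes> \<one>)"
      by (rule lam_shift [OF hS one_S _ y0]) (use h subgroup.m_inv_closed [OF L] hc in simp)
    then show "lam (inv h) = - lam h"
      using circ_on_flip [OF C y0A xA hx [OF hS]] hc act_one [OF x(1)] by (simp add: lam_def)
  next
    fix h k assume hk: "h \<in> L" "k \<in> L" "lam h = 1" "lam k = 1"
    then have hS: "h \<in> S" "k \<in> S" "h \<otimes> k \<in> S" and hc: "h \<in> carrier G" "k \<in> carrier G"
      using LS Sc subgroup.m_closed [OF L] by auto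
    have "C y0 (act h x) (act (h \<otimes> k) x) = lam (inv h \<otimes> (h \<otimes> k))"
      by (rule lam_shift [OF hS(1,3) _ y0]) (use hk hc in \<open>simp add: m_assoc [symmetric]\<close>)
    then have "C y0 (act h x) (act (h \<otimes> k) x) = 1" using hk hc by (simp add: m_assoc [symmetric])
    then show "lam (h \<otimes> k) = 1"
      using circ_on_trans [OF C y0A xA hx [OF hS(1)] hx [OF hS(3)]] hk(3) by (simp add: lam_def)
  qed
  have \<tau>L: "order_sign G L \<tau>" using \<tau> LK unfolding order_sign_def by blast
  obtain \<sigma> where \<sigma>: "order_sign G K \<sigma>" and \<sigma>L: "\<And>h. h \<in> L \<Longrightarrow> \<sigma> h = lam h"
  proof -
    have "(\<forall>h\<in>L. lam h = \<tau> h) \<or> (\<forall>h\<in>L. lam h = - \<tau> h)"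
      by (rule order_sign_unique_up_to_sign [OF L \<tau>L lam pow]) (use LS in blast)+
    then show ?thesis
      using that [OF \<tau>] that [OF order_sign_uminus [OF K \<tau>]] by fastforce
  qed
  have fcut: "is_cut Y C (f u)" if u: "u \<in> B" for u
  proof (cases "u \<in> A")
    case True
    have "f u a b = cut_at C u a b" if "a \<in> Y" "b \<in> Y" for a b
      using same_cutD [OF fA [OF True] that] .
    then show ?thesis
      by (rule is_cut_cong [OF is_cut_subset [OF is_cut_cut_at [OF C True] YA]])
  next
    case False
    then obtain g where g: "g \<in> carrier G" "u = act g x" using u YA by (auto simp: A_def B_def)
    have fu: "f u a b = C x (act (inv g) a) (act (inv g) b)" for a b
      using f_orbit g by simp
    have i: "act (inv g) a \<in> Y" "a \<in> N" if "a \<in> Y" for a using Y g that by auto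
    have inj: "act (inv g) a = act (inv g) b \<longleftrightarrow> a = b" if "a \<in> Y" "b \<in> Y" for a b
      using act_inj [of "inv g" a b] i that g by simp
    have "lin_on Y (f u)"
      unfolding lin_on_def fu
    proof (intro conjI ballI impI)
      fix a b assume ab: "a \<in> Y" "b \<in> Y"
      show "C x (act (inv g) a) (act (inv g) b) \<in> {-1, 0, 1}"
        using lin_on_values [OF lx i(1) [OF ab(1)] i(1) [OF ab(2)]] by auto
      show "C x (act (inv g) a) (act (inv g) b) = 0 \<longleftrightarrow> a = b"
        using lin_on_zero [OF lx i(1) [OF ab(1)] i(1) [OF ab(2)]] inj [OF ab] by auto
      show "C x (act (inv g) b) (act (inv g) a) = - C x (act (inv g) a) (act (inv g) b)"
        using lin_on_antisym [OF lx i(1) [OF ab(1)] i(1) [OF ab(2)]] .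
    next
      fix a b c assume ab: "a \<in> Y" "b \<in> Y" "c \<in> Y"
        "C x (act (inv g) a) (act (inv g) b) = 1" "C x (act (inv g) b) (act (inv g) c) = 1"
      then show "C x (act (inv g) a) (act (inv g) c) = 1"
        using lin_on_trans [OF lx i(1) i(1) i(1)] by blast
    qed
    moreover have "C a b c = coboundary (f u) a b c" if "a \<in> Y" "b \<in> Y" "c \<in> Y" for a b c
    proof -
      have "C a b c = C (act (inv g) a) (act (inv g) b) (act (inv g) c)"
        using invY [of "inv g" a b c] g that by simp
      also have "\<dots> = coboundary (f u) a b c"
        using is_cut_coboundary [OF fx i(1) i(1) i(1), OF that] by (simp add: coboundary_def fu)
      finally show ?thesis .
    qed
    ultimately show ?thesis by (simp add: is_cut_def)
  qed

  define s where "s u v = (if u \<notin> Y \<and> v \<notin> Y then \<sigma> (inv (\<gamma> u) \<otimes> \<gamma> v)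
    else if u \<in> Y \<and> v \<in> Y then 0 else if v \<in> Y then 1 else -1)" for u v
  have s_orbit: "s (act g x) (act h x) = \<sigma> (inv g \<otimes> h)" if "g \<in> carrier G" "h \<in> carrier G" for g h
    using that notY \<gamma> by (simp add: s_def)
  have pt: "u = v" if "u \<in> Y" "v \<in> Y" "same_cut Y (f u) (f v)" for u v
    using same_cut_point [of u Y v C] that by (simp add: f_def)
  have orb: "\<exists>g\<in>carrier G. u = act g x" if "u \<in> B" "u \<notin> Y" for u
    using that by (auto simp: B_def)
  have fib: "fibre_order Y f s B"
    unfolding fibre_order_def lin_on_def
  proof (intro conjI ballI impI)
    fix z u v assume "z \<in> B" and "u \<in> {u \<in> B. same_cut Y (f u) (f z)}"
      and "v \<in> {u \<in> B. same_cut Y (f u) (f z)}"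
    then have uv: "u \<in> B" "v \<in> B" and same: "same_cut Y (f u) (f v)"
      by (auto intro: same_cut_trans same_cut_sym)
    have "s u v \<in> {-1, 0, 1} \<and> (s u v = 0 \<longleftrightarrow> u = v) \<and> s v u = - s u v"
    proof (cases "u \<notin> Y \<and> v \<notin> Y")
      case True
      then obtain g h where gh: "g \<in> carrier G" "h \<in> carrier G" "u = act g x" "v = act h x"
        using orb [OF uv(1)] orb [OF uv(2)] by auto
      have k: "inv g \<otimes> h \<in> K" using same_K [OF gh(1,2)] same unfolding gh(3,4) by simp
      have "inv (inv g \<otimes> h) = inv h \<otimes> g" using gh by (simp add: inv_mult_group)
      then have *: "\<sigma> (inv h \<otimes> g) = - \<sigma> (inv g \<otimes> h)" using order_signD(3) [OF \<sigma> k] by simp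
      have "inv g \<otimes> h = \<one> \<longleftrightarrow> g = h"
        using gh by (metis inv_closed inv_equality inv_inv l_inv)
      then have "inv g \<otimes> h = \<one> \<longleftrightarrow> u = v"
        unfolding gh(3,4) using act_cancel [OF gh(1,2) x(1)] by auto
      then show ?thesis
        using order_signD(1,2) [OF \<sigma> k] * gh(3,4) s_orbit [OF gh(1,2)] s_orbit [OF gh(2,1)] by auto
    next
      case False
      then show ?thesis using pt [OF _ _ same] by (auto simp: s_def)
    qed
    then show "s u v \<in> {-1, 0, 1}" "s u v = 0 \<longleftrightarrow> u = v" "s v u = - s u v" by blast+
  next
    fix z u v w assume "z \<in> B" and "u \<in> {u \<in> B. same_cut Y (f u) (f z)}"
      and "v \<in> {u \<in> B. same_cut Y (f u) (f z)}" and "w \<in> {u \<in> B. same_cut Y (f u) (f z)}"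
      and s1: "s u v = 1" "s v w = 1"
    then have uv: "u \<in> B" "v \<in> B" "w \<in> B" and same: "same_cut Y (f u) (f v)" "same_cut Y (f v) (f w)"
      by (auto intro: same_cut_trans same_cut_sym)
    have uY: "u \<notin> Y" and vY: "v \<notin> Y" using s1 by (auto simp: s_def split: if_splits)
    show "s u w = 1"
    proof (cases "w \<in> Y")
      case True
      then show ?thesis using uY by (simp add: s_def)
    next
      case False
      then obtain g h k where gh: "g \<in> carrier G" "h \<in> carrier G" "k \<in> carrier G"
        "u = act g x" "v = act h x" "w = act k x"
        using orb [OF uv(1) uY] orb [OF uv(2) vY] orb [OF uv(3)] by auto
      have "\<sigma> ((inv g \<otimes> h) \<otimes> (inv h \<otimes> k)) = 1"
        by (rule order_sign_mult [OF \<sigma>])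
          (use same same_K gh s1 s_orbit in auto)
      moreover have "(inv g \<otimes> h) \<otimes> (inv h \<otimes> k) = inv g \<otimes> k"
        using gh(1-3) by (metis inv_closed inv_solve_left m_assoc m_closed)
      ultimately show ?thesis using s_orbit gh by simp
    qed
  qed
  let ?E = "lex_circular Y f s"
  have 1: "circ_on B ?E" by (rule circ_on_lex_circular [OF fcut fib Y(2)])
  have 2: "?E u v w = C u v w" if "u \<in> A" "v \<in> A" "w \<in> A" for u v w
  proof (rule lex_circular_decomposition [OF C YA Y(2) fA])
    fix u v y assume uv: "u \<in> A - Y" "v \<in> A - Y" and y: "y \<in> Y"
      and same: "same_cut Y (cut_at C u) (cut_at C v)"
    obtain g h where gh: "g \<in> S" "h \<in> S" "u = act g x" "v = act h x"
      using uv by (auto simp: A_def)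
    have l: "inv g \<otimes> h \<in> L" using same_L [OF gh(1,2)] same unfolding gh(3,4) by simp
    have "s u v = lam (inv g \<otimes> h)" using s_orbit [OF Sc Sc, OF gh(1,2)] gh(3,4) \<sigma>L [OF l] by simp
    then show "s u v = C y u v" using lam_shift [OF gh(1,2) l y] gh by simp
  qed (use that in \<open>auto simp: s_def\<close>)
  have 3: "circ_automorphism B ?E (act g)" if g: "g \<in> carrier G" for g
  proof -
    have Yg: "act g a \<in> Y \<longleftrightarrow> a \<in> Y" if "a \<in> B" for a
    proof
      assume "act g a \<in> Y"
      then have "act (inv g) (act g a) \<in> Y" using Y(3) g by simp
      then show "a \<in> Y" using act_inv(1) [OF g] BN that by auto
    qed (use Y(3) g in blast)
    have gB: "act g a \<in> B" if g: "g \<in> carrier G" and a: "a \<in> B" for g a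
    proof (cases "a \<in> Y")
      case True
      then show ?thesis using Y(3) [OF g] by (simp add: B_def)
    next
      case False
      then obtain h where h: "h \<in> carrier G" "a = act h x" using orb [OF a] by auto
      then have "act g a = act (g \<otimes> h) x" using g x by (simp add: act_mult)
      then show ?thesis using g h by (auto simp: B_def)
    qed
    have gBs: "act g ` B = B" by (rule act_image [OF g BN gB])
    note gB = gB [OF g]
    have fg: "f (act g a) (act g b) (act g c) = f a b c" if abc: "a \<in> B" "b \<in> Y" "c \<in> Y" for a b c
    proof (cases "a \<in> Y")
      case True
      have "a \<in> N" "b \<in> N" "c \<in> N" using abc True Y by auto
      then show ?thesis
        using True Y(3) [OF g True] invY [OF g True abc(2,3)] act_inj [OF g]
        by (simp add: f_def cut_at_def)
    next
      case False
      then obtain h where h: "h \<in> carrier G" "a = act h x" using orb [OF abc(1)] by auto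
      have N: "b \<in> N" "c \<in> N" using abc Y by auto
      have "act g a = act (g \<otimes> h) x" using g h x by (simp add: act_mult)
      then show ?thesis
        using f_orbit [of "g \<otimes> h" "act g b" "act g c"] f_orbit [OF h(1), of b c] g h N
        by (simp add: inv_mult_group act_mult act_inv act_closed)
    qed
    have sg: "s (act g a) (act g b) = s a b" if ab: "a \<in> B" "b \<in> B" for a b
    proof (cases "a \<in> Y \<or> b \<in> Y")
      case True
      then show ?thesis using Yg ab by (auto simp: s_def)
    next
      case False
      then obtain h k where h: "h \<in> carrier G" "a = act h x" "k \<in> carrier G" "b = act k x"
        using orb [OF ab(1)] orb [OF ab(2)] by auto
      have "act g a = act (g \<otimes> h) x" "act g b = act (g \<otimes> k) x"
        using g h x by (simp_all add: act_mult)
      moreover have "inv (g \<otimes> h) \<otimes> (g \<otimes> k) = inv h \<otimes> k"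
        using g h by (simp add: inv_mult_group m_assoc inv_solve_left' m_assoc [symmetric])
      ultimately show ?thesis
        using s_orbit [of "g \<otimes> h" "g \<otimes> k"] s_orbit [OF h(1,3)] g h by simp
    qed
    have "?E (act g u) (act g v) (act g w) = ?E u v w" if uvw: "u \<in> B" "v \<in> B" "w \<in> B" for u v w
    proof -
      have in3: "y \<in> B" if "y \<in> {u, v, w}" for y using uvw that by auto
      show ?thesis
        by (rule lex_circular_invariant [OF fcut Y(2) uvw gB [OF uvw(1)] gB [OF uvw(2)] gB [OF uvw(3)]
              act_image [OF g Y(1,3)]]) (simp_all only: fg [OF in3] sg [OF in3 in3])
    qed
    moreover have "inj_on (act g) B" using act_inj [OF g] BN by (auto intro: inj_onI)
    ultimately show ?thesis using gBs by (intro circ_automorphismI)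
  qed
  show ?thesis
    unfolding A_def [symmetric] B_def [symmetric] using 1 2 3 by (intro exI [of _ ?E]) simp
qed

end

section \<open>Orders on trees of orbits\<close>

text \<open>The situation of an amalgam acting on its elements by left multiplication, as far as it is
  needed to put an order on them. The group \<open>H\<close> acts through each \<open>G i\<close> in the same way, by \<open>hact\<close>.
  The value \<open>head x\<close> is the index of the leftmost letter of the normal form of \<open>x\<close>. Multiplication
  by an element of \<open>G i\<close> outside \<open>H\<close> puts a letter \<open>i\<close> in front if there was none, so every \<open>G
  i\<close>-orbit contains at most one \<open>H\<close>-orbit of elements with another head; this is \<open>head_orbit\<close>. It
  expresses that the orbits of the groups \<open>G i\<close> hang together along \<open>H\<close>-orbits in the shape of a
  tree.\<close>

locale tree_of_orbits =
  fixes I :: "'i set" and G :: "'i \<Rightarrow> ('g, 'm) monoid_scheme" and H :: "('h, 'n) monoid_scheme"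
    and \<phi> :: "'i \<Rightarrow> 'h \<Rightarrow> 'g" and N :: "'x set" and act :: "'i \<Rightarrow> 'g \<Rightarrow> 'x \<Rightarrow> 'x"
    and hact :: "'h \<Rightarrow> 'x \<Rightarrow> 'x" and n0 :: 'x and head :: "'x \<Rightarrow> 'i option"
  assumes action: "i \<in> I \<Longrightarrow> free_action (G i) N (act i)"
    and group_H: "group H" and hom: "i \<in> I \<Longrightarrow> \<phi> i \<in> hom H (G i)"
    and hact: "i \<in> I \<Longrightarrow> h \<in> carrier H \<Longrightarrow> x \<in> N \<Longrightarrow> act i (\<phi> i h) x = hact h x"
    and n0: "n0 \<in> N"
    and head_n0: "h \<in> carrier H \<Longrightarrow> head (hact h n0) = None"
    and head_orbit: "i \<in> I \<Longrightarrow> x \<in> N \<Longrightarrow> g \<in> carrier (G i) \<Longrightarrow> head x \<noteq> Some i \<Longrightarrow>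
      head (act i g x) \<noteq> Some i \<Longrightarrow> g \<in> \<phi> i ` carrier H"
    and generated: "X \<subseteq> N \<Longrightarrow> n0 \<in> X \<Longrightarrow>
      (\<And>i g x. i \<in> I \<Longrightarrow> g \<in> carrier (G i) \<Longrightarrow> x \<in> X \<Longrightarrow> act i g x \<in> X) \<Longrightarrow> X = N"
    and I: "I \<noteq> {}"
begin

abbreviation "S i \<equiv> \<phi> i ` carrier H"

lemma group_G: "i \<in> I \<Longrightarrow> group (G i)"
  using action unfolding free_action_def by blast

lemma subgroup_S: "i \<in> I \<Longrightarrow> subgroup (S i) (G i)"
  using group_hom.img_is_subgroup [of H "G i" "\<phi> i"] group_H hom group_G
  by (simp add: group_hom_def group_hom_axioms_def)

lemma S_carrier: "i \<in> I \<Longrightarrow> g \<in> S i \<Longrightarrow> g \<in> carrier (G i)"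
  using subgroup.mem_carrier [OF subgroup_S] .

lemma hact_S: "i \<in> I \<Longrightarrow> g \<in> S i \<Longrightarrow> x \<in> N \<Longrightarrow> \<exists>h\<in>carrier H. act i g x = hact h x"
  using hact by auto

end

locale ordered_tree_of_orbits = tree_of_orbits I G H \<phi> N act hact n0 head
  for I :: "'i set" and G :: "'i \<Rightarrow> ('g, 'm) monoid_scheme" and H :: "('h, 'n) monoid_scheme"
    and \<phi> and N :: "'x set" and act and hact and n0 and head +
  fixes c :: "'i \<Rightarrow> 'g \<Rightarrow> 'g \<Rightarrow> 'g \<Rightarrow> int"
  assumes circ: "i \<in> I \<Longrightarrow> circular_ordering (G i) (c i)"
    and agree: "i \<in> I \<Longrightarrow> j \<in> I \<Longrightarrow> h \<in> carrier H \<Longrightarrow> k \<in> carrier H \<Longrightarrow> l \<in> carrier H \<Longrightarrow>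
      c i (\<phi> i h) (\<phi> i k) (\<phi> i l) = c j (\<phi> j h) (\<phi> j k) (\<phi> j l)"
    and common_powers: "i \<in> I \<Longrightarrow> g \<in> S i \<Longrightarrow> g' \<in> S i \<Longrightarrow> g \<noteq> \<one>\<^bsub>G i\<^esub> \<Longrightarrow> g' \<noteq> \<one>\<^bsub>G i\<^esub> \<Longrightarrow>
      \<exists>(m::int) (n::int). m \<noteq> 0 \<and> n \<noteq> 0 \<and> g [^]\<^bsub>G i\<^esub> m = g' [^]\<^bsub>G i\<^esub> n"
begin

lemma circ_on_c: "i \<in> I \<Longrightarrow> circ_on (carrier (G i)) (c i)"
  using circ unfolding circular_ordering_iff by blast

lemma c_invariant:
  "i \<in> I \<Longrightarrow> g \<in> carrier (G i) \<Longrightarrow> a \<in> carrier (G i) \<Longrightarrow> b \<in> carrier (G i) \<Longrightarrow> e \<in> carrier (G i) \<Longrightarrow>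
    c i (g \<otimes>\<^bsub>G i\<^esub> a) (g \<otimes>\<^bsub>G i\<^esub> b) (g \<otimes>\<^bsub>G i\<^esub> e) = c i a b e"
  using circ unfolding circular_ordering_iff by blast

definition coord :: "'i \<Rightarrow> 'x \<Rightarrow> 'g"
  where "coord i u = (THE g. g \<in> carrier (G i) \<and> act i g n0 = u)"

definition orbit_order :: "'i \<Rightarrow> 'x \<Rightarrow> 'x \<Rightarrow> 'x \<Rightarrow> int"
  where "orbit_order i u v w = c i (coord i u) (coord i v) (coord i w)"

lemma coord_act: "i \<in> I \<Longrightarrow> g \<in> carrier (G i) \<Longrightarrow> coord i (act i g n0) = g"
  unfolding coord_def using free_action.act_cancel [OF action _ _ n0] by blast

lemma orbit_order_act:
  "i \<in> I \<Longrightarrow> a \<in> carrier (G i) \<Longrightarrow> b \<in> carrier (G i) \<Longrightarrow> e \<in> carrier (G i) \<Longrightarrow>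
    orbit_order i (act i a n0) (act i b n0) (act i e n0) = c i a b e"
  by (simp add: orbit_order_def coord_act)

lemma circ_on_orbit_order:
  assumes i: "i \<in> I" shows "circ_on ((\<lambda>g. act i g n0) ` carrier (G i)) (orbit_order i)"
proof -
  have "inj_on (coord i) ((\<lambda>g. act i g n0) ` carrier (G i))"
    by (rule inj_onI) (auto simp: coord_act [OF i])
  moreover have "coord i ` (\<lambda>g. act i g n0) ` carrier (G i) \<subseteq> carrier (G i)"
    by (auto simp: coord_act [OF i])
  ultimately show ?thesis
    unfolding orbit_order_def by (rule circ_on_pullback [OF circ_on_c [OF i]])
qed

lemma orbit_order_invariant:
  assumes i: "i \<in> I" "g \<in> carrier (G i)"
    and "u \<in> (\<lambda>g. act i g n0) ` carrier (G i)" "v \<in> (\<lambda>g. act i g n0) ` carrier (G i)"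
      "w \<in> (\<lambda>g. act i g n0) ` carrier (G i)"
  shows "orbit_order i (act i g u) (act i g v) (act i g w) = orbit_order i u v w"
proof -
  interpret free_action "G i" N "act i" by (rule action [OF i(1)])
  have *: "act i g (act i a n0) = act i (g \<otimes>\<^bsub>G i\<^esub> a) n0" if "a \<in> carrier (G i)" for a
    using that i n0 by (simp add: act_mult)
  show ?thesis
    using assms(3-) i by (auto simp: * orbit_order_act c_invariant)
qed

text \<open>The stages of the construction. A stage \<open>X\<close> is closed under the action of \<open>H\<close> and under
  changing or removing the leftmost letter of a normal form (the \<open>head\<close> condition), and its order
  is invariant as far as this makes sense. The last condition says that \<open>G i\<close> moves points of \<open>X\<close>
  within \<open>X\<close>, other than by elements of \<open>H\<close>, only if the whole \<open>G i\<close>-orbit of the base point is in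
  \<open>X\<close>; it ensures that this orbit can be given the order \<open>c i\<close> when it is added. Each condition
  speaks of finitely many points at a time, so it passes to unions of chains.\<close>

definition partial_ordering :: "'x set \<Rightarrow> ('x \<Rightarrow> 'x \<Rightarrow> 'x \<Rightarrow> int) \<Rightarrow> bool"
  where "partial_ordering X C \<longleftrightarrow> X \<subseteq> N \<and> n0 \<in> X \<and> (\<forall>h\<in>carrier H. \<forall>x\<in>X. hact h x \<in> X) \<and>
    (\<forall>x\<in>X. \<forall>i\<in>I. \<forall>g\<in>carrier (G i). head x = Some i \<longrightarrow> act i g x \<in> X) \<and>
    circ_on X C \<and>
    (\<forall>i\<in>I. \<forall>g\<in>carrier (G i). \<forall>u\<in>X. \<forall>v\<in>X. \<forall>w\<in>X. act i g u \<in> X \<longrightarrow> act i g v \<in> X \<longrightarrow> act i g w \<in> X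
      \<longrightarrow> C (act i g u) (act i g v) (act i g w) = C u v w) \<and>
    (\<forall>i\<in>I. \<forall>a\<in>carrier (G i). \<forall>b\<in>carrier (G i). \<forall>e\<in>carrier (G i).
      act i a n0 \<in> X \<longrightarrow> act i b n0 \<in> X \<longrightarrow> act i e n0 \<in> X
      \<longrightarrow> C (act i a n0) (act i b n0) (act i e n0) = c i a b e) \<and>
    (\<forall>i\<in>I. \<forall>x\<in>X. \<forall>g\<in>carrier (G i) - S i. act i g x \<in> X \<longrightarrow>
      (\<forall>a\<in>carrier (G i). act i a n0 \<in> X))"

lemma partial_orderingD:
  assumes "partial_ordering X C"
  shows "X \<subseteq> N" "n0 \<in> X" "h \<in> carrier H \<Longrightarrow> x \<in> X \<Longrightarrow> hact h x \<in> X"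
    "x \<in> X \<Longrightarrow> i \<in> I \<Longrightarrow> g \<in> carrier (G i) \<Longrightarrow> head x = Some i \<Longrightarrow> act i g x \<in> X"
    "circ_on X C"
    "i \<in> I \<Longrightarrow> g \<in> carrier (G i) \<Longrightarrow> u \<in> X \<Longrightarrow> v \<in> X \<Longrightarrow> w \<in> X \<Longrightarrow> act i g u \<in> X \<Longrightarrow>
      act i g v \<in> X \<Longrightarrow> act i g w \<in> X \<Longrightarrow> C (act i g u) (act i g v) (act i g w) = C u v w"
    "i \<in> I \<Longrightarrow> a \<in> carrier (G i) \<Longrightarrow> b \<in> carrier (G i) \<Longrightarrow> e \<in> carrier (G i) \<Longrightarrow>
      act i a n0 \<in> X \<Longrightarrow> act i b n0 \<in> X \<Longrightarrow> act i e n0 \<in> X \<Longrightarrow>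
      C (act i a n0) (act i b n0) (act i e n0) = c i a b e"
    "i \<in> I \<Longrightarrow> x \<in> X \<Longrightarrow> g \<in> carrier (G i) \<Longrightarrow> g \<notin> S i \<Longrightarrow> act i g x \<in> X \<Longrightarrow>
      a \<in> carrier (G i) \<Longrightarrow> act i a n0 \<in> X"
  using assms unfolding partial_ordering_def by blast+

lemma partial_orderingI:
  assumes "X \<subseteq> N" "n0 \<in> X" "\<And>h x. h \<in> carrier H \<Longrightarrow> x \<in> X \<Longrightarrow> hact h x \<in> X"
    "\<And>x i g. x \<in> X \<Longrightarrow> i \<in> I \<Longrightarrow> g \<in> carrier (G i) \<Longrightarrow> head x = Some i \<Longrightarrow> act i g x \<in> X"
    "circ_on X C"
    "\<And>i g u v w. i \<in> I \<Longrightarrow> g \<in> carrier (G i) \<Longrightarrow> u \<in> X \<Longrightarrow> v \<in> X \<Longrightarrow> w \<in> X \<Longrightarrow> act i g u \<in> X \<Longrightarrow>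
      act i g v \<in> X \<Longrightarrow> act i g w \<in> X \<Longrightarrow> C (act i g u) (act i g v) (act i g w) = C u v w"
    "\<And>i a b e. i \<in> I \<Longrightarrow> a \<in> carrier (G i) \<Longrightarrow> b \<in> carrier (G i) \<Longrightarrow> e \<in> carrier (G i) \<Longrightarrow>
      act i a n0 \<in> X \<Longrightarrow> act i b n0 \<in> X \<Longrightarrow> act i e n0 \<in> X \<Longrightarrow>
      C (act i a n0) (act i b n0) (act i e n0) = c i a b e"
    "\<And>i x g a. i \<in> I \<Longrightarrow> x \<in> X \<Longrightarrow> g \<in> carrier (G i) \<Longrightarrow> g \<notin> S i \<Longrightarrow> act i g x \<in> X \<Longrightarrow>
      a \<in> carrier (G i) \<Longrightarrow> act i a n0 \<in> X"
  shows "partial_ordering X C"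
  unfolding partial_ordering_def
  by (intro conjI ballI impI; (elim DiffE)?; (rule assms; assumption))

text \<open>The tree property: once \<open>X\<close> contains two points of a \<open>G i\<close>-orbit that are not in the same
  \<open>H\<close>-orbit, one of them has head \<open>i\<close>, and then \<open>X\<close> contains the orbit.\<close>

lemma orbit_all_or_H:
  assumes X: "partial_ordering X C" and i: "i \<in> I" and x: "x \<in> X"
    and g: "g \<in> carrier (G i)" "g \<notin> S i" "act i g x \<in> X" and g': "g' \<in> carrier (G i)"
  shows "act i g' x \<in> X"
proof -
  interpret free_action "G i" N "act i" by (rule action [OF i])
  have xN: "x \<in> N" using x partial_orderingD(1) [OF X] by blast
  consider "head x = Some i" | "head (act i g x) = Some i"
    using head_orbit [OF i xN g(1)] g(2) by blast
  then show ?thesis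
  proof cases
    case 1
    then show ?thesis using partial_orderingD(4) [OF X x i g'] by simp
  next
    case 2
    have "g' \<otimes>\<^bsub>G i\<^esub> inv\<^bsub>G i\<^esub> g \<in> carrier (G i)" using g g' by simp
    then have "act i (g' \<otimes>\<^bsub>G i\<^esub> inv\<^bsub>G i\<^esub> g) (act i g x) \<in> X"
      using partial_orderingD(4) [OF X g(3) i _ 2] by blast
    then show ?thesis using g g' xN by (simp add: act_mult act_inv act_closed)
  qed
qed

lemma partial_ordering_initial: "\<exists>C. partial_ordering ((\<lambda>h. hact h n0) ` carrier H) C"
proof -
  obtain i0 where i0: "i0 \<in> I" using I by blast
  let ?X = "(\<lambda>h. hact h n0) ` carrier H"
  let ?C = "orbit_order i0"
  interpret H: group H by (rule group_H)
  have hactE: "hact h n0 = act i (\<phi> i h) n0" if "i \<in> I" "h \<in> carrier H" for i h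
    using hact [OF that n0] by simp
  have \<phi>c: "\<phi> i h \<in> carrier (G i)" if "i \<in> I" "h \<in> carrier H" for i h
    using hom_in_carrier [OF hom] that by blast
  have hh: "hact k (hact h n0) = hact (k \<otimes>\<^bsub>H\<^esub> h) n0" if "k \<in> carrier H" "h \<in> carrier H" for k h
  proof -
    interpret free_action "G i0" N "act i0" by (rule action [OF i0])
    have m: "act i0 (\<phi> i0 h) n0 \<in> N" by (rule act_closed [OF \<phi>c [OF i0 that(2)] n0])
    have "hact k (hact h n0) = act i0 (\<phi> i0 k) (act i0 (\<phi> i0 h) n0)"
      using hact [OF i0 that(1) m] hact [OF i0 that(2) n0] by simp
    also have "\<dots> = act i0 (\<phi> i0 (k \<otimes>\<^bsub>H\<^esub> h)) n0"
      using hom_mult [OF hom [OF i0] that] act_mult [OF \<phi>c [OF i0 that(1)] \<phi>c [OF i0 that(2)] n0] by simp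
    finally show ?thesis using hact [OF i0 H.m_closed [OF that] n0] by simp
  qed
  have inS: "g \<in> S i"
    if i: "i \<in> I" and g: "g \<in> carrier (G i)" and x: "x \<in> ?X" "act i g x \<in> ?X" for i g x
  proof -
    interpret free_action "G i" N "act i" by (rule action [OF i])
    have xN: "x \<in> N" using x(1) hactE [OF i] act_closed [OF \<phi>c [OF i] n0] by auto
    show ?thesis using head_orbit [OF i xN g] x head_n0 by auto
  qed
  have XG: "?X \<subseteq> (\<lambda>g. act i0 g n0) ` carrier (G i0)" using hactE \<phi>c i0 by auto
  have XN: "?X \<subseteq> N"
    using free_action.act_closed [OF action [OF i0] \<phi>c [OF i0] n0] hactE [OF i0] by auto
  have "hact \<one>\<^bsub>H\<^esub> n0 = n0"
    using hactE [OF i0 H.one_closed] hom_one [OF hom [OF i0] group_H group_G [OF i0]]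
      free_action.act_one [OF action [OF i0] n0] by simp
  then have n0X: "n0 \<in> ?X" by (metis H.one_closed imageI)
  have "partial_ordering ?X ?C"
  proof (rule partial_orderingI)
    show "?X \<subseteq> N" by (rule XN)
    show "n0 \<in> ?X" by (rule n0X)
    show "hact h x \<in> ?X" if "h \<in> carrier H" "x \<in> ?X" for h x
      using that hh by auto
    show "act i g x \<in> ?X" if "x \<in> ?X" "head x = Some i" for x i g
      using that head_n0 by auto
    show "circ_on ?X ?C" by (rule circ_on_subset [OF circ_on_orbit_order [OF i0] XG])
  next
    fix i g u v w assume i: "i \<in> I" "g \<in> carrier (G i)" and u: "u \<in> ?X" "v \<in> ?X" "w \<in> ?X"
      and gu: "act i g u \<in> ?X"
    obtain h where h: "h \<in> carrier H" "g = \<phi> i h" using inS [OF i u(1) gu] by blast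
    have "act i g y = act i0 (\<phi> i0 h) y" if "y \<in> ?X" for y
      using hact [OF i(1) h(1), of y] hact [OF i0 h(1), of y] that XN h(2) by auto
    then show "?C (act i g u) (act i g v) (act i g w) = ?C u v w"
      using orbit_order_invariant [OF i0 \<phi>c [OF i0 h(1)]] u XG by (simp add: subset_iff)
  next
    fix i a b e assume i: "i \<in> I" and a: "a \<in> carrier (G i)" "b \<in> carrier (G i)" "e \<in> carrier (G i)"
      "act i a n0 \<in> ?X" "act i b n0 \<in> ?X" "act i e n0 \<in> ?X"
    obtain p q r where p: "p \<in> carrier H" "a = \<phi> i p" "q \<in> carrier H" "b = \<phi> i q"
      "r \<in> carrier H" "e = \<phi> i r"
      using inS [OF i a(1) n0X a(4)] inS [OF i a(2) n0X a(5)] inS [OF i a(3) n0X a(6)] by blast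
    have "act i (\<phi> i k) n0 = act i0 (\<phi> i0 k) n0" if "k \<in> carrier H" for k
      using hactE i i0 that by metis
    then show "?C (act i a n0) (act i b n0) (act i e n0) = c i a b e"
      using p orbit_order_act [OF i0 \<phi>c \<phi>c \<phi>c, OF i0 p(1) i0 p(3) i0 p(5)] agree [OF i i0 p(1,3,5)]
      by simp
  next
    fix i x g a assume "i \<in> I" "x \<in> ?X" "g \<in> carrier (G i)" "g \<notin> S i" "act i g x \<in> ?X"
    then show "act i a n0 \<in> ?X" using inS by blast
  qed
  then show ?thesis by blast
qed

text \<open>To add the \<open>G i\<close>-orbit of \<open>x\<close> to \<open>X\<close>, it is enough to order it together with the points of
  \<open>X\<close> on which \<open>G i\<close> already acts. The rest of \<open>X\<close> is joined by \<open>amalgamate_circular_orders\<close>. The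
  resulting order is invariant under \<open>H\<close>, which preserves both \<open>X\<close> and \<open>B\<close>. An element outside \<open>H\<close>
  cannot mix the two sides: if it is in \<open>G i\<close> it moves points within \<open>B\<close>, and if it is in another
  \<open>G j\<close> it moves points within \<open>X\<close>, because the new points all have head \<open>i\<close>. These are the facts
  \<open>stay_i\<close> and \<open>stay\<close>.\<close>

lemma partial_ordering_add_orbit:
  assumes X: "partial_ordering X C" and i: "i \<in> I" and x: "x \<in> X"
    and new: "\<And>g. g \<in> carrier (G i) \<Longrightarrow> act i g x \<in> X \<Longrightarrow> g \<in> S i"
    and B_def: "B = {y \<in> X. \<exists>g\<in>carrier (G i) - S i. act i g y \<in> X} \<union> (\<lambda>g. act i g x) ` carrier (G i)"
    and CB: "circ_on B CB"
    and agreeB: "\<forall>u\<in>X \<inter> B. \<forall>v\<in>X \<inter> B. \<forall>w\<in>X \<inter> B. C u v w = CB u v w"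
    and invB: "\<And>g u v w. g \<in> carrier (G i) \<Longrightarrow> u \<in> B \<Longrightarrow> v \<in> B \<Longrightarrow> w \<in> B \<Longrightarrow>
      CB (act i g u) (act i g v) (act i g w) = CB u v w"
    and n0B: "n0 \<in> B"
    and cB: "\<And>a b e. a \<in> carrier (G i) \<Longrightarrow> b \<in> carrier (G i) \<Longrightarrow> e \<in> carrier (G i) \<Longrightarrow>
      CB (act i a n0) (act i b n0) (act i e n0) = c i a b e"
  shows "\<exists>E. partial_ordering (X \<union> B) E \<and> (\<forall>u\<in>X. \<forall>v\<in>X. \<forall>w\<in>X. E u v w = C u v w)"
proof -
  interpret Gi: free_action "G i" N "act i" by (rule action [OF i])
  note XN = partial_orderingD(1) [OF X]
  have BN: "B \<subseteq> N" using XN x Gi.act_closed by (auto simp: B_def)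
  have Bclosed: "act i g u \<in> B" if g: "g \<in> carrier (G i)" and u: "u \<in> B" for g u
  proof (cases "u \<in> (\<lambda>g. act i g x) ` carrier (G i)")
    case True
    then obtain h where h: "h \<in> carrier (G i)" "u = act i h x" by blast
    then have "act i g u = act i (g \<otimes>\<^bsub>G i\<^esub> h) x" using g x XN by (simp add: Gi.act_mult subset_iff)
    moreover have "g \<otimes>\<^bsub>G i\<^esub> h \<in> carrier (G i)" using g h by simp
    ultimately show ?thesis by (auto simp: B_def)
  next
    case False
    then obtain k where k: "u \<in> X" "k \<in> carrier (G i)" "k \<notin> S i" "act i k u \<in> X"
      using u by (auto simp: B_def)
    have uN: "u \<in> N" using k XN by blast
    note all = orbit_all_or_H [OF X i k(1,2,3,4)]
    have "act i k (act i g u) = act i (k \<otimes>\<^bsub>G i\<^esub> g) u" using g k uN by (simp add: Gi.act_mult)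
    then have "act i k (act i g u) \<in> X" using all [of "k \<otimes>\<^bsub>G i\<^esub> g"] g k by simp
    then show ?thesis using all [OF g] k by (auto simp: B_def)
  qed
  have newhead: "head u = Some i" if u: "u \<in> B" "u \<notin> X" for u
  proof -
    obtain g where g: "g \<in> carrier (G i)" "u = act i g x" using u by (auto simp: B_def)
    have xN: "x \<in> N" using x XN by blast
    have "g \<notin> S i" using hact_S [OF i _ xN, of g] partial_orderingD(3) [OF X _ x] g u by auto
    moreover have "head x \<noteq> Some i" using partial_orderingD(4) [OF X x i g(1)] g u by auto
    ultimately show ?thesis using head_orbit [OF i xN g(1)] g(2) by blast
  qed
  have ne: "X \<inter> B \<noteq> {}" using n0B partial_orderingD(2) [OF X] by blast
  obtain E where E: "circ_on (X \<union> B) E"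
    "\<forall>u\<in>X. \<forall>v\<in>X. \<forall>w\<in>X. E u v w = C u v w"
    "\<forall>u\<in>B. \<forall>v\<in>B. \<forall>w\<in>B. E u v w = CB u v w"
    "\<forall>g. inj_on g (X \<union> B) \<longrightarrow> circ_automorphism X C g \<longrightarrow> circ_automorphism B CB g \<longrightarrow>
      circ_automorphism (X \<union> B) E g"
    using amalgamate_circular_orders [OF partial_orderingD(5) [OF X] CB ne agreeB] by auto
  have XB: "u \<in> N" if "u \<in> X \<union> B" for u using that XN BN by blast
  have stay: "u \<in> X \<and> act j g u \<in> X"
    if j: "j \<in> I" "j \<noteq> i" and g: "g \<in> carrier (G j)" "g \<notin> S j"
      and u: "u \<in> X \<union> B" "act j g u \<in> X \<union> B" for j g u
  proof -
    interpret Gj: free_action "G j" N "act j" by (rule action [OF j(1)])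
    have 1: "head u = Some j \<or> head (act j g u) = Some j"
      using head_orbit [OF j(1) XB [OF u(1)] g(1)] g(2) by blast
    have 2: "act j g u \<in> X" if "head u = Some j" "u \<in> X"
      using partial_orderingD(4) [OF X that(2) j(1) g(1) that(1)] .
    have 3: "u \<in> X" if "head (act j g u) = Some j" "act j g u \<in> X"
      using partial_orderingD(4) [OF X that(2) j(1) _ that(1), of "inv\<^bsub>G j\<^esub> g"] g(1)
        Gj.act_inv(1) [OF g(1) XB [OF u(1)]] by simp
    have 4: "u \<in> X" if "head u = Some j" using newhead [of u] u that j by auto
    have 5: "act j g u \<in> X" if "head (act j g u) = Some j"
      using newhead [of "act j g u"] u that j by auto
    show ?thesis using 1 2 3 4 5 by blast
  qed
  have stay_i: "u \<in> B \<and> act i g u \<in> B"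
    if g: "g \<in> carrier (G i)" "g \<notin> S i" and u: "u \<in> X \<union> B" "act i g u \<in> X \<union> B" for g u
  proof -
    have "u \<in> B" if "act i g u \<in> B"
      using Bclosed [of "inv\<^bsub>G i\<^esub> g", OF _ that] g Gi.act_inv(1) [OF g(1) XB [OF u(1)]] by simp
    moreover have "u \<in> B" if "u \<in> X" "act i g u \<in> X" using that g by (auto simp: B_def)
    ultimately have "u \<in> B" using u by blast
    then show ?thesis using Bclosed g by blast
  qed
  have "partial_ordering (X \<union> B) E"
  proof (rule partial_orderingI)
    show "X \<union> B \<subseteq> N" using XB by blast
    show "n0 \<in> X \<union> B" using n0B by blast
    show "hact h u \<in> X \<union> B" if h: "h \<in> carrier H" and u: "u \<in> X \<union> B" for h u
    proof (cases "u \<in> X")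
      case True
      then show ?thesis using partial_orderingD(3) [OF X h] by blast
    next
      case False
      then show ?thesis
        using Bclosed [OF S_carrier [OF i imageI [OF h]], of u] hact [OF i h XB [OF u]] u by simp
    qed
    show "act j g u \<in> X \<union> B" if "u \<in> X \<union> B" "j \<in> I" "g \<in> carrier (G j)" "head u = Some j" for u j g
    proof (cases "u \<in> X")
      case True
      then show ?thesis using partial_orderingD(4) [OF X] that by blast
    next
      case False
      then have "j = i" using newhead [of u] that by auto
      then show ?thesis using Bclosed that False by blast
    qed
    show "circ_on (X \<union> B) E" by (rule E(1))
  next
    fix j g u v w assume j: "j \<in> I" "g \<in> carrier (G j)"
      and u: "u \<in> X \<union> B" "v \<in> X \<union> B" "w \<in> X \<union> B"
      and gu: "act j g u \<in> X \<union> B" "act j g v \<in> X \<union> B" "act j g w \<in> X \<union> B"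
    consider "g \<in> S j" | "g \<notin> S j" "j = i" | "g \<notin> S j" "j \<noteq> i" by blast
    then show "E (act j g u) (act j g v) (act j g w) = E u v w"
    proof cases
      case 1
      then obtain h where h: "h \<in> carrier H" "g = \<phi> j h" by blast
      interpret Gj: free_action "G j" N "act j" by (rule action [OF j(1)])
      have ji: "act j g y = act i (\<phi> i h) y" if "y \<in> N" for y
        using hact [OF j(1) h(1) that] hact [OF i h(1) that] h(2) by simp
      have ih: "\<phi> i h \<in> carrier (G i)" by (rule S_carrier [OF i imageI [OF h(1)]])
      have inX: "act j k y \<in> X" if ky: "k \<in> S j" "y \<in> X" for k y
      proof -
        have "y \<in> N" using ky XN by blast
        then obtain l where "l \<in> carrier H" "act j k y = hact l y"
          using hact_S [OF j(1) ky(1)] by blast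
        then show ?thesis using partial_orderingD(3) [OF X _ ky(2)] by simp
      qed
      have injXB: "inj_on (act j g) (X \<union> B)"
        using Gj.act_inj [OF j(2)] XB by (auto intro: inj_onI)
      have gX: "act j g ` X = X"
      proof
        show "act j g ` X \<subseteq> X" using inX 1 by blast
        show "X \<subseteq> act j g ` X"
        proof
          fix y assume y: "y \<in> X"
          have "act j (inv\<^bsub>G j\<^esub> g) y \<in> X"
            using inX y subgroup.m_inv_closed [OF subgroup_S [OF j(1)] 1] by blast
          moreover have "y = act j g (act j (inv\<^bsub>G j\<^esub> g) y)"
            using Gj.act_inv(2) [OF j(2)] y XN by auto
          ultimately show "y \<in> act j g ` X" by blast
        qed
      qed
      have gB: "act j g ` B = B"
      proof -
        have "act j g ` B = act i (\<phi> i h) ` B" by (rule image_cong) (use ji BN in auto)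
        then show ?thesis using Gi.act_image [OF ih BN Bclosed] by simp
      qed
      have CX: "C (act j g a) (act j g b) (act j g e) = C a b e"
        if "a \<in> X" "b \<in> X" "e \<in> X" for a b e
        using partial_orderingD(6) [OF X j that] inX [OF 1] that by blast
      have CBB: "CB (act j g a) (act j g b) (act j g e) = CB a b e"
        if "a \<in> B" "b \<in> B" "e \<in> B" for a b e
        using invB [OF ih that] ji that BN by (simp add: subset_iff)
      have "circ_automorphism (X \<union> B) E (act j g)"
        by (intro E(4) [rule_format] circ_automorphismI injXB gX gB CX CBB inj_on_subset [OF injXB]) auto
      from circ_automorphismD(2) [OF this u] show ?thesis .
    next
      case 2
      have g: "g \<in> carrier (G i)" "g \<notin> S i" using j 2 by auto
      have "u \<in> B \<and> act i g u \<in> B" "v \<in> B \<and> act i g v \<in> B" "w \<in> B \<and> act i g w \<in> B"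
        using stay_i [OF g u(1)] stay_i [OF g u(2)] stay_i [OF g u(3)] gu 2 by auto
      then show ?thesis using E(3) invB [OF g(1)] 2 by simp
    next
      case 3
      have "u \<in> X \<and> act j g u \<in> X" "v \<in> X \<and> act j g v \<in> X" "w \<in> X \<and> act j g w \<in> X"
        using stay [OF j(1) 3(2) j(2) 3(1)] u gu by auto
      then show ?thesis using E(2) partial_orderingD(6) [OF X j] by simp
    qed
  next
    fix j a b e assume j: "j \<in> I" and a: "a \<in> carrier (G j)" "b \<in> carrier (G j)" "e \<in> carrier (G j)"
      and m: "act j a n0 \<in> X \<union> B" "act j b n0 \<in> X \<union> B" "act j e n0 \<in> X \<union> B"
    show "E (act j a n0) (act j b n0) (act j e n0) = c j a b e"
    proof (cases "j = i")
      case True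
      then show ?thesis using E(3) cB Bclosed n0B a by simp
    next
      case False
      have "act j k n0 \<in> X" if k: "k \<in> carrier (G j)" "act j k n0 \<in> X \<union> B" for k
      proof (cases "k \<in> S j")
        case True
        then show ?thesis
          using hact_S [OF j True n0] partial_orderingD(3) [OF X _ partial_orderingD(2) [OF X]] by auto
      next
        case nS: False
        then show ?thesis using stay [OF j False k(1) nS _ k(2)] n0B by blast
      qed
      then have "act j a n0 \<in> X" "act j b n0 \<in> X" "act j e n0 \<in> X" using a m by auto
      then show ?thesis using E(2) partial_orderingD(7) [OF X j a] by simp
    qed
  next
    fix j u g a assume j: "j \<in> I" and u: "u \<in> X \<union> B" "g \<in> carrier (G j)" "g \<notin> S j" "act j g u \<in> X \<union> B"
      and a: "a \<in> carrier (G j)"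
    show "act j a n0 \<in> X \<union> B"
    proof (cases "j = i")
      case True
      then show ?thesis using Bclosed n0B a by blast
    next
      case False
      then show ?thesis
        using stay [OF j False u(2,3,1,4)] partial_orderingD(8) [OF X j _ u(2,3) _ a] by blast
    qed
  qed
  then show ?thesis using E(2) by blast
qed

text \<open>While the orbit of the base point under some \<open>G i\<close> is incomplete, it is added next, with the
  order \<open>c i\<close>; there are no other points of \<open>X\<close> on which \<open>G i\<close> acts. Afterwards every \<open>G i\<close> that
  has an orbit to be added acts on the orbit of the base point, so the set \<open>Y\<close> in \<open>extend_to_orbit\<close>
  is nonempty. This is essential there, since \<open>Y\<close> supplies the left order of the stabiliser.\<close>

lemma partial_ordering_extend:
  assumes X: "partial_ordering X C" and ne: "X \<noteq> N"
  shows "\<exists>X' C'. partial_ordering X' C' \<and> X \<subset> X' \<and> (\<forall>u\<in>X. \<forall>v\<in>X. \<forall>w\<in>X. C' u v w = C u v w)"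
proof -
  note XN = partial_orderingD(1) [OF X]
  have add: ?thesis
    if i: "i \<in> I" and x: "x \<in> X" and g: "g \<in> carrier (G i)" "act i g x \<notin> X"
      and B: "B = {y \<in> X. \<exists>g\<in>carrier (G i) - S i. act i g y \<in> X} \<union> (\<lambda>g. act i g x) ` carrier (G i)"
      and E: "\<exists>E. partial_ordering (X \<union> B) E \<and> (\<forall>u\<in>X. \<forall>v\<in>X. \<forall>w\<in>X. E u v w = C u v w)"
    for i x g B
  proof -
    have "act i g x \<in> X \<union> B" using g by (auto simp: B)
    then have "X \<subset> X \<union> B" using g(2) by blast
    then show ?thesis using E by blast
  qed
  have new: "h \<in> S i" if i: "i \<in> I" and x: "x \<in> X" and g: "g \<in> carrier (G i)" "act i g x \<notin> X"
    and h: "h \<in> carrier (G i)" "act i h x \<in> X" for i x g h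
    using orbit_all_or_H [OF X i x h(1) _ h(2) g(1)] g(2) by blast
  have SX: "act i s u \<in> X" if i: "i \<in> I" and s: "s \<in> S i" and u: "u \<in> X" for i s u
  proof -
    obtain h where "h \<in> carrier H" "act i s u = hact h u" using hact_S [OF i s] u XN by blast
    then show ?thesis using partial_orderingD(3) [OF X _ u] by simp
  qed
  show ?thesis
  proof (cases "\<exists>i\<in>I. \<exists>g\<in>carrier (G i). act i g n0 \<notin> X")
    case True
    then obtain i g where i: "i \<in> I" and g: "g \<in> carrier (G i)" "act i g n0 \<notin> X" by blast
    interpret Gi: free_action "G i" N "act i" by (rule action [OF i])
    let ?O = "(\<lambda>g. act i g n0) ` carrier (G i)"
    have Y: "{y \<in> X. \<exists>g\<in>carrier (G i) - S i. act i g y \<in> X} = {}"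
      using partial_orderingD(8) [OF X i _ _ _ _ g(1)] g(2) by auto
    have agreeO: "C u v w = orbit_order i u v w" if "u \<in> X \<inter> ?O" "v \<in> X \<inter> ?O" "w \<in> X \<inter> ?O" for u v w
      using that by (auto simp: orbit_order_act [OF i] partial_orderingD(7) [OF X i])
    have n0O: "n0 \<in> ?O" using Gi.act_one [OF n0] by (metis Gi.one_closed imageI)
    show ?thesis
    proof (rule add [OF i partial_orderingD(2) [OF X] g])
      show "?O = {y \<in> X. \<exists>g\<in>carrier (G i) - S i. act i g y \<in> X} \<union> ?O" using Y by blast
      show "\<exists>E. partial_ordering (X \<union> ?O) E \<and> (\<forall>u\<in>X. \<forall>v\<in>X. \<forall>w\<in>X. E u v w = C u v w)"
      proof (rule partial_ordering_add_orbit [OF X i partial_orderingD(2) [OF X], where CB = "orbit_order i"])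
        show "h \<in> S i" if "h \<in> carrier (G i)" "act i h n0 \<in> X" for h
          using new [OF i partial_orderingD(2) [OF X] g that] .
        show "?O = {y \<in> X. \<exists>g\<in>carrier (G i) - S i. act i g y \<in> X} \<union> ?O" using Y by blast
        show "circ_on ?O (orbit_order i)" by (rule circ_on_orbit_order [OF i])
        show "\<forall>u\<in>X \<inter> ?O. \<forall>v\<in>X \<inter> ?O. \<forall>w\<in>X \<inter> ?O. C u v w = orbit_order i u v w"
          using agreeO by blast
        show "n0 \<in> ?O" by (rule n0O)
        show "orbit_order i (act i h u) (act i h v) (act i h w) = orbit_order i u v w"
          if "h \<in> carrier (G i)" "u \<in> ?O" "v \<in> ?O" "w \<in> ?O" for h u v w
          by (rule orbit_order_invariant [OF i that])
        show "orbit_order i (act i a n0) (act i b n0) (act i e n0) = c i a b e"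
          if "a \<in> carrier (G i)" "b \<in> carrier (G i)" "e \<in> carrier (G i)" for a b e
          by (rule orbit_order_act [OF i that])
      qed
    qed
  next
    case False
    then have n0X: "act i g n0 \<in> X" if "i \<in> I" "g \<in> carrier (G i)" for i g using that by blast
    obtain i g x where i: "i \<in> I" and g: "g \<in> carrier (G i)" "act i g x \<notin> X" and x: "x \<in> X"
      using generated [OF XN partial_orderingD(2) [OF X]] ne by blast
    interpret Gi: free_action "G i" N "act i" by (rule action [OF i])
    define Y where "Y = {y \<in> X. \<exists>g\<in>carrier (G i) - S i. act i g y \<in> X}"
    let ?A = "Y \<union> (\<lambda>s. act i s x) ` S i"
    let ?B = "Y \<union> (\<lambda>g. act i g x) ` carrier (G i)"
    have xN: "x \<in> N" using x XN by blast
    have gS: "g \<notin> S i" using SX [OF i _ x] g by blast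
    have YX: "Y \<subseteq> X" by (auto simp: Y_def)
    have YN: "Y \<subseteq> N" using YX XN by blast
    have n0Y: "n0 \<in> Y"
      using n0X [OF i g(1)] g(1) gS partial_orderingD(2) [OF X] by (auto simp: Y_def)
    have Yc: "act i h u \<in> Y" if h: "h \<in> carrier (G i)" and u: "u \<in> Y" for h u
    proof -
      obtain k where k: "u \<in> X" "k \<in> carrier (G i)" "k \<notin> S i" "act i k u \<in> X"
        using u by (auto simp: Y_def)
      have uN: "u \<in> N" using k XN by blast
      note all = orbit_all_or_H [OF X i k(1,2,3,4)]
      have "act i k (act i h u) = act i (k \<otimes>\<^bsub>G i\<^esub> h) u" using h k uN by (simp add: Gi.act_mult)
      then have "act i k (act i h u) \<in> X" using all [of "k \<otimes>\<^bsub>G i\<^esub> h"] h k by simp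
      then show ?thesis using all [OF h] k by (auto simp: Y_def)
    qed
    have xY: "x \<notin> Y" using Yc [OF g(1)] YX g(2) by blast
    have AX: "?A \<subseteq> X" using YX SX [OF i _ x] by blast
    have AB: "X \<inter> ?B = ?A"
    proof -
      have "act i h x \<in> (\<lambda>s. act i s x) ` S i" if "h \<in> carrier (G i)" "act i h x \<in> X" for h
        using new [OF i x g that] by blast
      then show ?thesis using AX S_carrier [OF i] by auto
    qed
    obtain E where E: "circ_on ?B E" "\<forall>u\<in>?A. \<forall>v\<in>?A. \<forall>w\<in>?A. E u v w = C u v w"
      "\<forall>g\<in>carrier (G i). circ_automorphism ?B E (act i g)"
    proof -
      have "\<exists>E. circ_on ?B E \<and> (\<forall>u\<in>?A. \<forall>v\<in>?A. \<forall>w\<in>?A. E u v w = C u v w) \<and>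
          (\<forall>g\<in>carrier (G i). circ_automorphism ?B E (act i g))"
      proof (rule Gi.extend_to_orbit [OF subgroup_S [OF i] common_powers [OF i] YN _ Yc xN xY])
        show "Y \<noteq> {}" using n0Y by blast
        show "circ_on ?A C" by (rule circ_on_subset [OF partial_orderingD(5) [OF X] AX])
        show "C (act i h u) (act i h v) (act i h w) = C u v w"
          if "h \<in> carrier (G i)" "u \<in> Y" "v \<in> Y" "w \<in> Y" for h u v w
          using partial_orderingD(6) [OF X i that(1)] Yc [OF that(1)] that YX by blast
        show "C (act i s u) (act i s v) (act i s w) = C u v w"
          if s: "s \<in> S i" and u: "u \<in> ?A" "v \<in> ?A" "w \<in> ?A" for s u v w
        proof -
          have m: "u \<in> X" "v \<in> X" "w \<in> X" using u AX by auto
          show ?thesis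
            by (rule partial_orderingD(6) [OF X i S_carrier [OF i s] m]) (rule SX [OF i s] m)+
        qed
      qed auto
      then show ?thesis using that by blast
    qed
    show ?thesis
    proof (rule add [OF i x g])
      show "?B = {y \<in> X. \<exists>g\<in>carrier (G i) - S i. act i g y \<in> X} \<union> (\<lambda>g. act i g x) ` carrier (G i)"
        by (simp add: Y_def)
      show "\<exists>E. partial_ordering (X \<union> ?B) E \<and> (\<forall>u\<in>X. \<forall>v\<in>X. \<forall>w\<in>X. E u v w = C u v w)"
      proof (rule partial_ordering_add_orbit [OF X i x, where CB = E])
        show "h \<in> S i" if "h \<in> carrier (G i)" "act i h x \<in> X" for h using new [OF i x g that] .
        show "?B = {y \<in> X. \<exists>g\<in>carrier (G i) - S i. act i g y \<in> X} \<union> (\<lambda>g. act i g x) ` carrier (G i)"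
          by (simp add: Y_def)
        show "circ_on ?B E" by (rule E(1))
        show "\<forall>u\<in>X \<inter> ?B. \<forall>v\<in>X \<inter> ?B. \<forall>w\<in>X \<inter> ?B. C u v w = E u v w"
          unfolding AB using E(2) by simp
        show "n0 \<in> ?B" using n0Y by blast
        show "E (act i h u) (act i h v) (act i h w) = E u v w"
          if "h \<in> carrier (G i)" "u \<in> ?B" "v \<in> ?B" "w \<in> ?B" for h u v w
          by (rule circ_automorphismD(2) [OF bspec [OF E(3) that(1)] that(2-4)])
        show "E (act i a n0) (act i b n0) (act i e n0) = c i a b e"
          if a: "a \<in> carrier (G i)" "b \<in> carrier (G i)" "e \<in> carrier (G i)" for a b e
          using E(2) Yc [OF _ n0Y] partial_orderingD(7) [OF X i a n0X [OF i a(1)] n0X [OF i a(2)] n0X [OF i a(3)]] a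
          by simp
      qed
    qed
  qed
qed

text \<open>Graphs turn extension of ordered sets into inclusion, so that Zorn's lemma for set inclusion
  applies. Triples of equal points record the underlying set.\<close>

definition order_graph :: "'x set \<Rightarrow> ('x \<Rightarrow> 'x \<Rightarrow> 'x \<Rightarrow> int) \<Rightarrow> ('x \<times> 'x \<times> 'x \<times> int) set"
  where "order_graph X C = {(u, v, w, C u v w) | u v w. u \<in> X \<and> v \<in> X \<and> w \<in> X}"

lemma mem_order_graph:
  "(u, v, w, k) \<in> order_graph X C \<longleftrightarrow> u \<in> X \<and> v \<in> X \<and> w \<in> X \<and> k = C u v w"
  by (auto simp: order_graph_def)

lemma order_graph_mono:
  "order_graph X C \<subseteq> order_graph X' C' \<longleftrightarrow>
    X \<subseteq> X' \<and> (\<forall>u\<in>X. \<forall>v\<in>X. \<forall>w\<in>X. C' u v w = C u v w)"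
proof
  assume *: "order_graph X C \<subseteq> order_graph X' C'"
  have "u \<in> X' \<and> C' u v w = C u v w" if "u \<in> X" "v \<in> X" "w \<in> X" for u v w
    using subsetD [OF *, of "(u, v, w, C u v w)"] that by (simp add: mem_order_graph)
  then show "X \<subseteq> X' \<and> (\<forall>u\<in>X. \<forall>v\<in>X. \<forall>w\<in>X. C' u v w = C u v w)" by blast
next
  assume "X \<subseteq> X' \<and> (\<forall>u\<in>X. \<forall>v\<in>X. \<forall>w\<in>X. C' u v w = C u v w)"
  then show "order_graph X C \<subseteq> order_graph X' C'" by (auto simp: order_graph_def)
qed

lemma partial_ordering_chain:
  assumes ne: "\<G> \<noteq> {}"
    and chain: "subset.chain {order_graph X C | X C. partial_ordering X C} \<G>"
  shows "\<exists>X C. partial_ordering X C \<and> \<Union>\<G> = order_graph X C"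
proof -
  define X where "X = {u. \<exists>k. (u, u, u, k) \<in> \<Union>\<G>}"
  define C where "C u v w = (THE k. (u, v, w, k) \<in> \<Union>\<G>)" for u v w
  have mem: "\<exists>X C. partial_ordering X C \<and> \<Gamma> = order_graph X C" if "\<Gamma> \<in> \<G>" for \<Gamma>
    using chain that unfolding subset.chain_def by blast
  have dir: "\<Gamma> \<subseteq> \<Gamma>' \<or> \<Gamma>' \<subseteq> \<Gamma>" if "\<Gamma> \<in> \<G>" "\<Gamma>' \<in> \<G>" for \<Gamma> \<Gamma>'
    using chain that unfolding subset.chain_def by blast
  have member: "X' \<subseteq> X \<and> (\<forall>u\<in>X'. \<forall>v\<in>X'. \<forall>w\<in>X'. C u v w = C' u v w)"
    if "order_graph X' C' \<in> \<G>" for X' C'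
  proof -
    have "C u v w = C' u v w" if uvw: "u \<in> X'" "v \<in> X'" "w \<in> X'" for u v w
      unfolding C_def
    proof (rule the_equality)
      show "(u, v, w, C' u v w) \<in> \<Union>\<G>"
        by (rule UnionI [OF \<open>order_graph X' C' \<in> \<G>\<close>]) (use uvw in \<open>simp add: mem_order_graph\<close>)
    next
      fix k assume "(u, v, w, k) \<in> \<Union>\<G>"
      then obtain \<Gamma> where \<Gamma>: "\<Gamma> \<in> \<G>" "(u, v, w, k) \<in> \<Gamma>" by blast
      obtain Z D where Z: "\<Gamma> = order_graph Z D" using mem [OF \<Gamma>(1)] by blast
      have "u \<in> Z" "v \<in> Z" "w \<in> Z" "k = D u v w" using \<Gamma>(2) by (auto simp: Z mem_order_graph)
      then show "k = C' u v w"
        using dir [OF \<Gamma>(1) \<open>order_graph X' C' \<in> \<G>\<close>] uvw unfolding Z order_graph_mono by auto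
    qed
    moreover have "u \<in> X" if "u \<in> X'" for u
    proof -
      have "(u, u, u, C' u u u) \<in> \<Union>\<G>"
        by (rule UnionI [OF \<open>order_graph X' C' \<in> \<G>\<close>]) (use that in \<open>simp add: mem_order_graph\<close>)
      then show ?thesis unfolding X_def by blast
    qed
    ultimately show ?thesis by blast
  qed
  have capture: "\<exists>X' C'. partial_ordering X' C' \<and> order_graph X' C' \<in> \<G> \<and> F \<subseteq> X'"
    if "finite F" "F \<subseteq> X" for F
    using that
  proof (induction F)
    case empty
    then show ?case using ne mem by blast
  next
    case (insert u F)
    then obtain X1 C1 where 1: "partial_ordering X1 C1" "order_graph X1 C1 \<in> \<G>" "F \<subseteq> X1" by blast
    obtain k \<Gamma> where \<Gamma>: "\<Gamma> \<in> \<G>" "(u, u, u, k) \<in> \<Gamma>" using insert by (auto simp: X_def)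
    obtain X2 C2 where 2: "partial_ordering X2 C2" "\<Gamma> = order_graph X2 C2"
      using mem [OF \<Gamma>(1)] by blast
    have u2: "u \<in> X2" using \<Gamma>(2) 2 by (simp add: mem_order_graph)
    show ?case
      using dir [OF 1(2) \<Gamma>(1)]
    proof
      assume "order_graph X1 C1 \<subseteq> \<Gamma>"
      then have "insert u F \<subseteq> X2" using 1 2 u2 order_graph_mono by blast
      then show ?thesis using 2 \<Gamma> by blast
    next
      assume "\<Gamma> \<subseteq> order_graph X1 C1"
      then have "insert u F \<subseteq> X1" using 1 2 u2 order_graph_mono by blast
      then show ?thesis using 1 by blast
    qed
  qed
  have graph: "\<Union>\<G> = order_graph X C"
  proof (intro equalityI subsetI)
    fix t assume "t \<in> \<Union>\<G>"
    then obtain \<Gamma> where \<Gamma>: "\<Gamma> \<in> \<G>" "t \<in> \<Gamma>" by blast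
    obtain Z D where Z: "\<Gamma> = order_graph Z D" using mem [OF \<Gamma>(1)] by blast
    have "order_graph Z D \<subseteq> order_graph X C"
      unfolding order_graph_mono using member [of Z D] \<Gamma>(1) Z by auto
    then show "t \<in> order_graph X C" using \<Gamma>(2) Z by blast
  next
    fix t assume "t \<in> order_graph X C"
    then obtain u v w where t: "t = (u, v, w, C u v w)" "u \<in> X" "v \<in> X" "w \<in> X"
      by (auto simp: order_graph_def)
    obtain X' C' where *: "order_graph X' C' \<in> \<G>" "{u, v, w} \<subseteq> X'"
      using capture [of "{u, v, w}"] t by auto
    then have "t \<in> order_graph X' C'" using member [OF *(1)] t by (simp add: mem_order_graph)
    then show "t \<in> \<Union>\<G>" using * by blast
  qed
  have "partial_ordering X C"
  proof (rule partial_orderingI)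
    show "X \<subseteq> N"
    proof
      fix u assume "u \<in> X"
      then show "u \<in> N" using capture [of "{u}"] partial_orderingD(1) by auto
    qed
    show "n0 \<in> X" using capture [of "{}"] member partial_orderingD(2) by blast
    show "hact h x \<in> X" if x: "h \<in> carrier H" "x \<in> X" for h x
    proof -
      obtain X' C' where *: "partial_ordering X' C'" "order_graph X' C' \<in> \<G>" "x \<in> X'"
        using capture [of "{x}"] x by auto
      show ?thesis using partial_orderingD(3) [OF *(1) x(1) *(3)] member [OF *(2)] by auto
    qed
    show "act i g x \<in> X" if x: "x \<in> X" "i \<in> I" "g \<in> carrier (G i)" "head x = Some i" for x i g
    proof -
      obtain X' C' where *: "partial_ordering X' C'" "order_graph X' C' \<in> \<G>" "x \<in> X'"
        using capture [of "{x}"] x by auto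
      show ?thesis using partial_orderingD(4) [OF *(1,3) x(2-4)] member [OF *(2)] by auto
    qed
    show "circ_on X C"
      unfolding circ_on_def
    proof (intro conjI ballI)
      fix x y z assume "x \<in> X" "y \<in> X" "z \<in> X"
      then obtain X' C' where *: "partial_ordering X' C'" "order_graph X' C' \<in> \<G>" "{x, y, z} \<subseteq> X'"
        using capture [of "{x, y, z}"] by auto
      then show "C x y z \<in> {-1, 0, 1}" "C x y z = 0 \<longleftrightarrow> x = y \<or> y = z \<or> x = z"
        using circ_on_values [OF partial_orderingD(5) [OF *(1)], of x y z] member [OF *(2)]
          circ_on_zero [OF partial_orderingD(5) [OF *(1)], of x y z] by auto
    next
      fix w x y z assume "w \<in> X" "x \<in> X" "y \<in> X" "z \<in> X"
      then obtain X' C' where *: "partial_ordering X' C'" "order_graph X' C' \<in> \<G>" "{w, x, y, z} \<subseteq> X'"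
        using capture [of "{w, x, y, z}"] by auto
      then show "C x y z - C w y z + C w x z - C w x y = 0"
        using circ_on_cocycle [OF partial_orderingD(5) [OF *(1)], of w x y z] member [OF *(2)] by simp
    qed
  next
    fix i g u v w assume i: "i \<in> I" "g \<in> carrier (G i)"
      and "u \<in> X" "v \<in> X" "w \<in> X" "act i g u \<in> X" "act i g v \<in> X" "act i g w \<in> X"
    then obtain X' C' where *: "partial_ordering X' C'" "order_graph X' C' \<in> \<G>"
        "{u, v, w, act i g u, act i g v, act i g w} \<subseteq> X'"
      using capture [of "{u, v, w, act i g u, act i g v, act i g w}"] by auto
    then show "C (act i g u) (act i g v) (act i g w) = C u v w"
      using partial_orderingD(6) [OF *(1) i, of u v w] member [OF *(2)] by simp
  next
    fix i a b e assume i: "i \<in> I" "a \<in> carrier (G i)" "b \<in> carrier (G i)" "e \<in> carrier (G i)"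
      and "act i a n0 \<in> X" "act i b n0 \<in> X" "act i e n0 \<in> X"
    then obtain X' C' where *: "partial_ordering X' C'" "order_graph X' C' \<in> \<G>"
        "{act i a n0, act i b n0, act i e n0} \<subseteq> X'"
      using capture [of "{act i a n0, act i b n0, act i e n0}"] by auto
    then show "C (act i a n0) (act i b n0) (act i e n0) = c i a b e"
      using partial_orderingD(7) [OF *(1) i] member [OF *(2)] by simp
  next
    fix i x g a assume i: "i \<in> I" and x: "x \<in> X" "act i g x \<in> X"
      and g: "g \<in> carrier (G i)" "g \<notin> S i" "a \<in> carrier (G i)"
    then obtain X' C' where *: "partial_ordering X' C'" "order_graph X' C' \<in> \<G>"
        "{x, act i g x} \<subseteq> X'"
      using capture [of "{x, act i g x}"] by auto
    then show "act i a n0 \<in> X"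
      using partial_orderingD(8) [OF *(1) i _ g(1,2) _ g(3), of x] member [OF *(2)] by auto
  qed
  then show ?thesis using graph by blast
qed

theorem exists_invariant_order:
  "\<exists>C. circ_on N C \<and>
    (\<forall>i\<in>I. \<forall>g\<in>carrier (G i). \<forall>u\<in>N. \<forall>v\<in>N. \<forall>w\<in>N. C (act i g u) (act i g v) (act i g w) = C u v w) \<and>
    (\<forall>i\<in>I. \<forall>a\<in>carrier (G i). \<forall>b\<in>carrier (G i). \<forall>e\<in>carrier (G i).
      C (act i a n0) (act i b n0) (act i e n0) = c i a b e)"
proof -
  let ?F = "{order_graph X C | X C. partial_ordering X C}"
  have "\<exists>M\<in>?F. \<forall>Z\<in>?F. M \<subseteq> Z \<longrightarrow> Z = M"
  proof (rule subset_Zorn_nonempty)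
    show "?F \<noteq> {}" using partial_ordering_initial by blast
    show "\<Union>\<G> \<in> ?F" if "\<G> \<noteq> {}" "subset.chain ?F \<G>" for \<G>
      using partial_ordering_chain [OF that] by blast
  qed
  then obtain M where M: "M \<in> ?F" "\<forall>Z\<in>?F. M \<subseteq> Z \<longrightarrow> Z = M" by (elim bexE)
  then obtain X C where X: "partial_ordering X C" and MX: "M = order_graph X C" by auto
  have max: "order_graph X' C' = order_graph X C"
    if "partial_ordering X' C'" "order_graph X C \<subseteq> order_graph X' C'" for X' C'
  proof -
    have "order_graph X' C' \<in> ?F" using that(1) by auto
    from mp [OF bspec [OF M(2) this]] show ?thesis using that(2) unfolding MX by simp
  qed
  have XN: "X = N"
  proof (rule ccontr)
    assume "X \<noteq> N"
    then obtain X' C' where X': "partial_ordering X' C'" "X \<subset> X'"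
      "\<forall>u\<in>X. \<forall>v\<in>X. \<forall>w\<in>X. C' u v w = C u v w"
      using partial_ordering_extend [OF X] by blast
    have sub: "order_graph X C \<subseteq> order_graph X' C'" unfolding order_graph_mono using X' by blast
    have "order_graph X' C' \<subseteq> order_graph X C" using max [OF X'(1) sub] by blast
    then have "X' \<subseteq> X" unfolding order_graph_mono by blast
    then show False using X'(2) by blast
  qed
  note X = X [unfolded XN]
  have cl: "act i g u \<in> N" if "i \<in> I" "g \<in> carrier (G i)" "u \<in> N" for i g u
    using free_action.act_closed [OF action] that by blast
  show ?thesis
  proof (intro exI [of _ C] conjI ballI)
    show "circ_on N C" by (rule partial_orderingD(5) [OF X])
    show "C (act i g u) (act i g v) (act i g w) = C u v w"
      if "i \<in> I" "g \<in> carrier (G i)" "u \<in> N" "v \<in> N" "w \<in> N" for i g u v w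
      by (rule partial_orderingD(6) [OF X that]) (rule cl that)+
    show "C (act i a n0) (act i b n0) (act i e n0) = c i a b e"
      if "i \<in> I" "a \<in> carrier (G i)" "b \<in> carrier (G i)" "e \<in> carrier (G i)" for i a b e
      by (rule partial_orderingD(7) [OF X that]) (rule cl that n0)+
  qed
qed

end

section \<open>Normal forms in an amalgamated product\<close>

locale injective_amalgam = amalgam_diagram I G H \<phi>
  for I :: "'i set" and G :: "'i \<Rightarrow> ('g, 'm) monoid_scheme" and H :: "('h, 'n) monoid_scheme"
    and \<phi> :: "'i \<Rightarrow> 'h \<Rightarrow> 'g" +
  assumes group_H: "group H" and inj: "i \<in> I \<Longrightarrow> inj_on (\<phi> i) (carrier H)" and I: "I \<noteq> {}"
begin

abbreviation "S i \<equiv> \<phi> i ` carrier H"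

lemma subgroup_S: "i \<in> I \<Longrightarrow> subgroup (S i) (G i)"
  using group_hom.img_is_subgroup [of H "G i" "\<phi> i"] group_H maps groups
  by (simp add: group_hom_def group_hom_axioms_def)

lemma \<phi>_carrier: "i \<in> I \<Longrightarrow> h \<in> carrier H \<Longrightarrow> \<phi> i h \<in> carrier (G i)"
  using hom_in_carrier [OF maps] .

lemma \<phi>_one: "i \<in> I \<Longrightarrow> \<phi> i \<one>\<^bsub>H\<^esub> = \<one>\<^bsub>G i\<^esub>"
  using hom_one [OF maps group_H groups] .

text \<open>Representatives of the right cosets of \<open>H\<close> in \<open>G i\<close>; that of \<open>H\<close> itself has to be \<open>\<one>\<close>, so
  that elements of \<open>H\<close> leave no letter behind when they are moved to the front.\<close>

definition coset_rep :: "'i \<Rightarrow> 'g \<Rightarrow> 'g"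
  where "coset_rep i g = (if g \<in> S i then \<one>\<^bsub>G i\<^esub> else SOME t. t \<in> S i #>\<^bsub>G i\<^esub> g)"

definition hpart :: "'i \<Rightarrow> 'g \<Rightarrow> 'h"
  where "hpart i g = inv_into (carrier H) (\<phi> i) (g \<otimes>\<^bsub>G i\<^esub> inv\<^bsub>G i\<^esub> coset_rep i g)"

lemma coset_rep_mem_coset:
  assumes i: "i \<in> I" and g: "g \<in> carrier (G i)"
  shows "coset_rep i g \<in> S i #>\<^bsub>G i\<^esub> g"
proof -
  interpret group "G i" by (rule groups [OF i])
  have self: "g \<in> S i #>\<^bsub>G i\<^esub> g" using rcos_self [OF g subgroup_S [OF i]] .
  show ?thesis
  proof (cases "g \<in> S i")
    case True
    then show ?thesis
      using coset_join2 [OF g subgroup_S [OF i] True] subgroup.one_closed [OF subgroup_S [OF i]]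
      by (simp add: coset_rep_def)
  next
    case False
    then show ?thesis using someI [of "\<lambda>t. t \<in> S i #>\<^bsub>G i\<^esub> g", OF self] by (simp add: coset_rep_def)
  qed
qed

lemma coset_rep_carrier:
  assumes i: "i \<in> I" and g: "g \<in> carrier (G i)" shows "coset_rep i g \<in> carrier (G i)"
proof -
  interpret group "G i" by (rule groups [OF i])
  obtain s where "s \<in> S i" "coset_rep i g = s \<otimes>\<^bsub>G i\<^esub> g"
    using coset_rep_mem_coset [OF i g] unfolding r_coset_def by blast
  then show ?thesis using g subgroup.mem_carrier [OF subgroup_S [OF i]] by simp
qed

lemma mult_mem_S:
  assumes i: "i \<in> I" and s: "s \<in> S i" and g: "g \<in> carrier (G i)"
  shows "s \<otimes>\<^bsub>G i\<^esub> g \<in> S i \<longleftrightarrow> g \<in> S i" "g \<otimes>\<^bsub>G i\<^esub> s \<in> S i \<longleftrightarrow> g \<in> S i"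
proof -
  interpret group "G i" by (rule groups [OF i])
  interpret S: subgroup "S i" "G i" by (rule subgroup_S [OF i])
  have sc: "s \<in> carrier (G i)" using s by (rule S.mem_carrier)
  have "inv\<^bsub>G i\<^esub> s \<otimes>\<^bsub>G i\<^esub> (s \<otimes>\<^bsub>G i\<^esub> g) = g" "(g \<otimes>\<^bsub>G i\<^esub> s) \<otimes>\<^bsub>G i\<^esub> inv\<^bsub>G i\<^esub> s = g"
    using sc g by (simp_all add: m_assoc [symmetric] inv_solve_right')
  then show "s \<otimes>\<^bsub>G i\<^esub> g \<in> S i \<longleftrightarrow> g \<in> S i" "g \<otimes>\<^bsub>G i\<^esub> s \<in> S i \<longleftrightarrow> g \<in> S i"
    using S.m_closed S.m_inv_closed s by metis+
qed

lemma coset_rep_mult: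
  assumes i: "i \<in> I" and s: "s \<in> S i" and g: "g \<in> carrier (G i)"
  shows "coset_rep i (s \<otimes>\<^bsub>G i\<^esub> g) = coset_rep i g"
proof -
  interpret group "G i" by (rule groups [OF i])
  interpret S: subgroup "S i" "G i" by (rule subgroup_S [OF i])
  have "S i #>\<^bsub>G i\<^esub> (s \<otimes>\<^bsub>G i\<^esub> g) = S i #>\<^bsub>G i\<^esub> g"
    using coset_mult_assoc [OF S.subset S.mem_carrier [OF s] g]
      coset_join2 [OF S.mem_carrier [OF s] subgroup_S [OF i] s] by simp
  then show ?thesis using mult_mem_S [OF i s g] by (simp add: coset_rep_def)
qed

lemma coset_rep_mem_S: "i \<in> I \<Longrightarrow> g \<in> carrier (G i) \<Longrightarrow> coset_rep i g \<in> S i \<longleftrightarrow> g \<in> S i"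
  and coset_rep_idem: "i \<in> I \<Longrightarrow> g \<in> carrier (G i) \<Longrightarrow> coset_rep i (coset_rep i g) = coset_rep i g"
proof -
  assume i: "i \<in> I" and g: "g \<in> carrier (G i)"
  obtain s where s: "s \<in> S i" "coset_rep i g = s \<otimes>\<^bsub>G i\<^esub> g"
    using coset_rep_mem_coset [OF i g] unfolding r_coset_def by blast
  show "coset_rep i g \<in> S i \<longleftrightarrow> g \<in> S i" "coset_rep i (coset_rep i g) = coset_rep i g"
    using mult_mem_S(1) [OF i s(1) g] coset_rep_mult [OF i s(1) g] s(2) by simp_all
qed

lemma hpart:
  assumes i: "i \<in> I" and g: "g \<in> carrier (G i)"
  shows "hpart i g \<in> carrier H" "\<phi> i (hpart i g) \<otimes>\<^bsub>G i\<^esub> coset_rep i g = g"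
proof -
  interpret group "G i" by (rule groups [OF i])
  interpret S: subgroup "S i" "G i" by (rule subgroup_S [OF i])
  obtain s where s: "s \<in> S i" "coset_rep i g = s \<otimes>\<^bsub>G i\<^esub> g"
    using coset_rep_mem_coset [OF i g] unfolding r_coset_def by blast
  have sc: "s \<in> carrier (G i)" using s by auto
  have "g \<otimes>\<^bsub>G i\<^esub> inv\<^bsub>G i\<^esub> coset_rep i g = inv\<^bsub>G i\<^esub> s"
    using sc g by (simp add: s(2) inv_mult_group m_assoc [symmetric])
  then have *: "g \<otimes>\<^bsub>G i\<^esub> inv\<^bsub>G i\<^esub> coset_rep i g \<in> S i" using s by simp
  then show "hpart i g \<in> carrier H" unfolding hpart_def by (rule inv_into_into)
  have "\<phi> i (hpart i g) = g \<otimes>\<^bsub>G i\<^esub> inv\<^bsub>G i\<^esub> coset_rep i g"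
    unfolding hpart_def by (rule f_inv_into_f [OF *])
  then show "\<phi> i (hpart i g) \<otimes>\<^bsub>G i\<^esub> coset_rep i g = g"
    using g coset_rep_carrier [OF i g] by (simp add: m_assoc)
qed

lemma hpart_unique:
  assumes i: "i \<in> I" and h: "h \<in> carrier H" and g: "g \<in> carrier (G i)"
    and eq: "g = \<phi> i h \<otimes>\<^bsub>G i\<^esub> coset_rep i g"
  shows "hpart i g = h"
proof -
  interpret group "G i" by (rule groups [OF i])
  have "\<phi> i (hpart i g) \<otimes>\<^bsub>G i\<^esub> coset_rep i g = \<phi> i h \<otimes>\<^bsub>G i\<^esub> coset_rep i g"
    using hpart(2) [OF i g] eq by simp
  then have "\<phi> i (hpart i g) = \<phi> i h"
    using right_cancel [OF coset_rep_carrier [OF i g]] \<phi>_carrier i h hpart(1) [OF i g] by simp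
  then show ?thesis using inj [OF i] h hpart(1) [OF i g] by (auto simp: inj_on_def)
qed

lemma hpart_mult:
  assumes i: "i \<in> I" and h: "h \<in> carrier H" and g: "g \<in> carrier (G i)"
  shows "hpart i (\<phi> i h \<otimes>\<^bsub>G i\<^esub> g) = h \<otimes>\<^bsub>H\<^esub> hpart i g"
proof (rule hpart_unique [OF i])
  interpret group "G i" by (rule groups [OF i])
  interpret H: group H by (rule group_H)
  show "h \<otimes>\<^bsub>H\<^esub> hpart i g \<in> carrier H" using h hpart(1) [OF i g] by simp
  show "\<phi> i h \<otimes>\<^bsub>G i\<^esub> g \<in> carrier (G i)" using g \<phi>_carrier i h by simp
  have "\<phi> i (h \<otimes>\<^bsub>H\<^esub> hpart i g) = \<phi> i h \<otimes>\<^bsub>G i\<^esub> \<phi> i (hpart i g)"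
    using hom_mult [OF maps [OF i] h hpart(1) [OF i g]] .
  then show "\<phi> i h \<otimes>\<^bsub>G i\<^esub> g = \<phi> i (h \<otimes>\<^bsub>H\<^esub> hpart i g) \<otimes>\<^bsub>G i\<^esub> coset_rep i (\<phi> i h \<otimes>\<^bsub>G i\<^esub> g)"
    using hpart [OF i g] coset_rep_mult [OF i imageI [OF h] g] \<phi>_carrier i h coset_rep_carrier [OF i g]
    by (simp add: m_assoc)
qed

definition first :: "('i \<times> 'g) list \<Rightarrow> 'i option"
  where "first w = (case w of [] \<Rightarrow> None | x # _ \<Rightarrow> Some (fst x))"

fun reduced :: "('i \<times> 'g) list \<Rightarrow> bool"
  where "reduced [] \<longleftrightarrow> True"
  | "reduced ((i, t) # w) \<longleftrightarrow> i \<in> I \<and> t \<in> carrier (G i) \<and> t \<notin> S i \<and> coset_rep i t = t \<and> reduced w \<and>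
      first w \<noteq> Some i"

text \<open>Normal forms \<open>h t\<^sub>1 \<dots> t\<^sub>n\<close>, with \<open>h\<close> in \<open>H\<close> and nontrivial coset representatives \<open>t\<^sub>k\<close> from
  groups with indices that change at each step.\<close>

definition N :: "('h \<times> ('i \<times> 'g) list) set"
  where "N = carrier H \<times> {w. reduced w}"

text \<open>For fixed \<open>i\<close>, normal forms correspond to pairs of an element of \<open>G i\<close> and a reduced word
  that does not begin with a letter from \<open>G i\<close>: \<open>join\<close> multiplies the two, and \<open>split\<close> takes them
  apart. The action of \<open>G i\<close> is left multiplication on the first component, which is free; this is
  the trick of van der Waerden.\<close>

definition join :: "'i \<Rightarrow> 'g \<Rightarrow> ('i \<times> 'g) list \<Rightarrow> 'h \<times> ('i \<times> 'g) list"
  where "join i g w = (hpart i g, if g \<in> S i then w else (i, coset_rep i g) # w)"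

definition split :: "'i \<Rightarrow> 'h \<times> ('i \<times> 'g) list \<Rightarrow> 'g \<times> ('i \<times> 'g) list"
  where "split i n = (if first (snd n) = Some i then (\<phi> i (fst n) \<otimes>\<^bsub>G i\<^esub> snd (hd (snd n)), tl (snd n))
    else (\<phi> i (fst n), snd n))"

definition nact :: "'i \<Rightarrow> 'g \<Rightarrow> 'h \<times> ('i \<times> 'g) list \<Rightarrow> 'h \<times> ('i \<times> 'g) list"
  where "nact i g n = join i (g \<otimes>\<^bsub>G i\<^esub> fst (split i n)) (snd (split i n))"

lemma first_simps [simp]: "first [] = None" "first (x # w) = Some (fst x)"
  by (simp_all add: first_def)

lemma split_join:
  assumes i: "i \<in> I" and g: "g \<in> carrier (G i)" and w: "first w \<noteq> Some i"
  shows "split i (join i g w) = (g, w)"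
proof (cases "g \<in> S i")
  case True
  then have "\<phi> i (hpart i g) = g"
    using hpart [OF i g] \<phi>_carrier [OF i hpart(1) [OF i g]] group.is_monoid [OF groups [OF i]]
    by (simp add: coset_rep_def monoid.r_one)
  then show ?thesis using True w by (simp add: join_def split_def)
next
  case False
  then show ?thesis using hpart [OF i g] by (simp add: join_def split_def)
qed

lemma join_mem:
  "i \<in> I \<Longrightarrow> g \<in> carrier (G i) \<Longrightarrow> reduced w \<Longrightarrow> first w \<noteq> Some i \<Longrightarrow> join i g w \<in> N"
  by (simp add: join_def N_def hpart coset_rep_carrier coset_rep_mem_S coset_rep_idem)

lemma join_H:
  assumes i: "i \<in> I" and h: "h \<in> carrier H" shows "join i (\<phi> i h) w = (h, w)"
proof -
  interpret group "G i" by (rule groups [OF i])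
  note \<phi>h = \<phi>_carrier [OF i h]
  have "hpart i (\<phi> i h) = h"
    by (rule hpart_unique [OF i h \<phi>h]) (use \<phi>h h in \<open>simp add: coset_rep_def\<close>)
  then show ?thesis using h by (simp add: join_def)
qed

lemma join_letter:
  assumes i: "i \<in> I" and h: "h \<in> carrier H" and t: "t \<in> carrier (G i)" "t \<notin> S i" "coset_rep i t = t"
  shows "join i (\<phi> i h \<otimes>\<^bsub>G i\<^esub> t) w = (h, (i, t) # w)"
proof -
  interpret group "G i" by (rule groups [OF i])
  note \<phi>h = \<phi>_carrier [OF i h]
  have r: "coset_rep i (\<phi> i h \<otimes>\<^bsub>G i\<^esub> t) = t"
    using coset_rep_mult [OF i imageI [OF h] t(1)] t(3) by simp
  then have "hpart i (\<phi> i h \<otimes>\<^bsub>G i\<^esub> t) = h" by (intro hpart_unique [OF i h]) (use \<phi>h t in simp_all)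
  then show ?thesis
    using mult_mem_S(1) [OF i imageI [OF h] t(1)] t(2) r by (simp add: join_def)
qed

lemma normal_form_cases:
  assumes i: "i \<in> I" and n: "n \<in> N"
  obtains a w where "a \<in> carrier (G i)" "reduced w" "first w \<noteq> Some i" "n = join i a w"
proof -
  interpret group "G i" by (rule groups [OF i])
  obtain h u where n_eq: "n = (h, u)" and h: "h \<in> carrier H" and u: "reduced u"
    using n by (auto simp: N_def)
  note \<phi>h = \<phi>_carrier [OF i h]
  show ?thesis
  proof (cases "first u = Some i")
    case True
    then obtain t w where uw: "u = (i, t) # w" by (cases u) auto
    have t: "t \<in> carrier (G i)" "t \<notin> S i" "coset_rep i t = t" "reduced w" "first w \<noteq> Some i"
      using u by (auto simp: uw)
    show ?thesis
      using that [of "\<phi> i h \<otimes>\<^bsub>G i\<^esub> t" w] t \<phi>h join_letter [OF i h t(1-3), of w]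
        by (simp add: n_eq uw)
  next
    case False
    then show ?thesis using that [of "\<phi> i h" u] \<phi>h u join_H [OF i h] by (simp add: n_eq)
  qed
qed

lemma nact_join:
  "i \<in> I \<Longrightarrow> g \<in> carrier (G i) \<Longrightarrow> a \<in> carrier (G i) \<Longrightarrow> first w \<noteq> Some i \<Longrightarrow>
    nact i g (join i a w) = join i (g \<otimes>\<^bsub>G i\<^esub> a) w"
  by (simp add: nact_def split_join)

lemma free_action_nact:
  assumes i: "i \<in> I" shows "free_action (G i) N (nact i)"
proof -
  interpret group "G i" by (rule groups [OF i])
  show ?thesis
  proof
    fix n assume n: "n \<in> N"
    obtain a w where aw: "a \<in> carrier (G i)" "reduced w" "first w \<noteq> Some i" "n = join i a w"
      using normal_form_cases [OF i n] .
    show "nact i \<one>\<^bsub>G i\<^esub> n = n" using aw by (simp add: nact_join [OF i])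
    fix g assume g: "g \<in> carrier (G i)"
    show "nact i g n \<in> N" using aw g join_mem [OF i _ aw(2,3)] by (simp add: nact_join [OF i])
    show "nact i (g \<otimes>\<^bsub>G i\<^esub> h) n = nact i g (nact i h n)" if "h \<in> carrier (G i)" for h
      using aw g that by (simp add: nact_join [OF i] m_assoc)
    assume "nact i g n = n"
    then have "split i (join i (g \<otimes>\<^bsub>G i\<^esub> a) w) = split i (join i a w)"
      using aw g by (simp add: nact_join [OF i])
    then have "g \<otimes>\<^bsub>G i\<^esub> a = a" using aw g by (simp add: split_join [OF i])
    then show "g = \<one>\<^bsub>G i\<^esub>" using aw g by simp
  qed
qed

definition nhact :: "'h \<Rightarrow> 'h \<times> ('i \<times> 'g) list \<Rightarrow> 'h \<times> ('i \<times> 'g) list"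
  where "nhact h n = (h \<otimes>\<^bsub>H\<^esub> fst n, snd n)"

text \<open>The head of \<open>join i a w\<close> differs from \<open>i\<close> exactly if \<open>a\<close> is in \<open>H\<close>, which is the tree
  property. Any normal form is reached from the empty one by multiplying with its letters from
  right to left.\<close>

lemma tree_of_orbits_normal_forms:
  "tree_of_orbits I G H \<phi> N nact nhact (\<one>\<^bsub>H\<^esub>, []) (\<lambda>n. first (snd n))"
proof (rule tree_of_orbits.intro)
  interpret H: group H by (rule group_H)
  show "free_action (G i) N (nact i)" if "i \<in> I" for i using free_action_nact [OF that] .
  show "group H" by (rule group_H)
  show "\<phi> i \<in> hom H (G i)" if "i \<in> I" for i using maps that .
  show "(\<one>\<^bsub>H\<^esub>, []) \<in> N" by (simp add: N_def)
  show "first (snd (nhact h (\<one>\<^bsub>H\<^esub>, []))) = None" for h by (simp add: nhact_def)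
  show "I \<noteq> {}" by (rule I)
next
  fix i h n assume i: "i \<in> I" and h: "h \<in> carrier H" and n: "n \<in> N"
  obtain a w where aw: "a \<in> carrier (G i)" "reduced w" "first w \<noteq> Some i" "n = join i a w"
    using normal_form_cases [OF i n] .
  show "nact i (\<phi> i h) n = nhact h n"
    using aw nact_join [OF i \<phi>_carrier [OF i h] aw(1,3)] mult_mem_S(1) [OF i imageI [OF h] aw(1)]
      hpart_mult [OF i h aw(1)] coset_rep_mult [OF i imageI [OF h] aw(1)]
    by (simp add: nhact_def join_def)
next
  fix i n g assume i: "i \<in> I" and n: "n \<in> N" and g: "g \<in> carrier (G i)"
    and hd: "first (snd n) \<noteq> Some i" "first (snd (nact i g n)) \<noteq> Some i"
  obtain a w where aw: "a \<in> carrier (G i)" "reduced w" "first w \<noteq> Some i" "n = join i a w"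
    using normal_form_cases [OF i n] .
  have a: "a \<in> S i" using hd(1) aw(4) by (auto simp: join_def split: if_splits)
  have "nact i g n = join i (g \<otimes>\<^bsub>G i\<^esub> a) w" using nact_join [OF i g aw(1,3)] aw(4) by simp
  then have "g \<otimes>\<^bsub>G i\<^esub> a \<in> S i" using hd(2) by (auto simp: join_def split: if_splits)
  then show "g \<in> S i" using mult_mem_S(2) [OF i a g] by simp
next
  fix X assume X: "X \<subseteq> N" "(\<one>\<^bsub>H\<^esub>, []) \<in> X"
    and closed: "\<And>i g x. i \<in> I \<Longrightarrow> g \<in> carrier (G i) \<Longrightarrow> x \<in> X \<Longrightarrow> nact i g x \<in> X"
  interpret H: group H by (rule group_H)
  have "(h, w) \<in> X" if "h \<in> carrier H" "reduced w" for h w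
    using that
  proof (induction w arbitrary: h)
    case Nil
    obtain i where i: "i \<in> I" using I by blast
    have "nact i (\<phi> i h) (join i (\<phi> i \<one>\<^bsub>H\<^esub>) []) = join i (\<phi> i h) []"
      using nact_join [OF i \<phi>_carrier [OF i Nil(1)] \<phi>_carrier [OF i H.one_closed], of "[]"]
        group.is_monoid [OF groups [OF i]] \<phi>_carrier [OF i Nil(1)] \<phi>_one [OF i]
          by (simp add: monoid.r_one)
    then have "nact i (\<phi> i h) (\<one>\<^bsub>H\<^esub>, []) = (h, [])" using join_H [OF i] Nil by simp
    then show ?case using closed [OF i \<phi>_carrier [OF i Nil(1)] X(2)] by simp
  next
    case (Cons x w)
    obtain i t where x: "x = (i, t)" by force
    have t: "i \<in> I" "t \<in> carrier (G i)" "t \<notin> S i" "coset_rep i t = t" "reduced w" "first w \<noteq> Some i"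
      using Cons.prems(2) by (auto simp: x)
    interpret group "G i" by (rule groups [OF t(1)])
    have ht: "\<phi> i h \<otimes>\<^bsub>G i\<^esub> t \<in> carrier (G i)" using \<phi>_carrier [OF t(1) Cons.prems(1)] t by simp
    have "nact i (\<phi> i h \<otimes>\<^bsub>G i\<^esub> t) (join i (\<phi> i \<one>\<^bsub>H\<^esub>) w) = join i (\<phi> i h \<otimes>\<^bsub>G i\<^esub> t) w"
      using nact_join [OF t(1) ht \<phi>_carrier [OF t(1) H.one_closed] t(6)] ht \<phi>_one [OF t(1)] by simp
    then have "nact i (\<phi> i h \<otimes>\<^bsub>G i\<^esub> t) (\<one>\<^bsub>H\<^esub>, w) = (h, x # w)"
      using join_H [OF t(1) H.one_closed] join_letter [OF t(1) Cons.prems(1) t(2-4)] x by simp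
    then show ?case using closed [OF t(1) ht Cons.IH [OF H.one_closed t(5)]] by simp
  qed
  then show "X = N" using X(1) by (auto simp: N_def)
qed

end

section \<open>Circular orders on amalgamated products\<close>

context injective_amalgam begin

definition wact :: "('i \<times> 'g) list \<Rightarrow> 'h \<times> ('i \<times> 'g) list \<Rightarrow> 'h \<times> ('i \<times> 'g) list"
  where "wact u n = foldr (\<lambda>(i, g). nact i g) u n"

text \<open>The element of the amalgam that a normal form denotes. Some \<open>G i\<close> has to be chosen to regard
  the factor from \<open>H\<close> as a letter; the class does not depend on it.\<close>

definition nf_value :: "'h \<times> ('i \<times> 'g) list \<Rightarrow> ('i \<times> 'g) list set"
  where "nf_value n = (let i = (SOME i. i \<in> I) in cls ((i, \<phi> i (fst n)) # snd n))"

lemma wact_simps: "wact [] n = n" "wact ((i, g) # u) n = nact i g (wact u n)"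
  and wact_append: "wact (u @ v) n = wact u (wact v n)"
  by (simp_all add: wact_def)

lemma nact_closed: "i \<in> I \<Longrightarrow> g \<in> carrier (G i) \<Longrightarrow> n \<in> N \<Longrightarrow> nact i g n \<in> N"
  using free_action.act_closed [OF free_action_nact] .

lemma wact_closed: "u \<in> W \<Longrightarrow> n \<in> N \<Longrightarrow> wact u n \<in> N"
  by (induction u) (auto simp: wact_simps nact_closed)

text \<open>The relations of the amalgam hold in the action, so the amalgam acts on normal forms.\<close>

lemma wact_amalgam_eq: "amalgam_eq I G H \<phi> u v \<Longrightarrow> n \<in> N \<Longrightarrow> wact u n = wact v n"
proof (induction arbitrary: n rule: amalgam_eq.induct)
  case (append u u' v v')
  then show ?case using wact_closed amalgam_eq_words by (metis wact_append)
next
  case (one i)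
  then show ?case using free_action.act_one [OF free_action_nact] by (simp add: wact_simps)
next
  case (mult i a b)
  then show ?case
    using free_action.act_mult [OF free_action_nact [OF mult(1)]] by (simp add: wact_simps)
next
  case (amalgamate i j h)
  then show ?case
    using tree_of_orbits.hact [OF tree_of_orbits_normal_forms] by (simp add: wact_simps)
qed auto

lemma reduced_word: "reduced w \<Longrightarrow> w \<in> W"
  by (induction w) auto

lemma nf_value_join:
  assumes i: "i \<in> I" and a: "a \<in> carrier (G i)" and w: "reduced w"
  shows "nf_value (join i a w) = cls ((i, a) # w)"
proof -
  define j where "j = (SOME i. i \<in> I)"
  have j: "j \<in> I" unfolding j_def some_in_eq by (rule I)
  let ?h = "hpart i a"
  have h: "?h \<in> carrier H" by (rule hpart(1) [OF i a])
  note wW = reduced_word [OF w]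
  have swap: "cls ((j, \<phi> j ?h) # u) = cls ((i, \<phi> i ?h) # u)" if u: "u \<in> W" for u
  proof -
    have "amalgam_eq I G H \<phi> ([(j, \<phi> j ?h)] @ u) ([(i, \<phi> i ?h)] @ u)"
      by (rule amalgam_eq.append [OF amalgam_eq.amalgamate [OF j i h] amalgam_eq.refl [OF u]])
    then show ?thesis using cls_eq_iff [of "(j, \<phi> j ?h) # u"] u j \<phi>_carrier [OF j h] by simp
  qed
  show ?thesis
  proof (cases "a \<in> S i")
    case True
    then have "\<phi> i ?h = a"
      using hpart [OF i a] \<phi>_carrier [OF i h] group.is_monoid [OF groups [OF i]]
      by (simp add: coset_rep_def monoid.r_one)
    then show ?thesis using True swap [OF wW] by (simp add: nf_value_def j_def [symmetric] join_def)
  next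
    case False
    have r: "coset_rep i a \<in> carrier (G i)" by (rule coset_rep_carrier [OF i a])
    have "amalgam_eq I G H \<phi> ([(i, \<phi> i ?h), (i, coset_rep i a)] @ w) ([(i, \<phi> i ?h \<otimes>\<^bsub>G i\<^esub> coset_rep i a)] @ w)"
      by (rule amalgam_eq.append [OF _ amalgam_eq.refl [OF wW]], rule amalgam_eq.mult)
        (use i r \<phi>_carrier [OF i h] in auto)
    then have "cls ((i, \<phi> i ?h) # (i, coset_rep i a) # w) = cls ((i, a) # w)"
      using cls_eq_iff [of "(i, \<phi> i ?h) # (i, coset_rep i a) # w"] i \<phi>_carrier [OF i h] r wW
      by (simp add: hpart(2) [OF i a])
    then show ?thesis
      using False swap [of "(i, coset_rep i a) # w"] i r wW
        by (simp add: nf_value_def j_def [symmetric] join_def)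
  qed
qed

lemma nf_value_nact:
  assumes i: "i \<in> I" and g: "g \<in> carrier (G i)" and n: "n \<in> N"
    and u: "u \<in> W" "nf_value n = cls u"
  shows "nf_value (nact i g n) = cls ((i, g) # u)"
proof -
  interpret group "G i" by (rule groups [OF i])
  obtain a w where aw: "a \<in> carrier (G i)" "reduced w" "first w \<noteq> Some i" "n = join i a w"
    using normal_form_cases [OF i n] .
  note wW = reduced_word [OF aw(2)]
  have ga: "g \<otimes>\<^bsub>G i\<^esub> a \<in> carrier (G i)" using g aw by simp
  have "cls u = cls ((i, a) # w)" using u(2) nf_value_join [OF i aw(1,2)] aw(4) by simp
  then have eq: "amalgam_eq I G H \<phi> u ((i, a) # w)" using cls_eq_iff [OF u(1)] by simp
  have "amalgam_eq I G H \<phi> ([(i, g)] @ u) ([(i, g)] @ ((i, a) # w))"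
    by (rule amalgam_eq.append [OF amalgam_eq.refl eq]) (use i g in simp)
  moreover have "amalgam_eq I G H \<phi> ([(i, g), (i, a)] @ w) ([(i, g \<otimes>\<^bsub>G i\<^esub> a)] @ w)"
    by (rule amalgam_eq.append [OF _ amalgam_eq.refl [OF wW]], rule amalgam_eq.mult)
      (use i g aw in auto)
  ultimately have "amalgam_eq I G H \<phi> ((i, g) # u) ((i, g \<otimes>\<^bsub>G i\<^esub> a) # w)"
    by (simp add: amalgam_eq.trans)
  then have "cls ((i, g) # u) = cls ((i, g \<otimes>\<^bsub>G i\<^esub> a) # w)"
    using cls_eq_iff [of "(i, g) # u"] i g u by simp
  then show ?thesis
    using nf_value_join [OF i ga aw(2)] nact_join [OF i g aw(1,3)] aw(4) by simp
qed

abbreviation "base \<equiv> (\<one>\<^bsub>H\<^esub>, []) :: 'h \<times> ('i \<times> 'g) list"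

lemma base_mem: "base \<in> N"
  using group.is_monoid [OF group_H] by (simp add: N_def monoid.one_closed)

lemma nf_value_wact: "u \<in> W \<Longrightarrow> nf_value (wact u base) = cls u"
proof (induction u)
  case Nil
  define j where "j = (SOME i. i \<in> I)"
  have j: "j \<in> I" unfolding j_def some_in_eq by (rule I)
  have "[(j, \<one>\<^bsub>G j\<^esub>)] \<in> W"
    using j group.is_monoid [OF groups [OF j]] by (simp add: monoid.one_closed)
  then have "cls [(j, \<one>\<^bsub>G j\<^esub>)] = cls []" using amalgam_eq.one [OF j] cls_eq_iff by blast
  then show ?case by (simp add: wact_simps nf_value_def j_def [symmetric] \<phi>_one [OF j])
next
  case (Cons x u)
  obtain i g where x: "x = (i, g)" by force
  then show ?case using Cons nf_value_nact [of i g "wact u base" u] wact_closed [OF _ base_mem]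
    by (simp add: wact_simps)
qed

definition nf_of :: "('i \<times> 'g) list set \<Rightarrow> 'h \<times> ('i \<times> 'g) list"
  where "nf_of A = wact (SOME u. u \<in> A) base"

lemma nf_of_cls: assumes u: "u \<in> W" shows "nf_of (cls u) = wact u base"
proof -
  have "u \<in> cls u" using u by (simp add: amalgam_class_def amalgam_eq.refl)
  then have "(SOME v. v \<in> cls u) \<in> cls u" by (rule someI)
  then show ?thesis using wact_amalgam_eq [OF _ base_mem] by (simp add: nf_of_def amalgam_class_def)
qed

text \<open>The normal form theorem: an element of the amalgam is recovered from its normal form. So the
  base point has trivial stabiliser, and an invariant order on normal forms is an order on the
  amalgam.\<close>

lemma inj_on_nf_of: "inj_on nf_of (carrier P)"
  by (rule inj_on_inverseI [of _ nf_value]) (auto simp: carrier_P nf_of_cls nf_value_wact)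

text \<open>The order on normal forms is pulled back to the amalgam along the action on the base point.
  The elements of \<open>G i\<close> correspond to the orbit of the base point, where that order is \<open>c i\<close>.\<close>

theorem amalgam_has_circular_ordering:
  assumes circ: "\<And>i. i \<in> I \<Longrightarrow> circular_ordering (G i) (c i)"
    and agree: "\<And>i j h k l. i \<in> I \<Longrightarrow> j \<in> I \<Longrightarrow> h \<in> carrier H \<Longrightarrow> k \<in> carrier H \<Longrightarrow> l \<in> carrier H \<Longrightarrow>
      c i (\<phi> i h) (\<phi> i k) (\<phi> i l) = c j (\<phi> j h) (\<phi> j k) (\<phi> j l)"
    and common_powers: "\<And>h k. h \<in> carrier H \<Longrightarrow> k \<in> carrier H \<Longrightarrow> h \<noteq> \<one>\<^bsub>H\<^esub> \<Longrightarrow> k \<noteq> \<one>\<^bsub>H\<^esub> \<Longrightarrow>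
      \<exists>(m::int) (n::int). m \<noteq> 0 \<and> n \<noteq> 0 \<and> h [^]\<^bsub>H\<^esub> m = k [^]\<^bsub>H\<^esub> n"
  shows "\<exists>C. circularly_ordered_group P C \<and> (\<forall>i\<in>I. extends_ordering I G H \<phi> C i (c i))"
proof -
  interpret T: ordered_tree_of_orbits I G H \<phi> N nact nhact base "\<lambda>n. first (snd n)" c
  proof (intro ordered_tree_of_orbits.intro tree_of_orbits_normal_forms ordered_tree_of_orbits_axioms.intro)
    fix i g g' assume i: "i \<in> I" and g: "g \<in> S i" "g' \<in> S i" "g \<noteq> \<one>\<^bsub>G i\<^esub>" "g' \<noteq> \<one>\<^bsub>G i\<^esub>"
    then obtain h k where hk: "h \<in> carrier H" "k \<in> carrier H" "g = \<phi> i h" "g' = \<phi> i k" by auto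
    then have ne: "h \<noteq> \<one>\<^bsub>H\<^esub>" "k \<noteq> \<one>\<^bsub>H\<^esub>" using g \<phi>_one [OF i] by auto
    obtain m n :: int where mn: "m \<noteq> 0" "n \<noteq> 0" "h [^]\<^bsub>H\<^esub> m = k [^]\<^bsub>H\<^esub> n"
      using common_powers [OF hk(1,2) ne] by blast
    have "g [^]\<^bsub>G i\<^esub> m = g' [^]\<^bsub>G i\<^esub> n"
      using hom_int_pow [OF maps [OF i] hk(1) group_H groups [OF i], of m]
        hom_int_pow [OF maps [OF i] hk(2) group_H groups [OF i], of n] mn(3) hk by simp
    then show "\<exists>(m::int) (n::int). m \<noteq> 0 \<and> n \<noteq> 0 \<and> g [^]\<^bsub>G i\<^esub> m = g' [^]\<^bsub>G i\<^esub> n"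
      using mn by blast
  qed (use circ agree in blast)+
  obtain E where E: "circ_on N E"
    "\<forall>i\<in>I. \<forall>g\<in>carrier (G i). \<forall>u\<in>N. \<forall>v\<in>N. \<forall>w\<in>N. E (nact i g u) (nact i g v) (nact i g w) = E u v w"
    "\<forall>i\<in>I. \<forall>a\<in>carrier (G i). \<forall>b\<in>carrier (G i). \<forall>e\<in>carrier (G i).
      E (nact i a base) (nact i b base) (nact i e base) = c i a b e"
    using T.exists_invariant_order by (elim exE conjE)
  define C where "C x y z = E (nf_of x) (nf_of y) (nf_of z)" for x y z
  have wact_inv: "E (wact u x) (wact u y) (wact u z) = E x y z"
    if "u \<in> W" "x \<in> N" "y \<in> N" "z \<in> N" for u x y z
    using that(1)
  proof (induction u)
    case (Cons p u)
    obtain i g where p: "p = (i, g)" by force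
    then have ig: "i \<in> I" "g \<in> carrier (G i)" and u: "u \<in> W" using Cons.prems by auto
    have "E (nact i g (wact u x)) (nact i g (wact u y)) (nact i g (wact u z))
        = E (wact u x) (wact u y) (wact u z)"
      using E(2) ig wact_closed [OF u] that(2-4) by blast
    then show ?case using Cons.IH [OF u] by (simp add: p wact_simps)
  qed (simp add: wact_simps)
  have nf_ofN: "nf_of x \<in> N" if "x \<in> carrier P" for x
    using that wact_closed [OF _ base_mem] by (auto simp: carrier_P nf_of_cls)
  have C: "circ_on (carrier P) C"
    unfolding C_def by (rule circ_on_pullback [OF E(1) inj_on_nf_of]) (use nf_ofN in blast)
  have nf_of_mult: "nf_of (cls u \<otimes>\<^bsub>P\<^esub> x) = wact u (nf_of x)" if "u \<in> W" "x \<in> carrier P" for u x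
    using that by (auto simp: carrier_P mult_cls nf_of_cls wact_append)
  have "C (g \<otimes>\<^bsub>P\<^esub> x) (g \<otimes>\<^bsub>P\<^esub> y) (g \<otimes>\<^bsub>P\<^esub> z) = C x y z"
    if g: "g \<in> carrier P" and xyz: "x \<in> carrier P" "y \<in> carrier P" "z \<in> carrier P" for g x y z
  proof -
    obtain u where u: "u \<in> W" "g = cls u" using g by (auto simp: carrier_P)
    show ?thesis
      using wact_inv [OF u(1) nf_ofN nf_ofN nf_ofN, OF xyz]
      by (simp add: C_def u(2) nf_of_mult [OF u(1)] xyz)
  qed
  then have "circular_ordering P C"
    using C unfolding circular_ordering_iff by simp
  then have 1: "circularly_ordered_group P C"
    by (simp add: circularly_ordered_group_def group_amalgamated_product)
  have 2: "extends_ordering I G H \<phi> C i (c i)" if i: "i \<in> I" for i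
  proof -
    have p: "nf_of (amalgam_incl I G H \<phi> i g) = nact i g base" if "g \<in> carrier (G i)" for g
      using that i by (simp add: amalgam_incl_def nf_of_cls wact_simps)
    have "inj_on (amalgam_incl I G H \<phi> i) (carrier (G i))"
    proof (rule inj_onI)
      fix a b assume ab: "a \<in> carrier (G i)" "b \<in> carrier (G i)"
        "amalgam_incl I G H \<phi> i a = amalgam_incl I G H \<phi> i b"
      then have "nact i a base = nact i b base" using p [OF ab(1)] p [OF ab(2)] by simp
      then show "a = b"
        using free_action.act_cancel [OF free_action_nact [OF i] ab(1,2) base_mem] by blast
    qed
    then show ?thesis
      using E(3) i amalgam_incl_hom [OF i]
      by (simp add: extends_ordering_def order_preserving_hom_def C_def p)
  qed
  show ?thesis using 1 2 by blast
qed

end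

section \<open>Rational points of the circle, rationals and integers\<close>

definition commensurable_elements :: "('h, 'n) monoid_scheme \<Rightarrow> bool"
  where "commensurable_elements H \<longleftrightarrow>
    (\<forall>h\<in>carrier H. \<forall>k\<in>carrier H. h \<noteq> \<one>\<^bsub>H\<^esub> \<longrightarrow> k \<noteq> \<one>\<^bsub>H\<^esub> \<longrightarrow>
      (\<exists>(m::int) (n::int). m \<noteq> 0 \<and> n \<noteq> 0 \<and> h [^]\<^bsub>H\<^esub> m = k [^]\<^bsub>H\<^esub> n))"

lemma commensurable_elements_iso:
  assumes H: "group H" and K: "group K" and f: "f \<in> iso H K" and com: "commensurable_elements K"
  shows "commensurable_elements H"
  unfolding commensurable_elements_def
proof (intro ballI impI)
  fix h k assume hk: "h \<in> carrier H" "k \<in> carrier H" "h \<noteq> \<one>\<^bsub>H\<^esub>" "k \<noteq> \<one>\<^bsub>H\<^esub>"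
  have hom: "f \<in> hom H K" and inj: "inj_on f (carrier H)"
    using f by (auto simp: iso_def bij_betw_def)
  have one: "\<one>\<^bsub>H\<^esub> \<in> carrier H" "f \<one>\<^bsub>H\<^esub> = \<one>\<^bsub>K\<^esub>"
    using hom_one [OF hom H K] group.is_monoid [OF H] by (auto simp: monoid.one_closed)
  have "f h \<in> carrier K" "f k \<in> carrier K" using hom_in_carrier [OF hom] hk by auto
  moreover have "f h \<noteq> \<one>\<^bsub>K\<^esub>" "f k \<noteq> \<one>\<^bsub>K\<^esub>"
    using hk one inj_on_eq_iff [OF inj] by metis+
  ultimately obtain m n :: int where mn: "m \<noteq> 0" "n \<noteq> 0" "f h [^]\<^bsub>K\<^esub> m = f k [^]\<^bsub>K\<^esub> n"
    using com unfolding commensurable_elements_def by blast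
  have "f (h [^]\<^bsub>H\<^esub> m) = f (k [^]\<^bsub>H\<^esub> n)"
    using mn(3) hom_int_pow [OF hom hk(1) H K] hom_int_pow [OF hom hk(2) H K] by simp
  then have "h [^]\<^bsub>H\<^esub> m = k [^]\<^bsub>H\<^esub> n"
    using inj_on_eq_iff [OF inj] group.int_pow_closed [OF H] hk by blast
  then show "\<exists>(m::int) (n::int). m \<noteq> 0 \<and> n \<noteq> 0 \<and> h [^]\<^bsub>H\<^esub> m = k [^]\<^bsub>H\<^esub> n" using mn by blast
qed

text \<open>Every rational point of the circle is a root of unity, so all elements have \<open>1\<close> as a nonzero
  power.\<close>

lemma commensurable_elements_rational_circle:
  assumes K: "subgroup K rational_circle_group"
  shows "commensurable_elements (rational_circle_group\<lparr>carrier := K\<rparr>)"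
proof -
  interpret R: group rational_circle_group by (rule group_rational_circle_group)
  have pow: "x [^]\<^bsub>rational_circle_group\<^esub> n = x ^ n" for x and n :: nat
    by (induction n) (simp_all add: rational_circle_group_def mult.commute)
  have one: "\<one>\<^bsub>rational_circle_group\<^esub> = 1" by (simp add: rational_circle_group_def)
  have tors: "\<exists>n::nat. n > 0 \<and> x [^]\<^bsub>rational_circle_group\<lparr>carrier := K\<rparr>\<^esub> n = \<one>\<^bsub>rational_circle_group\<^esub>"
    if x: "x \<in> K" for x
  proof -
    have "x \<in> carrier rational_circle_group" using subgroup.mem_carrier [OF K x] .
    then obtain q where q: "x = exp (2 * of_real pi * \<i> * of_rat q)"
      by (auto simp: rational_circle_group_def)
    obtain a b where ab: "q = Rat.Fract a b" "b > 0" by (cases q) auto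
    have "of_rat q = complex_of_real (of_int a / of_int b)" using ab by (simp add: of_rat_rat)
    then have x_cis: "x = cis (2 * pi * (of_int a / of_int b))"
      unfolding q by (simp add: cis_conv_exp mult_ac)
    have "x ^ nat b = cis (real (nat b) * (2 * pi * (of_int a / of_int b)))"
      unfolding x_cis by (rule DeMoivre)
    also have "real (nat b) * (2 * pi * (of_int a / of_int b)) = 2 * pi * of_int a"
      using ab(2) by simp
    also have "cis (2 * pi * of_int a) = 1" by (rule cis_multiple_2pi) simp
    finally have "x ^ nat b = 1" .
    then have "x [^]\<^bsub>rational_circle_group\<lparr>carrier := K\<rparr>\<^esub> nat b = \<one>\<^bsub>rational_circle_group\<^esub>"
      using R.nat_pow_consistent [of x "nat b" K] pow [of x "nat b"] one by simp
    then show ?thesis using ab(2) by (intro exI [of _ "nat b"]) simp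
  qed
  show ?thesis
    unfolding commensurable_elements_def
  proof (intro ballI impI)
    fix h k assume hk: "h \<in> carrier (rational_circle_group\<lparr>carrier := K\<rparr>)"
      "k \<in> carrier (rational_circle_group\<lparr>carrier := K\<rparr>)"
    obtain m n :: nat where mn: "m > 0" "n > 0"
      "h [^]\<^bsub>rational_circle_group\<lparr>carrier := K\<rparr>\<^esub> m = k [^]\<^bsub>rational_circle_group\<lparr>carrier := K\<rparr>\<^esub> n"
      using tors [of h] tors [of k] hk by auto
    show "\<exists>(m::int) (n::int). m \<noteq> 0 \<and> n \<noteq> 0 \<and>
        h [^]\<^bsub>rational_circle_group\<lparr>carrier := K\<rparr>\<^esub> m = k [^]\<^bsub>rational_circle_group\<lparr>carrier := K\<rparr>\<^esub> n"
      by (intro exI [of _ "int m"] exI [of _ "int n"]) (use mn in \<open>simp add: int_pow_int\<close>)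
  qed
qed

lemma commensurable_elements_rational_group: "commensurable_elements rational_group"
proof -
  interpret group rational_group
    using circularly_ordered_rational_group by (simp add: circularly_ordered_group_def)
  have nat_pow: "x [^]\<^bsub>rational_group\<^esub> n = of_nat n * x" for x and n :: nat
    by (induction n) (simp_all add: rational_group_def algebra_simps)
  have inv: "inv\<^bsub>rational_group\<^esub> x = - x" for x
    by (rule inv_equality) (simp_all add: rational_group_def)
  have pow: "x [^]\<^bsub>rational_group\<^esub> n = of_int n * x" for x and n :: int
    by (simp add: int_pow_def2 nat_pow inv)
  show ?thesis
    unfolding commensurable_elements_def pow
  proof (intro ballI impI)
    fix p q assume ne: "p \<noteq> \<one>\<^bsub>rational_group\<^esub>" "q \<noteq> \<one>\<^bsub>rational_group\<^esub>"
    obtain a b where p: "p = Rat.Fract a b" "b > 0" by (cases p) auto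
    obtain e f where q: "q = Rat.Fract e f" "f > 0" by (cases q) auto
    have nz: "a \<noteq> 0" "e \<noteq> 0" using ne p q by (auto simp: rational_group_def rat_number_collapse)
    have "of_int (e * b) * p = of_int (a * f) * q"
      using p q by (simp add: Fract_of_int_quotient)
    then show "\<exists>(m::int) (n::int). m \<noteq> 0 \<and> n \<noteq> 0 \<and> of_int m * p = of_int n * q"
      using nz p(2) q(2) by (intro exI [of _ "e * b"] exI [of _ "a * f"]) simp
  qed
qed

lemma commensurable_elements_integer_group: "commensurable_elements integer_group"
  unfolding commensurable_elements_def
proof (intro ballI impI)
  fix h k :: int assume "h \<noteq> \<one>\<^bsub>integer_group\<^esub>" "k \<noteq> \<one>\<^bsub>integer_group\<^esub>"
  then show "\<exists>(m::int) (n::int). m \<noteq> 0 \<and> n \<noteq> 0 \<and> h [^]\<^bsub>integer_group\<^esub> m = k [^]\<^bsub>integer_group\<^esub> n"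
    by (intro exI [of _ k] exI [of _ h]) simp
qed

theorem proposition1p2:
  fixes I :: "'i set"
    and G :: "'i \<Rightarrow> ('g, 'm) monoid_scheme"
    and c :: "'i \<Rightarrow> 'g \<Rightarrow> 'g \<Rightarrow> 'g \<Rightarrow> int"
    and S :: "'i \<Rightarrow> 'g set"
    and H :: "('h, 'n) monoid_scheme"
    and d :: "'h \<Rightarrow> 'h \<Rightarrow> 'h \<Rightarrow> int"
    and \<phi> :: "'i \<Rightarrow> 'h \<Rightarrow> 'g"
  assumes "\<And>i. i \<in> I \<Longrightarrow> circularly_ordered_group (G i) (c i)"
    and "\<And>i. i \<in> I \<Longrightarrow> subgroup (S i) (G i)"
    and "circularly_ordered_group H d"
    and "\<And>i. i \<in> I \<Longrightarrow> order_preserving_iso H d ((G i)\<lparr>carrier := S i\<rparr>) (c i) (\<phi> i)"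
    and "(\<exists>K f. subgroup K rational_circle_group \<and>
            order_preserving_iso H d (rational_circle_group\<lparr>carrier := K\<rparr>) circle_ordering f) \<or>
         (\<exists>f. order_preserving_iso H d rational_group cyclic_ordering f) \<or>
         (\<exists>f. order_preserving_iso H d integer_group cyclic_ordering f)"
  shows "\<exists>C. circularly_ordered_group (amalgamated_product I G H \<phi>) C \<and>
             (\<forall>i\<in>I. extends_ordering I G H \<phi> C i (c i))"
proof -
  have groups: "group (G i)" if "i \<in> I" for i
    using assms(1) [OF that] by (simp add: circularly_ordered_group_def)
  have H: "group H" using assms(3) by (simp add: circularly_ordered_group_def)
  have hom: "\<phi> i \<in> hom H (G i)" if i: "i \<in> I" for i
    using assms(4) [OF i] subgroup.subset [OF assms(2) [OF i]]
    unfolding order_preserving_iso_def order_preserving_hom_def hom_def by auto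
  interpret amalgam_diagram I G H \<phi> by (rule amalgam_diagram.intro) (use groups hom in auto)
  show ?thesis
  \<comment> \<open>Without factors the amalgam is trivial; normal forms need an index to begin with.\<close>
  proof (cases "I = {}")
    case True
    then have "W = {[]}" by (auto simp: amalgam_words_def)
    then have "carrier P = {cls []}" by (simp add: carrier_P)
    then have "circular_ordering P (\<lambda>_ _ _. 0)" by (simp add: circular_ordering_def)
    then show ?thesis
      using True group_amalgamated_product by (auto simp: circularly_ordered_group_def)
  next
    case False
    have inj: "inj_on (\<phi> i) (carrier H)" if i: "i \<in> I" for i
      using assms(4) [OF i] by (simp add: order_preserving_iso_def iso_def bij_betw_def)
    interpret injective_amalgam I G H \<phi>
      by (intro injective_amalgam.intro amalgam_diagram_axioms injective_amalgam_axioms.intro)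
        (use False H inj in auto)
    have com: "commensurable_elements H"
      using assms(5)
    proof (elim disjE exE conjE)
      fix K f assume K: "subgroup K rational_circle_group"
        and f: "order_preserving_iso H d (rational_circle_group\<lparr>carrier := K\<rparr>) circle_ordering f"
      show ?thesis
        using commensurable_elements_iso [OF H
            subgroup.subgroup_is_group [OF K group_rational_circle_group] _
            commensurable_elements_rational_circle [OF K]] f
        by (auto simp: order_preserving_iso_def)
    next
      fix f assume f: "order_preserving_iso H d rational_group cyclic_ordering f"
      have "group rational_group"
        using circularly_ordered_rational_group by (simp add: circularly_ordered_group_def)
      then show ?thesis
        using commensurable_elements_iso [OF H _ _ commensurable_elements_rational_group] f
        by (auto simp: order_preserving_iso_def)
    next
      fix f assume f: "order_preserving_iso H d integer_group cyclic_ordering f"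
      show ?thesis
        using commensurable_elements_iso [OF H _ _ commensurable_elements_integer_group] f
        by (auto simp: order_preserving_iso_def)
    qed
    show ?thesis
    proof (rule amalgam_has_circular_ordering)
      show "circular_ordering (G i) (c i)" if "i \<in> I" for i
        using assms(1) [OF that] by (simp add: circularly_ordered_group_def)
      show "c i (\<phi> i h) (\<phi> i k) (\<phi> i l) = c j (\<phi> j h) (\<phi> j k) (\<phi> j l)"
        if "i \<in> I" "j \<in> I" "h \<in> carrier H" "k \<in> carrier H" "l \<in> carrier H" for i j h k l
        using assms(4) [OF that(1)] assms(4) [OF that(2)] that(3-5)
        unfolding order_preserving_iso_def order_preserving_hom_def by metis
    qed (use com in \<open>auto simp: commensurable_elements_def\<close>)
  qed
qed

end
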